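(* Let $\mathcal{A}:\mathbb{R}^{n\times n}\to\mathbb{R}^{\mu n^2}$ denote the random linear transformation $\mathcal{A}(X)=\mathbf{A}\operatorname{vec}(X)$, where $\mathbf{A}$ is a random $\mu n^2\times n^2$ matrix with i.i.d. Gaussian entries of mean zero and variance one. Define the two functions $$f(\beta,\epsilon)=\frac{8}{3\pi}\,\frac{(1-\beta)^{3/2}-\beta^{3/2}-4\epsilon}{1+4\epsilon},\qquad g(\beta,\epsilon)=\sqrt{2\beta(2-\beta)}\,\log\left(\frac{3\pi}{2\epsilon}\right).$$ Then, whenever $$\mu\ \ge\ 1-\sup_{\substack{\epsilon>0\\ f(\beta,\epsilon)-g(\beta,\epsilon)>0}}\left(f(\beta,\epsilon)-g(\beta,\epsilon)\right)^2,$$ there exists a numerical constant $c_s(\mu,\beta)>0$ (depending only on $\mu$ and $\beta$) such that with probability exceeding $1-e^{-c_s(\mu,\beta)n^2}$, for all $n\times n$ matrices $X_0$ of rank $r\le\beta n$ (simultaneously), $$X_0=\arg\min\{\|Z\|_*\ :\ \mathcal{A}(Z)=\mathcal{A}(X_0)\}.$$ In particular, if $\beta$ and $\mu$ satisfy the displayed inequality on $\mu$, then nuclear norm minimization will recover all rank $r$ matrices from a random set of $\mu n^2$ constraints drawn from the Gaussian ensemble almost surely as $n\to\infty$.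
   Context: $\|Z\|_*$ denotes the nuclear norm (sum of singular values) of $Z$. $\operatorname{vec}(X)\in\mathbb{R}^{n^2}$ is the vector obtained by stacking the columns of $X$. It is understood that $0\le\beta\le 1$, $\mu n^2$ is an integer. The supremum is over those $\epsilon>0$ with $f(\beta,\epsilon)-g(\beta,\epsilon)>0$; if there is no such $\epsilon$, the condition on $\mu$ is regarded as not satisfied. The constraints drawn from the Gaussian ensemble are the rows of $\mathbf{A}$, and nuclear norm minimization recovers $X_0$ if $X_0$ is the minimizer of $\|Z\|_*$ subject to $\mathcal{A}(Z)=\mathcal{A}(X_0)$.
   Formalization: The supremum is taken only over ε with log(3π/(2ε)) ≥ 0 (equivalently f > 0); over all ε > 0 with f − g > 0 it is infinite for every β > 0, so the condition on μ would be void and the claim false (e.g. μ = 0, β = 1/2). *)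

theory Defs
  imports "HOL-Probability.Probability" "Jordan_Normal_Form.DL_Rank"
    "Jordan_Normal_Form.Char_Poly"
begin

text \<open>The matrix size n varies inside the statement (the constant must not depend on it), so
  matrices are the dimension-carrying \<^typ>\<open>real mat\<close> rather than matrices with a type as index.\<close>

(* proots counts roots with multiplicity; X^T X is symmetric positive semidefinite, so all roots
   of its characteristic polynomial are real and nonnegative, one for each column of X. *)
definition singular_values :: "real mat \<Rightarrow> real multiset" where
  "singular_values X = image_mset sqrt (proots (char_poly (transpose_mat X * X)))"

definition nuclear_norm :: "real mat \<Rightarrow> real" where
  "nuclear_norm X = sum_mset (singular_values X)"

(* Entry (i, j) of X has position j * dim_row X + i in the stacked columns. *)
definition vec_of_cols :: "real mat \<Rightarrow> real Matrix.vec" where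
  "vec_of_cols X = Matrix.vec (dim_row X * dim_col X)
     (\<lambda>k. X $$ (k mod dim_row X, k div dim_row X))"

definition lin_map :: "real mat \<Rightarrow> real mat \<Rightarrow> real Matrix.vec" where
  "lin_map A X = A *\<^sub>v vec_of_cols X"

definition nuclear_argmin :: "nat \<Rightarrow> real mat \<Rightarrow> real mat \<Rightarrow> real mat set" where
  "nuclear_argmin n A X0 =
     {X. is_arg_min nuclear_norm (\<lambda>Z. Z \<in> carrier_mat n n \<and> lin_map A Z = lin_map A X0) X}"

(* X0 = argmin is read as: X0 is the one and only minimizer. *)
definition recovers :: "nat \<Rightarrow> real mat \<Rightarrow> real mat \<Rightarrow> bool" where
  "recovers n A X0 \<longleftrightarrow> nuclear_argmin n A X0 = {X0}"

definition recovers_low_rank :: "nat \<Rightarrow> real \<Rightarrow> real mat \<Rightarrow> bool" where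
  "recovers_low_rank n \<beta> A \<longleftrightarrow>
     (\<forall>X0 \<in> carrier_mat n n. real (vec_space.rank n X0) \<le> \<beta> * real n \<longrightarrow> recovers n A X0)"

definition gaussian_ensemble :: "nat \<Rightarrow> nat \<Rightarrow> (nat \<times> nat \<Rightarrow> real) measure" where
  "gaussian_ensemble m k = Pi\<^sub>M ({..<m} \<times> {..<k}) (\<lambda>_. std_normal_distribution)"

definition gaussian_random_matrix ::
    "'w measure \<Rightarrow> nat \<Rightarrow> nat \<Rightarrow> ('w \<Rightarrow> real mat) \<Rightarrow> bool" where
  "gaussian_random_matrix M m k A \<longleftrightarrow>
     (\<forall>\<omega> \<in> space M. A \<omega> \<in> carrier_mat m k) \<and>
     prob_space.indep_vars M (\<lambda>_. borel) (\<lambda>ij \<omega>. A \<omega> $$ ij) ({..<m} \<times> {..<k}) \<and>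
     (\<forall>ij \<in> {..<m} \<times> {..<k}. distributed M lborel (\<lambda>\<omega>. A \<omega> $$ ij) std_normal_density)"

definition f_strong :: "real \<Rightarrow> real \<Rightarrow> real" where
  "f_strong \<beta> \<epsilon> = 8 / (3 * pi) *
     (((1 - \<beta>) powr (3/2) - \<beta> powr (3/2) - 4 * \<epsilon>) / (1 + 4 * \<epsilon>))"

definition g_strong :: "real \<Rightarrow> real \<Rightarrow> real" where
  "g_strong \<beta> \<epsilon> = sqrt (2 * \<beta> * (2 - \<beta>)) * ln (3 * pi / (2 * \<epsilon>))"

text \<open>The radius \<^term>\<open>\<epsilon>\<close> is confined to the range where the logarithm in
  \<^const>\<open>g_strong\<close> (of a bound on the size of an \<^term>\<open>\<epsilon>\<close>-net) is nonnegative. Without this, for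
  \<^prop>\<open>\<beta> > 0\<close> the difference would tend to infinity as \<^term>\<open>\<epsilon>\<close> grows, the supremum would be
  infinite and the condition on \<^term>\<open>\<mu>\<close> void. For \<^prop>\<open>0 \<le> \<beta> \<and> \<beta> \<le> 1\<close> the confinement is the same
  as requiring \<^term>\<open>f_strong \<beta> \<epsilon>\<close> to be positive.\<close>

definition admissible_eps :: "real \<Rightarrow> real set" where
  "admissible_eps \<beta> =
     {\<epsilon>. \<epsilon> > 0 \<and> ln (3 * pi / (2 * \<epsilon>)) \<ge> 0 \<and> f_strong \<beta> \<epsilon> - g_strong \<beta> \<epsilon> > 0}"

definition strong_bound :: "real \<Rightarrow> real \<Rightarrow> bool" where
  "strong_bound \<mu> \<beta> \<longleftrightarrow> admissible_eps \<beta> \<noteq> {} \<and>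
     \<mu> \<ge> 1 - (SUP \<epsilon> \<in> admissible_eps \<beta>. (f_strong \<beta> \<epsilon> - g_strong \<beta> \<epsilon>)\<^sup>2)"

lemma admissible_eps_iff_f_pos:
  assumes "0 \<le> \<beta>" "\<beta> \<le> 1"
  shows "\<epsilon> \<in> admissible_eps \<beta> \<longleftrightarrow>
    \<epsilon> > 0 \<and> f_strong \<beta> \<epsilon> > 0 \<and> f_strong \<beta> \<epsilon> - g_strong \<beta> \<epsilon> > 0"
proof -
  have s: "sqrt (2 * \<beta> * (2 - \<beta>)) \<ge> 0" using assms by simp
  have "ln (3 * pi / (2 * \<epsilon>)) \<ge> 0" if e: "\<epsilon> > 0" and f: "f_strong \<beta> \<epsilon> > 0"
  proof -
    have "(1 - \<beta>) powr (3/2) \<le> 1" using assms by (intro powr_le1) auto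
    moreover have "(1 - \<beta>) powr (3/2) - \<beta> powr (3/2) - 4 * \<epsilon> > 0"
    proof (rule ccontr)
      assume "\<not> ?thesis"
      then have "f_strong \<beta> \<epsilon> \<le> 0" unfolding f_strong_def using e
        by (intro mult_nonneg_nonpos divide_nonpos_nonneg) auto
      with f show False by simp
    qed
    moreover have "\<beta> powr (3/2) \<ge> 0" by simp
    ultimately have "\<epsilon> < 1/4" by linarith
    then have "3 * pi / (2 * \<epsilon>) \<ge> 1" using e pi_gt3 by (simp add: field_simps)
    then show ?thesis by simp
  qed
  moreover have "g_strong \<beta> \<epsilon> \<ge> 0" if "ln (3 * pi / (2 * \<epsilon>)) \<ge> 0"
    unfolding g_strong_def using s that by (rule mult_nonneg_nonneg)
  ultimately show ?thesis
    unfolding admissible_eps_def by force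
qed

lemma bdd_above_admissible:
  assumes "0 \<le> \<beta>" "\<beta> \<le> 1"
  shows "bdd_above ((\<lambda>\<epsilon>. (f_strong \<beta> \<epsilon> - g_strong \<beta> \<epsilon>)\<^sup>2) ` admissible_eps \<beta>)"
proof (rule bdd_aboveI2)
  fix \<epsilon> assume a: "\<epsilon> \<in> admissible_eps \<beta>"
  then have e: "\<epsilon> > 0" and l: "ln (3 * pi / (2 * \<epsilon>)) \<ge> 0"
    and d: "f_strong \<beta> \<epsilon> - g_strong \<beta> \<epsilon> > 0" by (auto simp: admissible_eps_def)
  have "sqrt (2 * \<beta> * (2 - \<beta>)) \<ge> 0" using assms by simp
  then have g: "g_strong \<beta> \<epsilon> \<ge> 0" unfolding g_strong_def using l by (rule mult_nonneg_nonneg)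
  have "(1 - \<beta>) powr (3/2) \<le> 1" using assms by (intro powr_le1) auto
  moreover have "\<beta> powr (3/2) \<ge> 0" by simp
  ultimately have "(1 - \<beta>) powr (3/2) - \<beta> powr (3/2) - 4 * \<epsilon> \<le> 1 + 4 * \<epsilon>" using e by linarith
  then have "((1 - \<beta>) powr (3/2) - \<beta> powr (3/2) - 4 * \<epsilon>) / (1 + 4 * \<epsilon>) \<le> 1"
    using e by (simp add: divide_le_eq)
  then have "f_strong \<beta> \<epsilon> \<le> 8 / (3 * pi) * 1"
    unfolding f_strong_def by (intro mult_left_mono) auto
  then show "(f_strong \<beta> \<epsilon> - g_strong \<beta> \<epsilon>)\<^sup>2 \<le> (8 / (3 * pi))\<^sup>2"
    using g d by (intro power_mono) auto
qed

end

theory Submission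
  imports Defs
begin

text \<open>Gordon's comparison theorem is not needed: every \<^term>\<open>\<epsilon>\<close> that makes the gap
  between \<^const>\<open>f_strong\<close> and \<^const>\<open>g_strong\<close> positive satisfies
  ln(3 pi/(2 \<epsilon>)) \<ge> 5 (1 - 4 \<epsilon>), so the hypothesis gives
  1 - \<mu> \<le> (8/(3 pi) - 5 c)^2 with c^2 = 2 \<beta> (2 - \<beta>). In this range \<beta> is so small
  compared with \<mu> that a union bound over a net of low-rank matrices suffices.

  If X has rank at most r and X + H has no larger nuclear norm, then pairing X + H with a suitable
  partial isometry shows that H is within relative distance sqrt(1/32) of a matrix of rank 10 r. Unit
  matrices of this rank, written through singular vectors, are covered by at most 115^(20 r n) cells of
  diameter 1/10. Hence a failure of recovery puts one of finitely many fixed unit matrices W within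
  distance sqrt(1/12) of the kernel of the Gaussian matrix. By rotation invariance W may be replaced by a
  Gaussian vector and the kernel by a coordinate subspace, and a Chernoff bound for sums of squares
  beats the entropy of the net; the second part follows by Borel-Cantelli.\<close>

section \<open>Givens rotations\<close>

text \<open>Entropy and kernel draw on one budget. Put b = 8/(3 pi) <= 8/9. The kernel takes up a
  fraction of at most (b - 5 c)^2 of the n^2 dimensions, and \<beta> is about c^2/4, so that in
  units of (n^2/2) ln 7 the net costs at most 25 c^2; since 0 <= 5 c <= b, the sum 25 c^2 + (b - 5
  c)^2 is at most b^2 <= 64/81. The Chernoff exponent ln(14/3) exceeds (64/81) ln 7 by less than
  0.003, which leaves hardly any room in the constants: sqrt(1/32) + 1/10 has to stay below
  sqrt(1/12), and the net may have only a constant factor (115) per coordinate, without a logarithm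
  of n. Two obstacles shape the rest. Recovery quantifies over uncountably many X and H, so that its
  measurability is a question about projections of closed sets. And the size of the matrices varies,
  so that linear algebra is done on functions over finite index sets; orthogonal maps are generated
  by plane rotations, for which triangularization and Gaussian invariance are both
  inductions.\<close>

definition ip :: "'i set \<Rightarrow> ('i \<Rightarrow> real) \<Rightarrow> ('i \<Rightarrow> real) \<Rightarrow> real" where
  "ip I x y = (\<Sum>i\<in>I. x i * y i)"

lemma ip_commute: "ip I x y = ip I y x"
  by (simp add: ip_def mult.commute)

lemma ip_add_left: "ip I (\<lambda>k. x k + y k) z = ip I x z + ip I y z"
  by (simp add: ip_def algebra_simps sum.distrib)

lemma ip_diff_left: "ip I (\<lambda>k. x k - y k) z = ip I x z - ip I y z"
  by (simp add: ip_def algebra_simps sum_subtractf)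

lemma ip_scale_left: "ip I (\<lambda>k. a * x k) z = a * ip I x z"
  by (simp add: ip_def sum_distrib_left mult.assoc)

lemma ip_add_right: "ip I z (\<lambda>k. x k + y k) = ip I z x + ip I z y"
  by (simp add: ip_def algebra_simps sum.distrib)

lemma ip_diff_right: "ip I z (\<lambda>k. x k - y k) = ip I z x - ip I z y"
  by (simp add: ip_def algebra_simps sum_subtractf)

lemma ip_scale_right: "ip I z (\<lambda>k. a * x k) = a * ip I z x"
  by (simp add: ip_def sum_distrib_left algebra_simps)

lemma ip_sum_left: "ip I (\<lambda>k. \<Sum>l\<in>L. x l k) z = (\<Sum>l\<in>L. ip I (x l) z)"
  unfolding ip_def sum_distrib_right by (rule sum.swap)

lemma ip_sum_right: "ip I z (\<lambda>k. \<Sum>l\<in>L. x l k) = (\<Sum>l\<in>L. ip I z (x l))"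
  unfolding ip_def sum_distrib_left by (rule sum.swap)

lemma ip_cong: "(\<And>k. k \<in> I \<Longrightarrow> x k = x' k) \<Longrightarrow> (\<And>k. k \<in> I \<Longrightarrow> y k = y' k) \<Longrightarrow> ip I x y = ip I x' y'"
  by (simp add: ip_def)

lemma ip_self_nonneg: "0 \<le> ip I x x"
  by (simp add: ip_def sum_nonneg)

lemma ip_self_eq_0: "finite I \<Longrightarrow> ip I x x = 0 \<longleftrightarrow> (\<forall>k\<in>I. x k = 0)"
  by (simp add: ip_def sum_nonneg_eq_0_iff)

lemma ip_delta: "finite I \<Longrightarrow> p \<in> I \<Longrightarrow> ip I x (\<lambda>k. if k = p then 1 else 0) = x p"
  unfolding ip_def by (subst sum.remove[of _ p]) auto

definition givens :: "'i \<Rightarrow> 'i \<Rightarrow> real \<Rightarrow> real \<Rightarrow> ('i \<Rightarrow> real) \<Rightarrow> 'i \<Rightarrow> real" where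
  "givens i j c s x = x(i := c * x i + s * x j, j := - s * x i + c * x j)"

text \<open>Orthogonal maps given by generators: invariance has to be checked in one plane only.
  Coordinates outside \<open>I\<close> stay fixed, which keeps the maps within the extensional
  functions that carry the product measure.\<close>

inductive_set rotations :: "'i set \<Rightarrow> (('i \<Rightarrow> real) \<Rightarrow> 'i \<Rightarrow> real) set" for I where
  id: "id \<in> rotations I"
| step: "T \<in> rotations I \<Longrightarrow> i \<in> I \<Longrightarrow> j \<in> I \<Longrightarrow> i \<noteq> j \<Longrightarrow> c\<^sup>2 + s\<^sup>2 = 1
    \<Longrightarrow> givens i j c s \<circ> T \<in> rotations I"

lemma ip_givens:
  assumes "finite I" "i \<in> I" "j \<in> I" "i \<noteq> j" "c\<^sup>2 + s\<^sup>2 = 1"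
  shows "ip I (givens i j c s x) (givens i j c s y) = ip I x y"
proof -
  have I: "I = insert i (insert j (I - {i, j}))" using assms by auto
  have split: "ip I u v = u i * v i + (u j * v j + ip (I - {i, j}) u v)" for u v
    unfolding ip_def using assms by (subst I, subst sum.insert) auto
  have "ip (I - {i, j}) (givens i j c s x) (givens i j c s y) = ip (I - {i, j}) x y"
    by (rule ip_cong) (auto simp: givens_def)
  moreover have "(c * x i + s * x j) * (c * y i + s * y j) + (- s * x i + c * x j) * (- s * y i + c * y j)
      = (c\<^sup>2 + s\<^sup>2) * (x i * y i + x j * y j)"
    by (simp add: power2_eq_square algebra_simps)
  ultimately show ?thesis
    unfolding split using assms by (simp add: givens_def)
qed

lemma rotations_ip:
  "T \<in> rotations I \<Longrightarrow> finite I \<Longrightarrow> ip I (T x) (T y) = ip I x y"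
  by (induction rule: rotations.induct) (auto simp: ip_givens)

lemma rotations_comp: "S \<in> rotations I \<Longrightarrow> T \<in> rotations I \<Longrightarrow> S \<circ> T \<in> rotations I"
  by (induction rule: rotations.induct) (auto simp: comp_assoc intro: rotations.intros)

lemma rotations_linear:
  "T \<in> rotations I \<Longrightarrow> T (\<lambda>k. a * x k + b * y k) = (\<lambda>k. a * T x k + b * T y k)"
proof (induction rule: rotations.induct)
  case (step T i j c s)
  then show ?case by (auto simp: givens_def fun_eq_iff algebra_simps)
qed auto

lemma rotations_scale: "T \<in> rotations I \<Longrightarrow> T (\<lambda>k. a * x k) = (\<lambda>k. a * T x k)"
  using rotations_linear[of T I a x 0 x] by simp

lemma rotations_diff: "T \<in> rotations I \<Longrightarrow> T (\<lambda>k. x k - y k) = (\<lambda>k. T x k - T y k)"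
  using rotations_linear[of T I 1 x "-1" y] by simp

lemma rotations_sum:
  assumes "T \<in> rotations I" "finite L"
  shows "T (\<lambda>k. \<Sum>l\<in>L. a l * x l k) = (\<lambda>k. \<Sum>l\<in>L. a l * T (x l) k)"
  using assms(2)
proof induction
  case empty
  show ?case using rotations_scale[OF assms(1), of 0 "\<lambda>_. 0"] by simp
next
  case (insert l L)
  then show ?case using rotations_linear[OF assms(1), of "a l" "x l" 1 "\<lambda>k. \<Sum>l\<in>L. a l * x l k"] by simp
qed

lemma rotations_zero_on: "T \<in> rotations I \<Longrightarrow> (\<And>k. k \<in> I \<Longrightarrow> x k = 0) \<Longrightarrow> T x = x"
  by (induction rule: rotations.induct) (auto simp: givens_def)

lemma rotations_mono: "T \<in> rotations I \<Longrightarrow> I \<subseteq> J \<Longrightarrow> T \<in> rotations J"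
  by (induction rule: rotations.induct) (auto intro: rotations.intros)

lemma rotations_inverse:
  "T \<in> rotations I \<Longrightarrow> \<exists>T'\<in>rotations I. T \<circ> T' = id \<and> T' \<circ> T = id"
proof (induction rule: rotations.induct)
  case (step T i j c s)
  then obtain T' where T': "T' \<in> rotations I" "T \<circ> T' = id" "T' \<circ> T = id" by blast
  let ?G = "givens i j c s" and ?H = "givens i j c (- s)"
  have *: "c * (c * u + s * v) - s * (c * v - s * u) = u"
    "s * (c * u + s * v) + c * (c * v - s * u) = v"
    "c * (c * u - s * v) + s * (c * v + s * u) = u"
    "c * (c * v + s * u) - s * (c * u - s * v) = v" for u v
  proof -
    have "c * (c * u + s * v) - s * (c * v - s * u) = (c\<^sup>2 + s\<^sup>2) * u"
      "s * (c * u + s * v) + c * (c * v - s * u) = (c\<^sup>2 + s\<^sup>2) * v"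
      "c * (c * u - s * v) + s * (c * v + s * u) = (c\<^sup>2 + s\<^sup>2) * u"
      "c * (c * v + s * u) - s * (c * u - s * v) = (c\<^sup>2 + s\<^sup>2) * v"
      by (simp_all only: power2_eq_square) (simp_all add: algebra_simps)
    then show "c * (c * u + s * v) - s * (c * v - s * u) = u"
      "s * (c * u + s * v) + c * (c * v - s * u) = v"
      "c * (c * u - s * v) + s * (c * v + s * u) = u"
      "c * (c * v + s * u) - s * (c * u - s * v) = v"
      using \<open>c\<^sup>2 + s\<^sup>2 = 1\<close> by simp_all
  qed
  have **: "c * (c * u - s * v) + s * (s * u + c * v) = u" "c * (s * u + c * v) - s * (c * u - s * v) = v" for u v
    using *(3)[of u v] *(4)[of v u] by (simp_all only: add.commute)
  have "?G \<circ> ?H = id" "?H \<circ> ?G = id"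
    using \<open>i \<noteq> j\<close> * ** by (auto simp: givens_def fun_eq_iff)
  then have "(?G \<circ> T) \<circ> (T' \<circ> ?H) = id" "(T' \<circ> ?H) \<circ> (?G \<circ> T) = id"
    using T' by (metis comp_assoc comp_id)+
  moreover have "?H \<circ> id \<in> rotations I" using step by (intro rotations.intros) auto
  then have "T' \<circ> ?H \<in> rotations I" using T' by (intro rotations_comp) auto
  ultimately show ?case by blast
next
  case id
  show ?case using rotations.id by (intro bexI[of _ id]) auto
qed

lemma givens_annihilate:
  fixes u v :: real
  obtains c s where "c\<^sup>2 + s\<^sup>2 = 1" "- s * u + c * v = 0"
proof (cases "u = 0 \<and> v = 0")
  case True
  then show ?thesis using that[of 1 0] by simp
next
  case False
  define d where "d = sqrt (u\<^sup>2 + v\<^sup>2)"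
  have "u\<^sup>2 + v\<^sup>2 > 0" using False by (simp add: sum_power2_gt_zero_iff)
  then have d: "d\<^sup>2 = u\<^sup>2 + v\<^sup>2" "u\<^sup>2 + v\<^sup>2 \<noteq> 0" by (auto simp: d_def)
  have "(u / d)\<^sup>2 + (v / d)\<^sup>2 = 1"
    using d by (simp add: power_divide add_divide_distrib[symmetric])
  moreover have "- (v / d) * u + (u / d) * v = 0" by simp
  ultimately show ?thesis by (rule that)
qed

text \<open>Every other coordinate is rotated in turn into the pivot \<open>i\<close>; a step
  touches the pivot and one new coordinate, so earlier zeros survive.\<close>

lemma rotations_annihilate:
  assumes "finite I" "i \<in> I"
  shows "\<exists>T\<in>rotations I. \<forall>k\<in>I - {i}. T x k = 0"
proof -
  have "finite K \<Longrightarrow> i \<notin> K \<Longrightarrow> \<exists>T\<in>rotations (insert i K). \<forall>k\<in>K. T x k = 0" for K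
  proof (induction K rule: finite_induct)
    case empty
    show ?case by (auto intro: rotations.intros)
  next
    case (insert j K)
    then obtain T where T: "T \<in> rotations (insert i K)" "\<forall>k\<in>K. T x k = 0" by auto
    obtain c s where cs: "c\<^sup>2 + s\<^sup>2 = 1" "- s * T x i + c * T x j = 0" by (rule givens_annihilate)
    have "givens i j c s \<circ> T \<in> rotations (insert i (insert j K))"
      using T(1) cs insert by (intro rotations.step rotations_mono[OF T(1)]) auto
    moreover have "\<forall>k\<in>insert j K. (givens i j c s \<circ> T) x k = 0"
      using T(2) cs insert by (auto simp: givens_def)
    ultimately show ?case by blast
  qed
  from this[of "I - {i}"] assms show ?thesis by (simp add: insert_absorb)
qed

text \<open>QR factorization. The vectors already treated vanish on {p..<D}, so a rotation that acts
  only there leaves them fixed.\<close>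

lemma rotations_triangularize:
  fixes a :: "nat \<Rightarrow> nat \<Rightarrow> real"
  assumes "p \<le> D"
  shows "\<exists>T\<in>rotations {..<D}. \<forall>j<p. \<forall>k<D. j < k \<longrightarrow> T (a j) k = 0"
  using assms
proof (induction p)
  case 0
  show ?case by (auto intro: rotations.intros)
next
  case (Suc p)
  then obtain T where T: "T \<in> rotations {..<D}" "\<forall>j<p. \<forall>k<D. j < k \<longrightarrow> T (a j) k = 0" by auto
  obtain S where S: "S \<in> rotations {p..<D}" "\<forall>k\<in>{p..<D} - {p}. S (T (a p)) k = 0"
    using rotations_annihilate[of "{p..<D}" p "T (a p)"] Suc(2) by auto
  have "S \<circ> T \<in> rotations {..<D}"
    using S T by (intro rotations_comp rotations_mono[OF S(1)]) auto
  moreover have "(S \<circ> T) (a j) k = 0" if "j < Suc p" "k < D" "j < k" for j k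
  proof (cases "j = p")
    case True
    then show ?thesis using S that by auto
  next
    case False
    then have "j < p" using that by simp
    then have "S (T (a j)) = T (a j)" using T by (intro rotations_zero_on[OF S(1)]) auto
    then show ?thesis using T \<open>j < p\<close> that by auto
  qed
  ultimately show ?case by blast
qed

text \<open>Triangularization confines the \<open>p\<close> rows to the first \<open>p\<close>
  coordinates. The basis vector with index \<open>p\<close> is then orthogonal to all of them and is
  rotated back; its norm 1 records that the solution is not trivial.\<close>

lemma homogeneous_solution:
  fixes M :: "nat \<Rightarrow> nat \<Rightarrow> real"
  assumes "p < q"
  shows "\<exists>t. (\<Sum>j<q. (t j)\<^sup>2) = 1 \<and> (\<forall>k<p. (\<Sum>j<q. M k j * t j) = 0)"
proof -
  obtain T where T: "T \<in> rotations {..<q}" "\<forall>j<p. \<forall>k<q. j < k \<longrightarrow> T (M j) k = 0"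
    using rotations_triangularize[of p q M] assms by auto
  obtain T' where T': "T' \<in> rotations {..<q}" "T \<circ> T' = id" using rotations_inverse[OF T(1)] by blast
  define e :: "nat \<Rightarrow> real" where "e = (\<lambda>k. if k = p then 1 else 0)"
  have TT: "T (T' e) = e" using T'(2) by (metis comp_apply id_apply)
  have "ip {..<q} (T' e) (T' e) = ip {..<q} e e" by (rule rotations_ip) (use T' in auto)
  also have "\<dots> = 1" using ip_delta[of "{..<q}" p e] assms by (simp add: e_def)
  finally have 1: "(\<Sum>j<q. (T' e j)\<^sup>2) = 1" by (simp add: ip_def power2_eq_square)
  have "(\<Sum>j<q. M k j * T' e j) = 0" if "k < p" for k
  proof -
    have "ip {..<q} (M k) (T' e) = ip {..<q} (T (M k)) (T (T' e))"
      by (rule rotations_ip[symmetric]) (use T in auto)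
    also have "\<dots> = T (M k) p" unfolding TT unfolding e_def using assms by (intro ip_delta) auto
    also have "\<dots> = 0" using T that assms by auto
    finally show ?thesis by (simp add: ip_def)
  qed
  with 1 show ?thesis by blast
qed

section \<open>Orthonormal families and diagonalization of symmetric matrices\<close>

text \<open>Tychonoff for the product topology of the function type. It serves the extremal argument
  of the diagonalization and the projections of closed sets.\<close>

lemma compact_box: "compact {y :: 'i \<Rightarrow> real. \<forall>i. \<bar>y i\<bar> \<le> K}"
proof -
  have "compactin (product_topology (\<lambda>_. euclidean) UNIV) (PiE UNIV (\<lambda>_::'i. {-K..K}))"
    by (subst compactin_PiE) auto
  moreover have "PiE UNIV (\<lambda>_::'i. {-K..K}) = {y. \<forall>i. \<bar>y i\<bar> \<le> K}"
    by (auto simp: PiE_def Pi_def abs_le_iff) (metis neg_le_iff_le minus_minus)+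
  ultimately show ?thesis by (simp add: euclidean_product_topology)
qed

definition orthonormal :: "nat \<Rightarrow> nat \<Rightarrow> (nat \<Rightarrow> nat \<Rightarrow> real) \<Rightarrow> bool" where
  "orthonormal n p v \<longleftrightarrow> (\<forall>l<p. \<forall>m<p. ip {..<n} (v l) (v m) = (if l = m then 1 else 0))"

definition bilin :: "nat \<Rightarrow> (nat \<Rightarrow> nat \<Rightarrow> real) \<Rightarrow> (nat \<Rightarrow> real) \<Rightarrow> (nat \<Rightarrow> real) \<Rightarrow> real" where
  "bilin n M x y = (\<Sum>i<n. \<Sum>j<n. x i * M i j * y j)"

lemma bilin_linear:
  "bilin n M (\<lambda>i. a * x i + b * y i) z = a * bilin n M x z + b * bilin n M y z"
  "bilin n M z (\<lambda>i. a * x i + b * y i) = a * bilin n M z x + b * bilin n M z y"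
  by (simp_all add: bilin_def algebra_simps sum.distrib sum_distrib_left)

lemma bilin_commute:
  assumes "\<And>i j. i < n \<Longrightarrow> j < n \<Longrightarrow> M i j = M j i"
  shows "bilin n M x y = bilin n M y x"
  unfolding bilin_def by (subst sum.swap) (auto intro!: sum.cong simp: assms)

(* If d were nonzero, the terms linear in t would dominate for small t of the right sign. *)
lemma linear_coeff_zero:
  fixes d e :: real
  assumes "\<And>t. t\<^sup>2 * e + t * d \<le> 0"
  shows "d = 0"
proof (rule ccontr)
  assume "d \<noteq> 0"
  define E where "E = \<bar>e\<bar> + 1"
  have "E > 0" "e + E > 0" by (auto simp: E_def)
  have "(d / E)\<^sup>2 * e + (d / E) * d = d\<^sup>2 * (e + E) / E\<^sup>2"
    using \<open>E > 0\<close> by (simp add: power2_eq_square field_simps)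
  moreover have "d\<^sup>2 * (e + E) / E\<^sup>2 > 0" using \<open>d \<noteq> 0\<close> \<open>E > 0\<close> \<open>e + E > 0\<close> by simp
  ultimately show False using assms[of "d / E"] by simp
qed

text \<open>A maximizer of a weighted trace over orthonormal frames, with distinct weights, diagonalizes
  the form: rotating two vectors of the frame must not increase the weighted trace.\<close>

lemma symmetric_diagonalization:
  assumes sym: "\<And>i j. i < n \<Longrightarrow> j < n \<Longrightarrow> M i j = (M j i :: real)"
  obtains V where "orthonormal n n V"
    and "\<And>l m. l < n \<Longrightarrow> m < n \<Longrightarrow> l \<noteq> m \<Longrightarrow> bilin n M (V l) (V m) = 0"
proof -
  define F :: "(nat \<times> nat \<Rightarrow> real) \<Rightarrow> nat \<Rightarrow> nat \<Rightarrow> real" where "F = (\<lambda>v l i. v (l, i))"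
  \<comment> \<open>Only the n by n block carries the frame, but compactness in the space of all
    functions asks for a bound on every coordinate.\<close>
  define S where "S = {v :: nat \<times> nat \<Rightarrow> real. \<forall>p. \<bar>v p\<bar> \<le> 1} \<inter> {v. orthonormal n n (F v)}"
  have "closed {v. orthonormal n n (F v)}"
    unfolding orthonormal_def ip_def F_def Collect_conj_eq
    by (intro closed_Collect_all closed_Collect_imp closed_Collect_eq continuous_intros
        continuous_on_product_coordinates) auto
  then have "compact S"
    unfolding S_def by (intro compact_Int_closed compact_box)
  define g where "g = (\<lambda>v. \<Sum>l<n. real l * bilin n M (F v l) (F v l))"
  have "continuous_on S g"
    unfolding g_def bilin_def F_def
    by (intro continuous_intros continuous_on_subset[OF continuous_on_product_coordinates]) auto
  moreover have "(\<lambda>(l, i). if l = i then 1 else 0) \<in> S"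
    by (auto simp: S_def F_def orthonormal_def ip_def if_distrib[of "\<lambda>x. x * _"] cong: if_cong)
  ultimately obtain v where v: "v \<in> S" and max: "\<And>w. w \<in> S \<Longrightarrow> g w \<le> g v"
    using continuous_attains_sup[OF \<open>compact S\<close>, of g] by blast
  let ?V = "F v"
  have orth: "orthonormal n n ?V" using v by (simp add: S_def)
  have "bilin n M (?V l) (?V m) = 0" if lm: "l < n" "m < n" "l \<noteq> m" for l m
  proof -
    let ?q = "\<lambda>l m. bilin n M (?V l) (?V m)"
    have "t\<^sup>2 * ((real l - real m) * (?q m m - ?q l l)) + t * (2 * (real l - real m) * ?q l m) \<le> 0" for t
    proof -
      \<comment> \<open>Cosine of the angle with tangent \<open>t\<close>: after division by c^2 the
        comparison of the weighted traces is a quadratic polynomial in \<open>t\<close> without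
        constant term.\<close>
      define c where "c = 1 / sqrt (1 + t\<^sup>2)"
      define s where "s = t * c"
      have pos: "1 + t\<^sup>2 > 0" by (simp add: add_pos_nonneg)
      have c2: "c\<^sup>2 * (1 + t\<^sup>2) = 1" "c > 0" using pos by (simp_all add: c_def power_divide)
      have cs: "c\<^sup>2 + s\<^sup>2 = 1" using c2(1) by (simp add: s_def power_mult_distrib algebra_simps)
      define x y where "x = (\<lambda>i. c * ?V l i + s * ?V m i)" and "y = (\<lambda>i. (- s) * ?V l i + c * ?V m i)"
      define U where "U = ?V(l := x, m := y)"
      \<comment> \<open>Cut off outside the block, where the rotated vectors could leave the unit
        box.\<close>
      define w where "w = (\<lambda>(k, i). if k < n \<and> i < n then U k i else 0)"
      have ipV: "ip {..<n} (?V a) (?V b) = (if a = b then 1 else 0)" if "a < n" "b < n" for a b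
        using orth that by (simp add: orthonormal_def)
      have ipU: "orthonormal n n U"
      proof -
        have "ip {..<n} x x = 1" "ip {..<n} y y = 1"
          unfolding x_def y_def ip_add_left ip_add_right ip_scale_left ip_scale_right
          using cs lm by (simp_all add: ipV power2_eq_square)
        moreover have "ip {..<n} x y = 0"
          unfolding x_def y_def ip_add_left ip_add_right ip_scale_left ip_scale_right
          using cs lm by (simp add: ipV)
        moreover have "ip {..<n} y x = 0" using calculation(3) by (simp add: ip_commute)
        moreover have "ip {..<n} x (?V a) = 0" "ip {..<n} y (?V a) = 0" if "a < n" "a \<noteq> l" "a \<noteq> m" for a
          unfolding x_def y_def ip_add_left ip_scale_left using ipV that lm by auto
        moreover from this have "ip {..<n} (?V a) x = 0" "ip {..<n} (?V a) y = 0" if "a < n" "a \<noteq> l" "a \<noteq> m" for a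
          using that by (simp_all add: ip_commute)
        ultimately show ?thesis
          using lm unfolding orthonormal_def U_def by (auto simp: ipV)
      qed
      have Fw: "ip {..<n} (F w a) (F w b) = ip {..<n} (U a) (U b)" if "a < n" "b < n" for a b
        using that by (intro ip_cong) (auto simp: F_def w_def)
      have orthw: "orthonormal n n (F w)" using ipU Fw by (simp add: orthonormal_def)
      have "\<bar>w p\<bar> \<le> 1" for p
      proof -
        obtain k i where p: "p = (k, i)" by (cases p)
        show ?thesis
        proof (cases "k < n \<and> i < n")
          case True
          then have "(w (k, i))\<^sup>2 \<le> (\<Sum>i<n. (w (k, i))\<^sup>2)" by (intro member_le_sum) auto
          also have "\<dots> = 1" using orthw True by (simp add: orthonormal_def ip_def F_def power2_eq_square)
          finally show ?thesis using abs_square_le_1 p by blast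
        qed (auto simp: w_def p)
      qed
      then have "w \<in> S" using orthw by (simp add: S_def)
      then have "g w \<le> g v" by (rule max)
      moreover have "g w = (\<Sum>k<n. real k * bilin n M (U k) (U k))"
        unfolding g_def bilin_def by (intro sum.cong refl) (auto simp: F_def w_def intro!: sum.cong)
      moreover have split: "(\<Sum>k<n. h k) = h l + h m + (\<Sum>k\<in>{..<n} - {l, m}. h k)" for h :: "nat \<Rightarrow> real"
      proof -
        have "{..<n} = insert l (insert m ({..<n} - {l, m}))" using lm by auto
        then show ?thesis using lm by (subst \<open>{..<n} = _\<close>, subst sum.insert) auto
      qed
      moreover have "(\<Sum>k\<in>{..<n} - {l, m}. real k * bilin n M (U k) (U k))
          = (\<Sum>k\<in>{..<n} - {l, m}. real k * ?q k k)"
        by (intro sum.cong) (auto simp: U_def)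
      ultimately have "real l * bilin n M x x + real m * bilin n M y y \<le> real l * ?q l l + real m * ?q m m"
        using lm unfolding g_def by (simp add: U_def)
      moreover have "bilin n M x x = c\<^sup>2 * ?q l l + 2 * c * s * ?q l m + s\<^sup>2 * ?q m m"
        "bilin n M y y = s\<^sup>2 * ?q l l - 2 * c * s * ?q l m + c\<^sup>2 * ?q m m"
        unfolding x_def y_def bilin_linear using bilin_commute[OF sym, where ?x = "?V m" and ?y = "?V l"]
        by (simp_all add: power2_eq_square algebra_simps)
      ultimately have "real l * (c\<^sup>2 * ?q l l + 2 * c * s * ?q l m + s\<^sup>2 * ?q m m)
         + real m * (s\<^sup>2 * ?q l l - 2 * c * s * ?q l m + c\<^sup>2 * ?q m m)
         - (c\<^sup>2 + s\<^sup>2) * (real l * ?q l l + real m * ?q m m) \<le> 0"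
        using cs by simp
      also have "real l * (c\<^sup>2 * ?q l l + 2 * c * s * ?q l m + s\<^sup>2 * ?q m m)
         + real m * (s\<^sup>2 * ?q l l - 2 * c * s * ?q l m + c\<^sup>2 * ?q m m)
         - (c\<^sup>2 + s\<^sup>2) * (real l * ?q l l + real m * ?q m m)
         = c\<^sup>2 * (t\<^sup>2 * ((real l - real m) * (?q m m - ?q l l)) + t * (2 * (real l - real m) * ?q l m))"
        unfolding s_def by (simp add: power2_eq_square algebra_simps)
      finally show ?thesis using c2(2) by (simp add: mult_le_0_iff)
    qed
    then have "2 * (real l - real m) * ?q l m = 0" by (rule linear_coeff_zero)
    then show ?thesis using lm by simp
  qed
  with orth show ?thesis by (rule that)
qed

text \<open>For square matrices a right inverse is a left inverse, so orthonormal rows give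
  orthonormal columns, that is, a resolution of the identity.\<close>

lemma orthonormal_complete:
  assumes "orthonormal n n V" "i < n" "j < n"
  shows "(\<Sum>l<n. V l i * V l j) = (if i = j then 1 else 0)"
proof -
  let ?A = "Matrix.mat n n (\<lambda>(l, i). V l i)"
  let ?B = "Matrix.mat n n (\<lambda>(i, l). V l i)"
  have "?A * ?B = 1\<^sub>m n"
    using assms(1) by (intro eq_matI) (auto simp: scalar_prod_def orthonormal_def ip_def lessThan_atLeast0)
  then have "?B * ?A = 1\<^sub>m n" by (intro mat_mult_left_right_inverse[of ?A n ?B]) auto
  then have "(?B * ?A) $$ (i, j) = (1\<^sub>m n) $$ (i, j)" by simp
  then show ?thesis using assms by (simp add: scalar_prod_def lessThan_atLeast0)
qed

lemma bessel:
  assumes "orthonormal n p u"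
  shows "(\<Sum>k<p. (ip {..<n} (u k) x)\<^sup>2) \<le> ip {..<n} x x"
proof -
  define a where "a = (\<lambda>k. ip {..<n} (u k) x)"
  define y where "y = (\<lambda>i. \<Sum>k<p. a k * u k i)"
  have xy: "ip {..<n} x y = (\<Sum>k<p. (a k)\<^sup>2)" "ip {..<n} y x = (\<Sum>k<p. (a k)\<^sup>2)"
    unfolding y_def ip_sum_right ip_sum_left ip_scale_left ip_scale_right
    by (simp_all add: a_def power2_eq_square ip_commute[of _ x])
  have yy: "ip {..<n} y y = (\<Sum>k<p. (a k)\<^sup>2)"
  proof -
    have "ip {..<n} y y = (\<Sum>k<p. a k * (\<Sum>m<p. a m * ip {..<n} (u k) (u m)))"
      unfolding y_def ip_sum_left ip_scale_left unfolding ip_sum_right ip_scale_right ..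
    also have "\<dots> = (\<Sum>k<p. a k * (\<Sum>m<p. if m = k then a k else 0))"
      using assms by (intro sum.cong refl arg_cong2[of _ _ _ _ "(*)"]) (auto simp: orthonormal_def)
    also have "\<dots> = (\<Sum>k<p. (a k)\<^sup>2)" by (intro sum.cong) (auto simp: power2_eq_square)
    finally show ?thesis .
  qed
  have "0 \<le> ip {..<n} (\<lambda>i. x i - y i) (\<lambda>i. x i - y i)" by (rule ip_self_nonneg)
  also have "\<dots> = ip {..<n} x x - (\<Sum>k<p. (a k)\<^sup>2)"
    unfolding ip_diff_left ip_diff_right xy yy by simp
  finally show ?thesis by (simp add: a_def)
qed

lemma bessel_entry:
  assumes "orthonormal n p u" "i < n"
  shows "(\<Sum>k<p. (u k i)\<^sup>2) \<le> 1"
proof -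
  let ?e = "\<lambda>j. if j = i then 1 else (0::real)"
  have "ip {..<n} x ?e = x i" for x using ip_delta[of "{..<n}" i x] assms by simp
  then show ?thesis using bessel[OF assms(1), of ?e] by simp
qed

lemma sum_product_le_1:
  fixes a b :: "nat \<Rightarrow> real"
  assumes "(\<Sum>k<p. (a k)\<^sup>2) \<le> 1" "(\<Sum>k<p. (b k)\<^sup>2) \<le> 1"
  shows "\<bar>\<Sum>k<p. a k * b k\<bar> \<le> 1"
proof -
  have "(\<Sum>k<p. a k * b k)\<^sup>2 \<le> (\<Sum>k<p. (a k)\<^sup>2) * (\<Sum>k<p. (b k)\<^sup>2)"
    by (rule Cauchy_Schwarz_ineq_sum)
  also have "\<dots> \<le> 1 * 1" using assms by (intro mult_mono sum_nonneg) auto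
  finally show ?thesis by (simp add: abs_square_le_1)
qed

section \<open>Singular values and the nuclear norm\<close>

text \<open>Bridge from the characteristic polynomial in \<open>singular_values\<close> to frames:
  in the basis \<open>V\<close> the Gram matrix is diagonal, and similarity preserves the roots with
  their multiplicities.\<close>

lemma nuclear_norm_diagonalized:
  assumes X: "X \<in> carrier_mat n n" and V: "orthonormal n n V"
    and diag: "\<And>l m. l < n \<Longrightarrow> m < n \<Longrightarrow> l \<noteq> m \<Longrightarrow>
      bilin n (\<lambda>i j. \<Sum>k<n. X $$ (k, i) * X $$ (k, j)) (V l) (V m) = 0"
  shows "nuclear_norm X = (\<Sum>l<n. sqrt (bilin n (\<lambda>i j. \<Sum>k<n. X $$ (k, i) * X $$ (k, j)) (V l) (V l)))"
proof -
  define G where "G = (\<lambda>i j. \<Sum>k<n. X $$ (k, i) * X $$ (k, j))"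
  define q where "q = (\<lambda>l. bilin n G (V l) (V l))"
  define S where "S = transpose_mat X * X"
  define P where "P = Matrix.mat n n (\<lambda>(i, l). V l i)"
  define Q where "Q = Matrix.mat n n (\<lambda>(l, i). V l i)"
  define L where "L = Matrix.mat n n (\<lambda>(l, m). if l = m then q l else 0)"
  have carr: "S \<in> carrier_mat n n" "P \<in> carrier_mat n n" "Q \<in> carrier_mat n n" "L \<in> carrier_mat n n"
    using X by (auto simp: S_def P_def Q_def L_def)
  have S: "S $$ (i, j) = G i j" if "i < n" "j < n" for i j
    using X that by (simp add: S_def G_def scalar_prod_def lessThan_atLeast0)
  have PQ: "P * Q = 1\<^sub>m n"
    using orthonormal_complete[OF V]
    by (intro eq_matI) (auto simp: P_def Q_def scalar_prod_def lessThan_atLeast0)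
  then have QP: "Q * P = 1\<^sub>m n" using carr by (intro mat_mult_left_right_inverse[of P n Q])
  have QSP: "Q * S * P = L"
  proof (rule eq_matI)
    fix l m assume "l < dim_row L" "m < dim_col L"
    then have lm: "l < n" "m < n" by (auto simp: L_def)
    have QS: "(Q * S) $$ (l, j) = (\<Sum>i<n. V l i * G i j)" if "j < n" for j
      using carr that lm by (simp add: scalar_prod_def lessThan_atLeast0 S Q_def)
    have "(Q * S * P) $$ (l, m) = (\<Sum>j<n. (Q * S) $$ (l, j) * P $$ (j, m))"
    proof -
      have "Q * S \<in> carrier_mat n n" using carr by simp
      then have "(Q * S * P) $$ (l, m) = row (Q * S) l \<bullet> col P m"
        using carr lm by (intro index_mult_mat(1)) auto
      also have "\<dots> = (\<Sum>j<n. row (Q * S) l $ j * col P m $ j)"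
        using carr lm by (simp add: scalar_prod_def lessThan_atLeast0)
      also have "\<dots> = (\<Sum>j<n. (Q * S) $$ (l, j) * P $$ (j, m))"
        using carr lm by (intro sum.cong refl arg_cong2[of _ _ _ _ "(*)"] index_row(1) index_col) auto
      finally show ?thesis .
    qed
    also have "\<dots> = (\<Sum>j<n. (\<Sum>i<n. V l i * G i j) * V m j)"
      using lm by (intro sum.cong) (auto simp: QS P_def simp del: index_mult_mat(1))
    also have "\<dots> = bilin n G (V l) (V m)"
      unfolding bilin_def sum_distrib_right by (rule sum.swap)
    finally show "(Q * S * P) $$ (l, m) = L $$ (l, m)"
      using diag[OF lm] lm by (auto simp: L_def q_def G_def)
  qed (use carr in auto)
  have "P * L * Q = P * (Q * S * P) * Q" by (simp add: QSP)
  also have "\<dots> = (P * Q) * S * (P * Q)"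
    using carr by (simp add: assoc_mult_mat[where n\<^sub>1 = n and n\<^sub>2 = n and n\<^sub>3 = n and n\<^sub>4 = n])
  also have "\<dots> = S" using carr by (simp add: PQ)
  finally have "similar_mat_wit S L P Q"
    using carr PQ QP by (simp add: similar_mat_wit_def Let_def)
  then have "char_poly S = char_poly L" by (intro char_poly_similar) (auto simp: similar_mat_def)
  also have "\<dots> = (\<Prod>a\<leftarrow>diag_mat L. [:- a, 1:])"
    by (rule char_poly_upper_triangular[OF carr(4)]) (auto simp: L_def upper_triangular_def)
  also have "proots \<dots> = mset (diag_mat L)"
  proof -
    have "proots (\<Prod>a\<leftarrow>xs. [:- a, 1:]) = mset xs" for xs :: "real list"
    proof (induction xs)
      case (Cons a xs)
      have "(\<Prod>a\<leftarrow>xs. [:- a, 1:]) \<noteq> 0" by (auto simp: prod_list_zero_iff)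
      then show ?case using Cons by (simp add: proots_mult del: mult_pCons_left)
    qed auto
    then show ?thesis .
  qed
  finally have "singular_values X = image_mset sqrt (mset (diag_mat L))"
    by (simp add: singular_values_def S_def)
  then have "nuclear_norm X = sum_list (map sqrt (diag_mat L))"
    by (simp add: nuclear_norm_def sum_mset_sum_list flip: mset_map)
  also have "diag_mat L = map q [0..<n]" by (auto simp: diag_mat_def L_def)
  also have "sum_list (map sqrt (map q [0..<n])) = (\<Sum>l<n. sqrt (q l))"
    by (simp add: o_def interv_sum_list_conv_sum_set_nat lessThan_atLeast0)
  finally show ?thesis by (simp add: q_def G_def)
qed

text \<open>Reduced decomposition: only positive singular values occur, so that \<open>p\<close> can
  be compared with the rank. The last conjunct ties it to the nuclear norm; later arguments use only
  this predicate.\<close>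

definition svd :: "nat \<Rightarrow> real mat \<Rightarrow> nat \<Rightarrow> (nat \<Rightarrow> real) \<Rightarrow> (nat \<Rightarrow> nat \<Rightarrow> real) \<Rightarrow> (nat \<Rightarrow> nat \<Rightarrow> real) \<Rightarrow> bool" where
  "svd n X p \<sigma> u v \<longleftrightarrow> (\<forall>l<p. \<sigma> l > 0) \<and> orthonormal n p u \<and> orthonormal n p v \<and>
     (\<forall>i<n. \<forall>j<n. X $$ (i, j) = (\<Sum>l<p. \<sigma> l * u l i * v l j)) \<and> nuclear_norm X = (\<Sum>l<p. \<sigma> l)"

text \<open>X carries the eigenframe \<open>V\<close> of its Gram matrix to mutually orthogonal
  vectors \<open>x l\<close>, whose lengths are the singular values; the nonzero ones, normalized,
  are the left singular vectors.\<close>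

lemma svd_exists:
  assumes X: "X \<in> carrier_mat n n"
  obtains p \<sigma> u v where "svd n X p \<sigma> u v"
proof -
  define G where "G = (\<lambda>i j. \<Sum>k<n. X $$ (k, i) * X $$ (k, j))"
  obtain V where V: "orthonormal n n V"
    and diag: "\<And>l m. l < n \<Longrightarrow> m < n \<Longrightarrow> l \<noteq> m \<Longrightarrow> bilin n G (V l) (V m) = 0"
    by (rule symmetric_diagonalization[of n G]) (auto simp: G_def mult.commute)
  define x where "x = (\<lambda>l k. \<Sum>i<n. X $$ (k, i) * V l i)"
  have xx: "ip {..<n} (x l) (x m) = bilin n G (V l) (V m)" for l m
  proof -
    have "ip {..<n} (x l) (x m) = (\<Sum>k<n. \<Sum>i<n. \<Sum>j<n. V l i * (X $$ (k, i) * X $$ (k, j)) * V m j)"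
      by (simp add: ip_def x_def sum_product mult_ac)
    also have "\<dots> = (\<Sum>i<n. \<Sum>k<n. \<Sum>j<n. V l i * (X $$ (k, i) * X $$ (k, j)) * V m j)" by (rule sum.swap)
    also have "\<dots> = (\<Sum>i<n. \<Sum>j<n. \<Sum>k<n. V l i * (X $$ (k, i) * X $$ (k, j)) * V m j)"
      by (intro sum.cong refl sum.swap)
    also have "\<dots> = bilin n G (V l) (V m)"
      by (simp add: bilin_def G_def sum_distrib_left sum_distrib_right)
    finally show ?thesis .
  qed
  define s where "s = (\<lambda>l. sqrt (ip {..<n} (x l) (x l)))"
  have s0: "s l \<ge> 0" "s l * s l = ip {..<n} (x l) (x l)" for l by (simp_all add: s_def ip_self_nonneg)
  \<comment> \<open>Zero singular values are dropped because \<open>u\<close> divides by them;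
    \<open>h\<close> numbers the remaining indices consecutively.\<close>
  define J where "J = {l. l < n \<and> s l > 0}"
  define p where "p = card J"
  have "finite J" by (simp add: J_def)
  then obtain h where h: "bij_betw h {..<p} J"
    using ex_bij_betw_nat_finite by (auto simp: p_def lessThan_atLeast0)
  have hJ: "h l < n" "s (h l) > 0" if "l < p" for l
    using bij_betwE[OF h] that by (auto simp: J_def)
  have hinj: "h l = h m \<longleftrightarrow> l = m" if "l < p" "m < p" for l m
    using inj_onD[OF bij_betw_imp_inj_on[OF h]] that by auto
  define \<sigma> where "\<sigma> = (\<lambda>l. s (h l))"
  define v where "v = (\<lambda>l. V (h l))"
  define u where "u = (\<lambda>l k. (1 / s (h l)) * x (h l) k)"
  have off: "s l * y = 0" if "l \<in> {..<n} - J" for l y using that s0(1)[of l] by (auto simp: J_def)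
  have xoff: "x l k = 0" if "l \<in> {..<n} - J" "k < n" for l k
  proof -
    have "ip {..<n} (x l) (x l) = 0" using off[OF that(1), of "s l"] s0(2) by simp
    then show ?thesis using that by (subst (asm) ip_self_eq_0) auto
  qed
  have "orthonormal n p v" using V hJ hinj by (auto simp: orthonormal_def v_def)
  moreover have "orthonormal n p u"
    unfolding orthonormal_def u_def ip_scale_left ip_scale_right
  proof (intro allI impI)
    fix l m assume lm: "l < p" "m < p"
    have pos: "s (h l) > 0" using hJ lm by simp
    show "1 / s (h l) * (1 / s (h m) * ip {..<n} (x (h l)) (x (h m))) = (if l = m then 1 else 0)"
    proof (cases "l = m")
      case True
      then show ?thesis using pos by (simp flip: s0(2))
    next
      case False
      then show ?thesis using hJ hinj lm diag[of "h l" "h m"] by (simp add: xx)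
    qed
  qed
  moreover have "X $$ (i, j) = (\<Sum>l<p. \<sigma> l * u l i * v l j)" if "i < n" "j < n" for i j
  proof -
    have "(\<Sum>l<p. \<sigma> l * u l i * v l j) = (\<Sum>l<p. x (h l) i * V (h l) j)"
    proof (intro sum.cong refl)
      fix l assume "l \<in> {..<p}"
      then have "s (h l) \<noteq> 0" using hJ by fastforce
      then show "\<sigma> l * u l i * v l j = x (h l) i * V (h l) j" by (simp add: \<sigma>_def u_def v_def)
    qed
    also have "\<dots> = (\<Sum>l\<in>J. x l i * V l j)" by (rule sum.reindex_bij_betw[OF h])
    also have "\<dots> = (\<Sum>l<n. x l i * V l j)"
      using xoff that by (intro sum.mono_neutral_left) (auto simp: J_def)
    also have "\<dots> = (\<Sum>l<n. \<Sum>k<n. X $$ (i, k) * (V l k * V l j))"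
      by (simp add: x_def sum_distrib_right mult.assoc)
    also have "\<dots> = (\<Sum>k<n. X $$ (i, k) * (\<Sum>l<n. V l k * V l j))"
      unfolding sum_distrib_left by (rule sum.swap)
    also have "\<dots> = (\<Sum>k<n. if k = j then X $$ (i, k) else 0)"
      using that by (intro sum.cong) (auto simp: orthonormal_complete[OF V])
    also have "\<dots> = X $$ (i, j)" using that by simp
    finally show ?thesis by simp
  qed
  moreover have "nuclear_norm X = (\<Sum>l<p. \<sigma> l)"
  proof -
    have "nuclear_norm X = (\<Sum>l<n. s l)"
      using nuclear_norm_diagonalized[OF X V] diag by (simp add: G_def s_def xx)
    also have "\<dots> = (\<Sum>l\<in>J. s l)"
      using off[of _ 1] by (intro sum.mono_neutral_right) (auto simp: J_def)
    also have "\<dots> = (\<Sum>l<p. \<sigma> l)" unfolding \<sigma>_def by (rule sum.reindex_bij_betw[OF h, symmetric])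
    finally show ?thesis .
  qed
  ultimately have "svd n X p \<sigma> u v" using hJ by (auto simp: svd_def \<sigma>_def)
  then show ?thesis by (rule that)
qed

section \<open>Rank and the number of singular values\<close>

lemma sum_orthonormal:
  assumes "orthonormal n p v" "m < p"
  shows "ip {..<n} (\<lambda>i. \<Sum>l<p. a l * v l i) (v m) = a m"
proof -
  have "ip {..<n} (\<lambda>i. \<Sum>l<p. a l * v l i) (v m) = (\<Sum>l<p. if l = m then a l else 0)"
    unfolding ip_sum_left ip_scale_left using assms by (intro sum.cong) (auto simp: orthonormal_def)
  then show ?thesis using assms by simp
qed

text \<open>A maximal independent set of columns spans all columns. Together with
  \<open>rank_of_sum_le\<close> this makes rank at most r equivalent to a sum of r rank-one terms, a
  form that can be stored in finitely many real parameters.\<close>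

lemma rank_factorization:
  assumes X: "X \<in> carrier_mat n nc"
  obtains x y where "\<And>i j. i < n \<Longrightarrow> j < nc \<Longrightarrow>
    X $$ (i, j) = (\<Sum>l<vec_space.rank n X. x l i * y l j :: 'a :: field)"
proof -
  interpret vec_space "TYPE('a)" n .
  let ?P = "\<lambda>T. T \<subseteq> set (cols X) \<and> lin_indpt T"
  have "lin_indpt {}" by (simp add: lin_dep_def)
  then obtain S where S: "finite S" "maximal S ?P"
    using maximal_exists_superset[of "set (cols X)" ?P "{}"] by auto
  have cols: "set (cols X) \<subseteq> carrier_vec n" using cols_dim X by blast
  have sub: "S \<subseteq> set (cols X)" "lin_indpt S" using S(2) by (auto simp: maximal_def)
  have rank: "rank X = card S" by (rule rank_card_indpt[OF X S(2)])
  obtain h where h: "bij_betw h {..<card S} S"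
    using ex_bij_betw_nat_finite[OF S(1)] by (auto simp: lessThan_atLeast0)
  have "\<exists>a. \<forall>i<n. X $$ (i, j) = (\<Sum>s\<in>S. a s * s $ i)" if j: "j < nc" for j
  proof -
    have cj: "col X j \<in> set (cols X)" using j X by (metis cols_length cols_nth carrier_matD(2) nth_mem)
    have "col X j \<in> span S"
    proof (rule ccontr)
      assume "col X j \<notin> span S"
      have Sc: "S \<subseteq> carrier_vec n" using sub cols by blast
      then have "col X j \<notin> S" using \<open>col X j \<notin> span S\<close> span_mem[of S "col X j"] by blast
      moreover have "col X j \<in> carrier_vec n" using cj cols by blast
      ultimately have "lin_indpt (insert (col X j) S)"
        using lin_dep_iff_in_span[OF _ sub(2), of "col X j"] Sc \<open>col X j \<notin> span S\<close> by simp
      then have "?P (insert (col X j) S)" using sub cj by auto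
      then have "insert (col X j) S = S" using S(2) unfolding maximal_def by (metis subset_insertI)
      then show False using \<open>col X j \<notin> S\<close> by blast
    qed
    then obtain a where a: "col X j = lincomb a S"
      using finite_in_span[OF S(1) subset_trans[OF sub(1) cols]] by metis
    have "X $$ (i, j) = (\<Sum>s\<in>S. a s * s $ i)" if "i < n" for i
    proof -
      have "X $$ (i, j) = col X j $ i" using X j that by simp
      also have "\<dots> = (\<Sum>s\<in>S. a s * s $ i)" unfolding a by (rule lincomb_index) (use that sub cols in auto)
      finally show ?thesis .
    qed
    then show ?thesis by blast
  qed
  then obtain a where a: "\<And>j i. j < nc \<Longrightarrow> i < n \<Longrightarrow> X $$ (i, j) = (\<Sum>s\<in>S. a j s * s $ i)" by metis
  show ?thesis
  proof (rule that[of "\<lambda>l i. h l $ i" "\<lambda>l j. a j (h l)"])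
    fix i j assume "i < n" "j < nc"
    then show "X $$ (i, j) = (\<Sum>l<rank X. h l $ i * a j (h l))"
      unfolding rank using sum.reindex_bij_betw[OF h, of "\<lambda>s. s $ i * a j s"] a by (simp add: mult.commute)
  qed
qed

lemma rank_of_sum_le:
  assumes "X \<in> carrier_mat n nc" "\<And>i j. i < n \<Longrightarrow> j < nc \<Longrightarrow> X $$ (i, j) = (\<Sum>l<k. x l i * y l j :: 'a :: field)"
  shows "vec_space.rank n X \<le> k"
proof -
  interpret vec_space "TYPE('a)" n .
  define Y where "Y = (\<lambda>m. Matrix.mat n nc (\<lambda>(i, j). \<Sum>l<m. x l i * y l j))"
  have "rank (Y m) \<le> m" for m
  proof (induction m)
    case 0
    have "Y 0 = 0\<^sub>m n nc" by (intro eq_matI) (auto simp: Y_def)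
    then show ?case by (simp add: rank_0I)
  next
    case (Suc m)
    let ?E = "Matrix.mat n nc (\<lambda>(i, j). x m i * y m j)"
    have "Y (Suc m) = Y m + ?E" by (intro eq_matI) (auto simp: Y_def)
    moreover have "rank (Y m + ?E) \<le> rank (Y m) + rank ?E"
      by (rule rank_subadditive[of _ nc]) (auto simp: Y_def)
    moreover have "rank ?E \<le> 1" by (rule rank_le_1_product_entries[of _ nc "x m" "y m"]) auto
    ultimately show ?case using Suc by simp
  qed
  moreover have "X = Y k" using assms by (intro eq_matI) (auto simp: Y_def)
  ultimately show ?thesis by simp
qed

text \<open>If \<open>p\<close> exceeded the rank, some unit combination of the \<open>v l\<close>
  would be orthogonal to all right factors of X and hence be mapped to 0. But X maps it to the
  combination of the orthonormal \<open>u l\<close> with coefficients \<sigma> l * t l, which are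
  not all zero.\<close>

lemma svd_length_le_rank:
  assumes "X \<in> carrier_mat n n" "svd n X p \<sigma> u v"
  shows "p \<le> vec_space.rank n X"
proof (rule ccontr)
  define r where "r = vec_space.rank n X"
  assume "\<not> p \<le> vec_space.rank n X"
  then have "r < p" by (simp add: r_def)
  obtain x y where xy: "\<And>i j. i < n \<Longrightarrow> j < n \<Longrightarrow> X $$ (i, j) = (\<Sum>l<r. x l i * y l j)"
    using rank_factorization[OF assms(1)] unfolding r_def by metis
  obtain t where t: "(\<Sum>l<p. (t l)\<^sup>2) = 1" "\<And>k. k < r \<Longrightarrow> (\<Sum>l<p. ip {..<n} (y k) (v l) * t l) = 0"
    using homogeneous_solution[OF \<open>r < p\<close>, of "\<lambda>k l. ip {..<n} (y k) (v l)"] by blast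
  define z where "z = (\<lambda>j. \<Sum>l<p. t l * v l j)"
  have v: "orthonormal n p v" and u: "orthonormal n p u" and pos: "\<And>l. l < p \<Longrightarrow> \<sigma> l > 0"
    using assms(2) by (auto simp: svd_def)
  have Xz: "(\<Sum>j<n. X $$ (i, j) * z j) = (\<Sum>l<p. (\<sigma> l * t l) * u l i)" if "i < n" for i
  proof -
    have "(\<Sum>j<n. X $$ (i, j) * z j) = (\<Sum>j<n. \<Sum>l<p. (\<sigma> l * u l i) * (v l j * z j))"
      using assms(2) that by (simp add: svd_def sum_distrib_right mult.assoc)
    also have "\<dots> = (\<Sum>l<p. (\<sigma> l * u l i) * ip {..<n} (v l) z)"
      unfolding ip_def sum_distrib_left by (rule sum.swap)
    also have "\<dots> = (\<Sum>l<p. (\<sigma> l * t l) * u l i)"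
      unfolding z_def by (subst (1) ip_commute) (simp add: sum_orthonormal[OF v] mult_ac)
    finally show ?thesis .
  qed
  have yz: "ip {..<n} (y k) z = 0" if "k < r" for k
    using t(2)[OF that] unfolding z_def ip_sum_right ip_scale_right by (simp add: mult.commute)
  have Xz0: "(\<Sum>j<n. X $$ (i, j) * z j) = 0" if "i < n" for i
  proof -
    have "(\<Sum>j<n. X $$ (i, j) * z j) = (\<Sum>j<n. \<Sum>l<r. x l i * (y l j * z j))"
      using xy that by (simp add: sum_distrib_right mult.assoc)
    also have "\<dots> = (\<Sum>l<r. x l i * ip {..<n} (y l) z)"
      unfolding ip_def sum_distrib_left by (rule sum.swap)
    finally show ?thesis using yz by simp
  qed
  have "\<sigma> m * t m = 0" if "m < p" for m
  proof -
    have "\<sigma> m * t m = ip {..<n} (\<lambda>i. \<Sum>l<p. (\<sigma> l * t l) * u l i) (u m)"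
      by (rule sum_orthonormal[OF u that, symmetric])
    also have "\<dots> = ip {..<n} (\<lambda>i. 0) (u m)" using Xz Xz0 by (intro ip_cong) auto
    finally show ?thesis by (simp add: ip_def)
  qed
  then have "t m = 0" if "m < p" for m using that pos[OF that] by force
  then show False using t(1) by simp
qed

section \<open>Duality and continuity of the nuclear norm\<close>

text \<open>Duality with the operator norm: \<open>a\<close> and \<open>b\<close> form a partial
  isometry, and by Bessel and Cauchy-Schwarz each rank-one term of X pairs with it to at most its
  singular value.\<close>

lemma nuclear_norm_ge:
  assumes X: "X \<in> carrier_mat n n" and ab: "orthonormal n q a" "orthonormal n q b"
  shows "(\<Sum>k<q. bilin n (\<lambda>i j. X $$ (i, j)) (a k) (b k)) \<le> nuclear_norm X"
proof -
  obtain p \<sigma> u v where s: "svd n X p \<sigma> u v" using svd_exists[OF X] .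
  then have v: "orthonormal n p v" and u: "orthonormal n p u" and pos: "\<And>l. l < p \<Longrightarrow> \<sigma> l > 0"
    by (auto simp: svd_def)
  have *: "bilin n (\<lambda>i j. X $$ (i, j)) f g = (\<Sum>l<p. \<sigma> l * (ip {..<n} f (u l) * ip {..<n} g (v l)))" for f g
  proof -
    have "bilin n (\<lambda>i j. X $$ (i, j)) f g = (\<Sum>i<n. \<Sum>j<n. \<Sum>l<p. \<sigma> l * ((f i * u l i) * (g j * v l j)))"
      using s unfolding bilin_def
      by (intro sum.cong refl) (auto simp: svd_def sum_distrib_left sum_distrib_right mult_ac)
    also have "\<dots> = (\<Sum>i<n. \<Sum>l<p. \<Sum>j<n. \<sigma> l * ((f i * u l i) * (g j * v l j)))"
      by (intro sum.cong refl sum.swap)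
    also have "\<dots> = (\<Sum>l<p. \<Sum>i<n. \<Sum>j<n. \<sigma> l * ((f i * u l i) * (g j * v l j)))" by (rule sum.swap)
    also have "\<dots> = (\<Sum>l<p. \<sigma> l * (ip {..<n} f (u l) * ip {..<n} g (v l)))"
      by (simp add: ip_def sum_product flip: sum_distrib_left)
    finally show ?thesis .
  qed
  have "(\<Sum>k<q. bilin n (\<lambda>i j. X $$ (i, j)) (a k) (b k))
      = (\<Sum>l<p. \<sigma> l * (\<Sum>k<q. ip {..<n} (a k) (u l) * ip {..<n} (b k) (v l)))"
    unfolding * sum_distrib_left by (rule sum.swap)
  also have "\<dots> \<le> (\<Sum>l<p. \<sigma> l)"
  proof (rule sum_mono)
    fix l assume "l \<in> {..<p}"
    then have l: "l < p" by simp
    have "\<bar>\<Sum>k<q. ip {..<n} (a k) (u l) * ip {..<n} (b k) (v l)\<bar> \<le> 1"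
      using bessel[OF ab(1), of "u l"] bessel[OF ab(2), of "v l"] u v l
      by (intro sum_product_le_1) (auto simp: orthonormal_def)
    then have "\<sigma> l * (\<Sum>k<q. ip {..<n} (a k) (u l) * ip {..<n} (b k) (v l)) \<le> \<sigma> l * 1"
      using pos[OF l] by (intro mult_left_mono) auto
    then show "\<sigma> l * (\<Sum>k<q. ip {..<n} (a k) (u l) * ip {..<n} (b k) (v l)) \<le> \<sigma> l" by simp
  qed
  also have "\<dots> = nuclear_norm X" using s by (simp add: svd_def)
  finally show ?thesis .
qed

lemma svd_right:
  assumes "svd n X p \<sigma> u v" "l < p" "i < n"
  shows "(\<Sum>j<n. X $$ (i, j) * v l j) = \<sigma> l * u l i"
proof -
  have v: "orthonormal n p v" using assms by (auto simp: svd_def)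
  have "(\<Sum>j<n. X $$ (i, j) * v l j) = ip {..<n} (\<lambda>j. \<Sum>k<p. (\<sigma> k * u k i) * v k j) (v l)"
    using assms by (simp add: svd_def ip_def)
  then show ?thesis by (simp add: sum_orthonormal[OF v assms(2)])
qed

lemma svd_left:
  assumes "svd n X p \<sigma> u v" "l < p" "j < n"
  shows "(\<Sum>i<n. X $$ (i, j) * u l i) = \<sigma> l * v l j"
proof -
  have u: "orthonormal n p u" using assms by (auto simp: svd_def)
  have "(\<Sum>i<n. X $$ (i, j) * u l i) = ip {..<n} (\<lambda>i. \<Sum>k<p. (\<sigma> k * v k j) * u k i) (u l)"
    using assms by (simp add: svd_def ip_def mult_ac)
  then show ?thesis by (simp add: sum_orthonormal[OF u assms(2)])
qed

lemma svd_bilin: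
  assumes "svd n X p \<sigma> u v" "l < p"
  shows "bilin n (\<lambda>i j. X $$ (i, j)) (u l) (v l) = \<sigma> l"
proof -
  have "bilin n (\<lambda>i j. X $$ (i, j)) (u l) (v l) = (\<Sum>i<n. u l i * (\<sigma> l * u l i))"
    unfolding bilin_def using svd_right[OF assms]
    by (intro sum.cong) (auto simp: mult.assoc simp flip: sum_distrib_left)
  also have "\<dots> = \<sigma> l * ip {..<n} (u l) (u l)" by (simp add: ip_def sum_distrib_left mult_ac)
  finally show ?thesis using assms by (simp add: svd_def orthonormal_def)
qed

lemma svd_nuclear_norm:
  assumes "svd n X p \<sigma> u v"
  shows "nuclear_norm X = (\<Sum>l<p. bilin n (\<lambda>i j. X $$ (i, j)) (u l) (v l))"
  using assms svd_bilin[OF assms] by (simp add: svd_def)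

text \<open>The partial isometry that attains the norm of Y also tests X, and its entries are at
  most 1 in absolute value. In fixed dimension this crude constant is enough for continuity.\<close>

lemma nuclear_norm_lipschitz:
  assumes X: "X \<in> carrier_mat n n" and Y: "Y \<in> carrier_mat n n"
  shows "nuclear_norm Y - nuclear_norm X \<le> (\<Sum>i<n. \<Sum>j<n. \<bar>Y $$ (i, j) - X $$ (i, j)\<bar>)"
proof -
  obtain p \<sigma> u v where s: "svd n Y p \<sigma> u v" using svd_exists[OF Y] .
  then have v: "orthonormal n p v" and u: "orthonormal n p u" by (auto simp: svd_def)
  have "nuclear_norm Y - nuclear_norm X
      \<le> (\<Sum>l<p. bilin n (\<lambda>i j. Y $$ (i, j)) (u l) (v l) - bilin n (\<lambda>i j. X $$ (i, j)) (u l) (v l))"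
    using svd_nuclear_norm[OF s] nuclear_norm_ge[OF X u v] by (simp add: sum_subtractf)
  also have "\<dots> = (\<Sum>l<p. \<Sum>i<n. \<Sum>j<n. (Y $$ (i, j) - X $$ (i, j)) * (u l i * v l j))"
    by (simp add: bilin_def algebra_simps flip: sum_subtractf)
  also have "\<dots> = (\<Sum>i<n. \<Sum>l<p. \<Sum>j<n. (Y $$ (i, j) - X $$ (i, j)) * (u l i * v l j))" by (rule sum.swap)
  also have "\<dots> = (\<Sum>i<n. \<Sum>j<n. \<Sum>l<p. (Y $$ (i, j) - X $$ (i, j)) * (u l i * v l j))"
    by (intro sum.cong refl sum.swap)
  also have "\<dots> = (\<Sum>i<n. \<Sum>j<n. (Y $$ (i, j) - X $$ (i, j)) * (\<Sum>l<p. u l i * v l j))"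
    by (simp add: sum_distrib_left)
  also have "\<dots> \<le> (\<Sum>i<n. \<Sum>j<n. \<bar>Y $$ (i, j) - X $$ (i, j)\<bar>)"
  proof (intro sum_mono)
    fix i j assume "i \<in> {..<n}" "j \<in> {..<n}"
    then have "\<bar>\<Sum>l<p. u l i * v l j\<bar> \<le> 1"
      using bessel_entry[OF u] bessel_entry[OF v] by (intro sum_product_le_1) auto
    then have "\<bar>(Y $$ (i, j) - X $$ (i, j)) * (\<Sum>l<p. u l i * v l j)\<bar> \<le> \<bar>Y $$ (i, j) - X $$ (i, j)\<bar> * 1"
      unfolding abs_mult by (intro mult_left_mono) auto
    then show "(Y $$ (i, j) - X $$ (i, j)) * (\<Sum>l<p. u l i * v l j) \<le> \<bar>Y $$ (i, j) - X $$ (i, j)\<bar>" by simp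
  qed
  finally show ?thesis .
qed

section \<open>Low-rank approximation of perturbations that do not increase the nuclear norm\<close>

abbreviation sq :: "nat \<Rightarrow> (nat \<times> nat) set" where "sq n \<equiv> {..<n} \<times> {..<n}"

definition outer :: "(nat \<Rightarrow> real) \<Rightarrow> (nat \<Rightarrow> real) \<Rightarrow> nat \<times> nat \<Rightarrow> real" where
  "outer x y = (\<lambda>(i, j). x i * y j)"

lemma ip_outer_row: "ip (sq n) M (outer x y) = ip {..<n} (\<lambda>i. \<Sum>j<n. M (i, j) * y j) x"
  by (simp add: ip_def outer_def sum.cartesian_product' sum_distrib_left sum_distrib_right mult_ac)

lemma ip_outer_col: "ip (sq n) M (outer x y) = ip {..<n} (\<lambda>j. \<Sum>i<n. M (i, j) * x i) y"
  by (simp add: ip_def outer_def sum.cartesian_product' sum_distrib_left sum_distrib_right mult_ac)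
     (rule sum.swap)

lemma ip_outer_outer: "ip (sq n) (outer x y) (outer x' y') = ip {..<n} x x' * ip {..<n} y y'"
  by (simp add: ip_def outer_def sum.cartesian_product' sum_product mult_ac)

lemma bilin_eq_ip: "bilin n (\<lambda>i j. X $$ (i, j)) x y = ip (sq n) (\<lambda>e. X $$ e) (outer x y)"
  by (simp add: ip_def outer_def bilin_def sum.cartesian_product' mult_ac)

lemma ip_Cauchy_Schwarz: "(ip I x y)\<^sup>2 \<le> ip I x x * ip I y y"
  using Cauchy_Schwarz_ineq_sum[of x y I] by (simp add: ip_def power2_eq_square)

lemma ip_triangle:
  assumes "ip I x x \<le> a\<^sup>2" "ip I y y \<le> b\<^sup>2" "a \<ge> 0" "b \<ge> 0"
  shows "ip I (\<lambda>k. x k + y k) (\<lambda>k. x k + y k) \<le> (a + b)\<^sup>2"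
proof -
  have "(ip I x y)\<^sup>2 \<le> ip I x x * ip I y y" by (rule ip_Cauchy_Schwarz)
  also have "\<dots> \<le> a\<^sup>2 * b\<^sup>2" using assms by (intro mult_mono ip_self_nonneg) auto
  finally have "(ip I x y)\<^sup>2 \<le> (a * b)\<^sup>2" by (simp add: power_mult_distrib)
  then have "ip I x y \<le> a * b" by (rule power2_le_imp_le) (use assms in simp)
  moreover have "ip I y x = ip I x y" by (rule ip_commute)
  ultimately show ?thesis using assms unfolding ip_add_left ip_add_right power2_sum by linarith
qed

text \<open>Pythagoras. The hypothesis is a product because orthogonality of either the left or the
  right factors suffices; both variants occur.\<close>

lemma ip_sum_outer_orthogonal:
  assumes "finite L" "\<And>l m. l \<in> L \<Longrightarrow> m \<in> L \<Longrightarrow> l \<noteq> m \<Longrightarrow> ip {..<n} (b l) (b m) * ip {..<n} (e l) (e m) = 0"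
  shows "ip (sq n) (\<lambda>q. \<Sum>l\<in>L. outer (b l) (e l) q) (\<lambda>q. \<Sum>l\<in>L. outer (b l) (e l) q)
    = (\<Sum>l\<in>L. ip {..<n} (b l) (b l) * ip {..<n} (e l) (e l))"
  unfolding ip_sum_left
proof (intro sum.cong refl)
  fix l assume "l \<in> L"
  have "ip (sq n) (outer (b l) (e l)) (\<lambda>q. \<Sum>m\<in>L. outer (b m) (e m) q)
      = (\<Sum>m\<in>L. if m = l then ip {..<n} (b l) (b l) * ip {..<n} (e l) (e l) else 0)"
    unfolding ip_sum_right ip_outer_outer using \<open>l \<in> L\<close> assms(2) by (intro sum.cong) auto
  then show "ip (sq n) (outer (b l) (e l)) (\<lambda>q. \<Sum>m\<in>L. outer (b m) (e m) q)
      = ip {..<n} (b l) (b l) * ip {..<n} (e l) (e l)"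
    using assms(1) \<open>l \<in> L\<close> by simp
qed

lemma top_subset:
  fixes \<tau> :: "'a \<Rightarrow> real"
  assumes "finite S" "q \<le> card S"
  shows "\<exists>K\<subseteq>S. card K = q \<and> (\<forall>k\<in>K. \<forall>l\<in>S - K. \<tau> l \<le> \<tau> k)"
  using assms(2)
proof (induction q)
  case 0
  show ?case by (intro exI[of _ "{}"]) auto
next
  case (Suc q)
  then obtain K where K: "K \<subseteq> S" "card K = q" "\<forall>k\<in>K. \<forall>l\<in>S - K. \<tau> l \<le> \<tau> k" by auto
  have fin: "finite (S - K)" "finite K" using assms(1) K finite_subset by auto
  have "S - K \<noteq> {}" using K Suc fin assms(1) by (metis Diff_eq_empty_iff card_mono not_less_eq_eq)
  then have "Max (\<tau> ` (S - K)) \<in> \<tau> ` (S - K)" using fin by (intro Max_in) auto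
  then obtain x where x: "x \<in> S - K" "\<tau> x = Max (\<tau> ` (S - K))" by auto
  have "\<tau> l \<le> \<tau> x" if "l \<in> S - K" for l using that fin x by auto
  then show ?case using K x fin by (intro exI[of _ "insert x K"]) auto
qed

text \<open>The smallest of the q largest values is at most T/q, which bounds the tail by
  AM-GM.\<close>

lemma tail_bound:
  fixes \<tau> :: "'a \<Rightarrow> real"
  assumes "finite S" "q > 0" and pos: "\<And>k. k \<in> S \<Longrightarrow> \<tau> k \<ge> 0"
  shows "\<exists>K\<subseteq>S. card K \<le> q \<and> 4 * real q * (\<Sum>k\<in>S - K. (\<tau> k)\<^sup>2) \<le> (\<Sum>k\<in>S. \<tau> k)\<^sup>2"
proof (cases "q \<le> card S")
  case False
  then show ?thesis by (intro exI[of _ S]) auto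
next
  case True
  then obtain K where K: "K \<subseteq> S" "card K = q" "\<And>k l. k \<in> K \<Longrightarrow> l \<in> S - K \<Longrightarrow> \<tau> l \<le> \<tau> k"
    using top_subset[OF assms(1)] by metis
  have fin: "finite K" "finite (S - K)" using assms(1) K finite_subset by auto
  have "K \<noteq> {}" using K assms(2) by auto
  define \<theta> where "\<theta> = Min (\<tau> ` K)"
  have "\<theta> \<in> \<tau> ` K" unfolding \<theta>_def using fin \<open>K \<noteq> {}\<close> by (intro Min_in) auto
  then have \<theta>: "\<And>l. l \<in> S - K \<Longrightarrow> \<tau> l \<le> \<theta>" "\<theta> \<ge> 0" using K pos by auto
  have \<theta>K: "\<And>k. k \<in> K \<Longrightarrow> \<theta> \<le> \<tau> k" unfolding \<theta>_def using fin by auto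
  define T where "T = (\<Sum>k\<in>S. \<tau> k)"
  have split: "T = (\<Sum>k\<in>K. \<tau> k) + (\<Sum>k\<in>S - K. \<tau> k)"
    unfolding T_def using sum.subset_diff[OF K(1) assms(1)] by (simp add: add.commute)
  have "real q * \<theta> \<le> (\<Sum>k\<in>K. \<tau> k)" using sum_mono[of K "\<lambda>_. \<theta>" \<tau>] \<theta>K K(2) by simp
  then have R: "(\<Sum>k\<in>S - K. \<tau> k) \<le> T - real q * \<theta>" using split by simp
  have "(\<Sum>k\<in>S - K. (\<tau> k)\<^sup>2) \<le> (\<Sum>k\<in>S - K. \<theta> * \<tau> k)"
    unfolding power2_eq_square using \<theta> pos by (intro sum_mono mult_right_mono) auto
  also have "\<dots> \<le> \<theta> * (T - real q * \<theta>)"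
    unfolding sum_distrib_left[symmetric] using R \<theta> by (intro mult_left_mono) auto
  finally have "4 * real q * (\<Sum>k\<in>S - K. (\<tau> k)\<^sup>2) \<le> 4 * real q * (\<theta> * (T - real q * \<theta>))"
    by (intro mult_left_mono) auto
  also have "\<dots> = T\<^sup>2 - (T - 2 * real q * \<theta>)\<^sup>2" by (simp add: power2_eq_square algebra_simps)
  also have "\<dots> \<le> T\<^sup>2" by simp
  finally show ?thesis using K by (intro exI[of _ K]) (auto simp: T_def)
qed

lemma orthonormal_append:
  assumes "orthonormal n p u" "orthonormal n q s"
    and "\<And>k l. k < q \<Longrightarrow> l < p \<Longrightarrow> ip {..<n} (s k) (u l) = 0"
  shows "orthonormal n (p + q) (\<lambda>k. if k < p then u k else s (k - p))"
  using assms unfolding orthonormal_def by (auto simp: ip_commute[of _ "u _" "s _"])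

lemma sum_lessThan_add:
  fixes f :: "nat \<Rightarrow> 'a :: comm_monoid_add"
  shows "(\<Sum>k<p + q. f k) = (\<Sum>k<p. f k) + (\<Sum>k<q. f (p + k))"
  by (induction q) (simp_all add: add.assoc)

lemma svd_expand:
  assumes "svd n X p \<sigma> u v" "e \<in> sq n"
  shows "X $$ e = (\<Sum>l<p. \<sigma> l * outer (u l) (v l) e)"
  using assms by (auto simp: svd_def outer_def mult_ac)

text \<open>Pairing X + H with the partial isometry built from the singular vectors of X and of the part
  of H acting between the orthogonal complements of the row and column spaces of X.\<close>

lemma off_support_part:
  assumes X: "X \<in> carrier_mat n n" and H: "H \<in> carrier_mat n n"
    and le: "nuclear_norm (X + H) \<le> nuclear_norm X" and svd: "svd n X p \<sigma> u v"
  obtains a c p' \<tau> s t where "orthonormal n p' s" "orthonormal n p' t" "\<And>k. k < p' \<Longrightarrow> \<tau> k > 0"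
    and "\<And>k l. k < p' \<Longrightarrow> l < p \<Longrightarrow> ip {..<n} (s k) (u l) = 0"
    and "\<And>k l. k < p' \<Longrightarrow> l < p \<Longrightarrow> ip {..<n} (t k) (v l) = 0"
    and "\<And>e. e \<in> sq n \<Longrightarrow> H $$ e = (\<Sum>l<p. outer (u l) (a l) e) + (\<Sum>l<p. outer (c l) (v l) e)
           + (\<Sum>k<p'. \<tau> k * outer (s k) (t k) e)"
    and "(\<Sum>k<p'. \<tau> k)\<^sup>2 \<le> real p * ip (sq n) (\<lambda>e. H $$ e) (\<lambda>e. H $$ e)"
proof -
  have u: "orthonormal n p u" and v: "orthonormal n p v" using svd by (auto simp: svd_def)
  define h where "h = (\<lambda>e. H $$ e)"
  \<comment> \<open>\<open>a l\<close> is the transpose of H applied to \<open>u l\<close>, so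
    \<open>h1\<close> is H minus its projection to the column space of X. \<open>c\<close> does the
    same on the row side, and \<open>y\<close> is what remains after both projections.\<close>
  define a where "a = (\<lambda>l j. \<Sum>i<n. h (i, j) * u l i)"
  define h1 where "h1 = (\<lambda>e. h e - (\<Sum>l<p. outer (u l) (a l) e))"
  define c where "c = (\<lambda>l i. \<Sum>j<n. h1 (i, j) * v l j)"
  define y where "y = (\<lambda>e. h1 e - (\<Sum>l<p. outer (c l) (v l) e))"
  have h1: "ip (sq n) h1 (outer (u m) w) = 0" if "m < p" for m w
  proof -
    have "(\<Sum>l<p. ip {..<n} (u l) (u m) * ip {..<n} (a l) w) = (\<Sum>l<p. if l = m then ip {..<n} (a m) w else 0)"
      using u that by (intro sum.cong) (auto simp: orthonormal_def)
    then show ?thesis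
      using that unfolding h1_def ip_diff_left ip_sum_left ip_outer_outer
      by (simp add: ip_outer_col a_def)
  qed
  have yv: "ip (sq n) y (outer w (v m)) = 0" if "m < p" for m w
  proof -
    have "(\<Sum>l<p. ip {..<n} (c l) w * ip {..<n} (v l) (v m)) = (\<Sum>l<p. if l = m then ip {..<n} (c m) w else 0)"
      using v that by (intro sum.cong) (auto simp: orthonormal_def)
    then show ?thesis
      using that unfolding y_def ip_diff_left ip_sum_left ip_outer_outer
      by (simp add: ip_outer_row c_def)
  qed
  \<comment> \<open>Subtracting the second sum does not bring back a component along
    \<open>u\<close>.\<close>
  have "ip {..<n} (c l) (u m) = 0" if "m < p" for l m
    using h1[OF that, of "v l"] by (simp add: ip_outer_row c_def)
  then have yu: "ip (sq n) y (outer (u m) w) = 0" if "m < p" for m w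
    unfolding y_def ip_diff_left ip_sum_left ip_outer_outer using that h1 by simp
  define Y where "Y = Matrix.mat n n y"
  have Y: "Y \<in> carrier_mat n n" "\<And>i j. i < n \<Longrightarrow> j < n \<Longrightarrow> Y $$ (i, j) = y (i, j)" by (auto simp: Y_def)
  obtain p' \<tau> s t where svdY: "svd n Y p' \<tau> s t" using svd_exists[OF Y(1)] .
  then have s: "orthonormal n p' s" and t: "orthonormal n p' t" and pos: "\<And>k. k < p' \<Longrightarrow> \<tau> k > 0"
    by (auto simp: svd_def)
  have su: "ip {..<n} (s k) (u l) = 0" if "k < p'" "l < p" for k l
  proof -
    have "\<tau> k * ip {..<n} (s k) (u l) = ip {..<n} (\<lambda>i. \<Sum>j<n. y (i, j) * t k j) (u l)"
      unfolding ip_scale_left[symmetric] using svd_right[OF svdY that(1)] Y by (intro ip_cong) auto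
    also have "\<dots> = 0" using yu[OF that(2), of "t k"] by (simp add: ip_outer_row)
    finally show ?thesis using pos[OF that(1)] by simp
  qed
  have tv: "ip {..<n} (t k) (v l) = 0" if "k < p'" "l < p" for k l
  proof -
    have "\<tau> k * ip {..<n} (t k) (v l) = ip {..<n} (\<lambda>j. \<Sum>i<n. y (i, j) * s k i) (v l)"
      unfolding ip_scale_left[symmetric] using svd_left[OF svdY that(1)] Y by (intro ip_cong) auto
    also have "\<dots> = 0" using yv[OF that(2), of "s k"] by (simp add: ip_outer_col)
    finally show ?thesis using pos[OF that(1)] by simp
  qed
  have yst: "ip (sq n) y (outer (s k) (t k)) = \<tau> k" if "k < p'" for k
    using svd_bilin[OF svdY that] Y unfolding bilin_eq_ip by (auto simp: ip_def split: prod.splits)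
      (smt (verit) SigmaE lessThan_iff sum.cong)
  \<comment> \<open>The subtracted terms have a factor \<open>u l\<close> or \<open>v l\<close>, to
    which \<open>s k\<close> or \<open>t k\<close> is orthogonal; thus H pairs with these matrices
    exactly as \<open>y\<close> does.\<close>
  have hst: "ip (sq n) h (outer (s k) (t k)) = \<tau> k" if "k < p'" for k
  proof -
    have "ip (sq n) y (outer (s k) (t k)) = ip (sq n) h (outer (s k) (t k))"
      unfolding y_def h1_def ip_diff_left ip_sum_left ip_outer_outer
      using su[OF that] tv[OF that] by (simp add: ip_commute[of _ "u _"] ip_commute[of _ "v _"])
    then show ?thesis using yst[OF that] by simp
  qed
  have Xst: "ip (sq n) (\<lambda>e. X $$ e) (outer (s k) (t k)) = 0" if "k < p'" for k
  proof -
    have "ip (sq n) (\<lambda>e. X $$ e) (outer (s k) (t k)) = ip (sq n) (\<lambda>e. \<Sum>l<p. \<sigma> l * outer (u l) (v l) e) (outer (s k) (t k))"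
      using svd_expand[OF svd] by (intro ip_cong) auto
    also have "\<dots> = 0"
      unfolding ip_sum_left ip_scale_left ip_outer_outer
      using su[OF that] by (simp add: ip_commute[of _ "u _"])
    finally show ?thesis .
  qed
  define g where "g = (\<lambda>l. ip (sq n) h (outer (u l) (v l)))"
  \<comment> \<open>The enlarged partial isometry. Pairing it with X + H bounds the sum of \<sigma>,
    \<open>g\<close> and \<tau> by the sum of \<sigma> alone, so the part of H off the support of X
    is controlled by the pairings \<open>g\<close> on the support.\<close>
  define u' where "u' = (\<lambda>k. if k < p then u k else s (k - p))"
  define v' where "v' = (\<lambda>k. if k < p then v k else t (k - p))"
  have "orthonormal n (p + p') u'" "orthonormal n (p + p') v'"
    unfolding u'_def v'_def by (intro orthonormal_append u s su v t tv; assumption)+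
  then have "(\<Sum>k<p + p'. bilin n (\<lambda>i j. (X + H) $$ (i, j)) (u' k) (v' k)) \<le> nuclear_norm X"
    using nuclear_norm_ge[of "X + H" n "p + p'" u' v'] X H le by simp
  also have "(\<Sum>k<p + p'. bilin n (\<lambda>i j. (X + H) $$ (i, j)) (u' k) (v' k))
     = (\<Sum>k<p. \<sigma> k + g k) + (\<Sum>k<p'. \<tau> k)"
  proof -
    have XH: "bilin n (\<lambda>i j. (X + H) $$ (i, j)) x z
        = ip (sq n) (\<lambda>e. X $$ e) (outer x z) + ip (sq n) h (outer x z)" for x z
      unfolding bilin_eq_ip ip_add_left[symmetric] using X H by (intro ip_cong) (auto simp: h_def)
    have "(\<Sum>k<p + p'. bilin n (\<lambda>i j. (X + H) $$ (i, j)) (u' k) (v' k))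
      = (\<Sum>k<p. bilin n (\<lambda>i j. (X + H) $$ (i, j)) (u k) (v k)) + (\<Sum>k<p'. bilin n (\<lambda>i j. (X + H) $$ (i, j)) (s k) (t k))"
      by (subst sum_lessThan_add) (auto simp: u'_def v'_def intro!: arg_cong2[of _ _ _ _ "(+)"] sum.cong)
    also have "\<dots> = (\<Sum>k<p. \<sigma> k + g k) + (\<Sum>k<p'. \<tau> k)"
      using svd_bilin[OF svd] Xst hst unfolding XH by (simp add: g_def bilin_eq_ip)
    finally show ?thesis .
  qed
  also have "nuclear_norm X = (\<Sum>k<p. \<sigma> k)" using svd by (simp add: svd_def)
  finally have T: "(\<Sum>k<p'. \<tau> k) \<le> - (\<Sum>l<p. g l)" by (simp add: sum.distrib)
  have T0: "0 \<le> (\<Sum>k<p'. \<tau> k)" using pos by (intro sum_nonneg) (auto intro: less_imp_le)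
  have "(\<Sum>k<p'. \<tau> k)\<^sup>2 \<le> (\<Sum>l<p. g l)\<^sup>2"
    using T T0 by (metis power2_minus power_mono)
  \<comment> \<open>Source of the factor \<open>p\<close>. The squares of \<open>g\<close> are then
    summed by Bessel, one column of H at a time.\<close>
  also have "\<dots> \<le> (\<Sum>l<p. 1\<^sup>2) * (\<Sum>l<p. (g l)\<^sup>2)"
    using Cauchy_Schwarz_ineq_sum[of "\<lambda>_. 1" g "{..<p}"] by simp
  also have "\<dots> = real p * (\<Sum>l<p. (g l)\<^sup>2)" by simp
  also have "\<dots> \<le> real p * ip (sq n) h h"
  proof (intro mult_left_mono)
    have "(g l)\<^sup>2 \<le> ip {..<n} (a l) (a l)" if "l < p" for l
    proof -
      have "g l = ip {..<n} (a l) (v l)" by (simp add: g_def ip_outer_col a_def)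
      then show ?thesis using ip_Cauchy_Schwarz[of "{..<n}" "a l" "v l"] v that by (simp add: orthonormal_def)
    qed
    then have "(\<Sum>l<p. (g l)\<^sup>2) \<le> (\<Sum>l<p. ip {..<n} (a l) (a l))" by (intro sum_mono) auto
    also have "\<dots> = (\<Sum>j<n. \<Sum>l<p. (ip {..<n} (u l) (\<lambda>i. h (i, j)))\<^sup>2)"
      unfolding ip_def[of _ "a _"] by (subst sum.swap) (simp add: ip_def a_def power2_eq_square mult_ac)
    also have "\<dots> \<le> (\<Sum>j<n. ip {..<n} (\<lambda>i. h (i, j)) (\<lambda>i. h (i, j)))"
      by (intro sum_mono bessel u)
    also have "\<dots> = ip (sq n) h h"
      unfolding ip_def sum.cartesian_product' by (rule sum.swap)
    finally show "(\<Sum>l<p. (g l)\<^sup>2) \<le> ip (sq n) h h" .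
  qed auto
  finally have bound: "(\<Sum>k<p'. \<tau> k)\<^sup>2 \<le> real p * ip (sq n) h h" .
  have "H $$ e = (\<Sum>l<p. outer (u l) (a l) e) + (\<Sum>l<p. outer (c l) (v l) e)
           + (\<Sum>k<p'. \<tau> k * outer (s k) (t k) e)" if "e \<in> sq n" for e
    using svd_expand[OF svdY that] that by (auto simp: Y_def y_def h1_def h_def)
  with s t pos su tv show ?thesis using that bound unfolding h_def by blast
qed

text \<open>An arbitrary finite index set lets rank-one terms of three different kinds be indexed by
  a disjoint union.\<close>

lemma rank_of_finite_sum_le:
  assumes "X \<in> carrier_mat n nc" "finite L"
    and "\<And>i j. i < n \<Longrightarrow> j < nc \<Longrightarrow> X $$ (i, j) = (\<Sum>l\<in>L. x l i * y l j :: 'a :: field)"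
  shows "vec_space.rank n X \<le> card L"
proof -
  obtain h where h: "bij_betw h {..<card L} L"
    using ex_bij_betw_nat_finite[OF assms(2)] by (auto simp: lessThan_atLeast0)
  show ?thesis
  proof (rule rank_of_sum_le[OF assms(1), where x = "\<lambda>l. x (h l)" and y = "\<lambda>l. y (h l)"])
    fix i j assume "i < n" "j < nc"
    then show "X $$ (i, j) = (\<Sum>l<card L. x (h l) i * y (h l) j)"
      using assms(3) sum.reindex_bij_betw[OF h, of "\<lambda>l. x l i * y l j"] by simp
  qed
qed

section \<open>Unit matrices of bounded rank as pairs of orthogonal families\<close>

definition frame_mat :: "nat \<Rightarrow> (nat \<Rightarrow> nat \<Rightarrow> real) \<Rightarrow> (nat \<Rightarrow> nat \<Rightarrow> real) \<Rightarrow> nat \<times> nat \<Rightarrow> real" where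
  "frame_mat k b c e = (\<Sum>l<k. outer (b l) (c l) e)"

text \<open>A singular value decomposition with the singular values absorbed into \<open>b\<close>
  and exactly \<open>k\<close> terms, so that all pairs share one index set. Padding by zero vectors
  is allowed: the last product forces \<open>c l\<close> to have norm 1 only where
  \<open>b l\<close> is nonzero.\<close>

definition unit_frame :: "nat \<Rightarrow> nat \<Rightarrow> (nat \<Rightarrow> nat \<Rightarrow> real) \<Rightarrow> (nat \<Rightarrow> nat \<Rightarrow> real) \<Rightarrow> bool" where
  "unit_frame n k b c \<longleftrightarrow>
     (\<forall>l<k. \<forall>m<k. l \<noteq> m \<longrightarrow> ip {..<n} (b l) (b m) = 0 \<and> ip {..<n} (c l) (c m) = 0) \<and>
     (\<Sum>l<k. ip {..<n} (b l) (b l)) = 1 \<and>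
     (\<forall>l<k. ip {..<n} (c l) (c l) \<le> 1 \<and> ip {..<n} (b l) (b l) * ip {..<n} (c l) (c l) = ip {..<n} (b l) (b l))"

lemma unit_frame_norm:
  assumes "unit_frame n k b c"
  shows "ip (sq n) (frame_mat k b c) (frame_mat k b c) = 1"
proof -
  have "ip (sq n) (frame_mat k b c) (frame_mat k b c) = (\<Sum>l<k. ip {..<n} (b l) (b l) * ip {..<n} (c l) (c l))"
    unfolding frame_mat_def using assms by (intro ip_sum_outer_orthogonal) (auto simp: unit_frame_def)
  also have "\<dots> = (\<Sum>l<k. ip {..<n} (b l) (b l))" using assms by (intro sum.cong) (auto simp: unit_frame_def)
  finally show ?thesis using assms by (simp add: unit_frame_def)
qed

text \<open>Orthogonality of the left factors of the first frame and of the right factors of the second one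
  makes the error additive over the columns, without any loss in the rank.\<close>

lemma frame_mat_close:
  assumes bc: "unit_frame n k b c" and bc': "unit_frame n k b' c'" and "\<eta> \<ge> 0"
    and c: "\<And>l. l < k \<Longrightarrow> ip {..<n} (\<lambda>i. c l i - c' l i) (\<lambda>i. c l i - c' l i) \<le> \<eta>\<^sup>2"
    and b: "(\<Sum>l<k. ip {..<n} (\<lambda>i. b l i - b' l i) (\<lambda>i. b l i - b' l i)) \<le> \<eta>\<^sup>2"
  shows "ip (sq n) (\<lambda>e. frame_mat k b c e - frame_mat k b' c' e) (\<lambda>e. frame_mat k b c e - frame_mat k b' c' e)
    \<le> (2 * \<eta>)\<^sup>2"
proof -
  let ?x = "\<lambda>e. \<Sum>l<k. outer (b l) (\<lambda>i. c l i - c' l i) e"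
  let ?y = "\<lambda>e. \<Sum>l<k. outer (\<lambda>i. b l i - b' l i) (c' l) e"
  have split: "(\<lambda>e. frame_mat k b c e - frame_mat k b' c' e) = (\<lambda>e. ?x e + ?y e)"
    unfolding frame_mat_def sum_subtractf[symmetric] sum.distrib[symmetric]
    by (intro ext sum.cong refl) (auto simp: outer_def algebra_simps split: prod.splits)
  have "ip (sq n) ?x ?x = (\<Sum>l<k. ip {..<n} (b l) (b l) * ip {..<n} (\<lambda>i. c l i - c' l i) (\<lambda>i. c l i - c' l i))"
    using bc by (intro ip_sum_outer_orthogonal) (auto simp: unit_frame_def)
  also have "\<dots> \<le> (\<Sum>l<k. ip {..<n} (b l) (b l) * \<eta>\<^sup>2)"
    using c by (intro sum_mono mult_left_mono ip_self_nonneg) auto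
  also have "\<dots> = \<eta>\<^sup>2" using bc by (simp add: unit_frame_def flip: sum_distrib_right)
  finally have x: "ip (sq n) ?x ?x \<le> \<eta>\<^sup>2" .
  have "ip (sq n) ?y ?y = (\<Sum>l<k. ip {..<n} (\<lambda>i. b l i - b' l i) (\<lambda>i. b l i - b' l i) * ip {..<n} (c' l) (c' l))"
    using bc' by (intro ip_sum_outer_orthogonal) (auto simp: unit_frame_def)
  also have "\<dots> \<le> (\<Sum>l<k. ip {..<n} (\<lambda>i. b l i - b' l i) (\<lambda>i. b l i - b' l i) * 1)"
    using bc' by (intro sum_mono mult_left_mono ip_self_nonneg) (auto simp: unit_frame_def)
  also have "\<dots> \<le> \<eta>\<^sup>2" using b by simp
  finally have y: "ip (sq n) ?y ?y \<le> \<eta>\<^sup>2" .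
  show ?thesis unfolding split using ip_triangle[OF x y] \<open>\<eta> \<ge> 0\<close> by simp
qed

lemma svd_norm:
  assumes "svd n X p \<sigma> u v"
  shows "ip (sq n) (\<lambda>e. X $$ e) (\<lambda>e. X $$ e) = (\<Sum>l<p. (\<sigma> l)\<^sup>2)"
proof -
  let ?b = "\<lambda>l i. \<sigma> l * u l i"
  have "ip (sq n) (\<lambda>e. X $$ e) (\<lambda>e. X $$ e)
      = ip (sq n) (\<lambda>e. \<Sum>l<p. outer (?b l) (v l) e) (\<lambda>e. \<Sum>l<p. outer (?b l) (v l) e)"
    using svd_expand[OF assms] by (intro ip_cong) (auto simp: outer_def mult.assoc)
  also have "\<dots> = (\<Sum>l<p. ip {..<n} (?b l) (?b l) * ip {..<n} (v l) (v l))"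
    using assms by (intro ip_sum_outer_orthogonal) (auto simp: svd_def orthonormal_def ip_scale_left ip_scale_right)
  also have "\<dots> = (\<Sum>l<p. (\<sigma> l)\<^sup>2)"
    using assms unfolding ip_scale_left ip_scale_right
    by (intro sum.cong) (auto simp: svd_def orthonormal_def power2_eq_square)
  finally show ?thesis .
qed

text \<open>H is split into \<open>w\<close>, of rank at most 10 r, and the tail \<open>R\<close> of
  the singular values of its off-support part. The two are orthogonal, so the squared relative error
  is the share of \<open>R\<close> in the squared norm of H.\<close>

lemma low_rank_approximation:
  assumes X: "X \<in> carrier_mat n n" and H: "H \<in> carrier_mat n n"
    and le: "nuclear_norm (X + H) \<le> nuclear_norm X" and rank: "vec_space.rank n X \<le> r" "r > 0"
    and H0: "ip (sq n) (\<lambda>e. H $$ e) (\<lambda>e. H $$ e) > 0"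
  obtains b c \<alpha> where "unit_frame n (10 * r) b c"
    "ip (sq n) (\<lambda>e. frame_mat (10 * r) b c e - \<alpha> * H $$ e) (\<lambda>e. frame_mat (10 * r) b c e - \<alpha> * H $$ e) \<le> 1 / 32"
proof -
  define h where "h = (\<lambda>e. H $$ e)"
  define N where "N = ip (sq n) h h"
  have N: "N > 0" using H0 by (simp add: N_def h_def)
  obtain p \<sigma> u v where svd: "svd n X p \<sigma> u v" using svd_exists[OF X] .
  have p: "p \<le> r" using svd_length_le_rank[OF X svd] rank by simp
  obtain a c p' \<tau> s t where s: "orthonormal n p' s" and t: "orthonormal n p' t"
    and pos: "\<And>k. k < p' \<Longrightarrow> \<tau> k > 0"
    and su: "\<And>k l. k < p' \<Longrightarrow> l < p \<Longrightarrow> ip {..<n} (s k) (u l) = 0"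
    and tv: "\<And>k l. k < p' \<Longrightarrow> l < p \<Longrightarrow> ip {..<n} (t k) (v l) = 0"
    and dec': "\<And>e. e \<in> sq n \<Longrightarrow> H $$ e = (\<Sum>l<p. outer (u l) (a l) e) + (\<Sum>l<p. outer (c l) (v l) e)
           + (\<Sum>k<p'. \<tau> k * outer (s k) (t k) e)"
    and T': "(\<Sum>k<p'. \<tau> k)\<^sup>2 \<le> real p * ip (sq n) (\<lambda>e. H $$ e) (\<lambda>e. H $$ e)"
  proof (rule off_support_part[OF X H le svd], goal_cases)
    case (1 a c p' \<tau> s t)
    show ?case by (rule 1(1)[OF 1(2-)])
  qed
  note dec = dec'[folded h_def[THEN fun_cong]]
  have T: "(\<Sum>k<p'. \<tau> k)\<^sup>2 \<le> real p * N" using T' by (simp add: N_def h_def)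
  \<comment> \<open>Keeping 8 r terms yields the factor 4 (8 r) = 32 r; against the bound p N <= r N
    this leaves a tail of at most N / 32. With the 2 p terms that touch the support of X the rank
    stays within 10 r.\<close>
  obtain K where K: "K \<subseteq> {..<p'}" "card K \<le> 8 * r"
    and tail: "4 * real (8 * r) * (\<Sum>k\<in>{..<p'} - K. (\<tau> k)\<^sup>2) \<le> (\<Sum>k<p'. \<tau> k)\<^sup>2"
    using tail_bound[of "{..<p'}" "8 * r" \<tau>] pos rank(2) by (auto intro: less_imp_le)
  have finK: "finite K" using K finite_subset by auto
  define L where "L = {..<p'} - K"
  define w where "w = (\<lambda>e. (\<Sum>l<p. outer (u l) (a l) e) + (\<Sum>l<p. outer (c l) (v l) e)
      + (\<Sum>k\<in>K. \<tau> k * outer (s k) (t k) e))"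
  define R where "R = (\<lambda>e. \<Sum>k\<in>L. \<tau> k * outer (s k) (t k) e)"
  have hwR: "h e = w e + R e" if "e \<in> sq n" for e
    unfolding dec[OF that] w_def R_def L_def
    using sum.subset_diff[OF K(1), of "\<lambda>k. \<tau> k * outer (s k) (t k) e"] by simp
  have "ip (sq n) w (outer (s k) (t k)) = 0" if "k \<in> L" for k
  proof -
    have k: "k < p'" "k \<notin> K" using that by (auto simp: L_def)
    have "ip {..<n} (s m) (s k) = 0" if "m \<in> K" for m
      using s k K that by (auto simp: orthonormal_def)
    then show ?thesis
      unfolding w_def ip_add_left ip_sum_left ip_scale_left ip_outer_outer
      using su[OF k(1)] tv[OF k(1)] by (simp add: ip_commute[of _ "u _"] ip_commute[of _ "v _"])
  qed
  then have wR: "ip (sq n) w R = 0" unfolding R_def ip_sum_right ip_scale_right by simp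
  have "ip (sq n) R R = (\<Sum>k\<in>L. (\<tau> k)\<^sup>2)"
  proof -
    let ?b = "\<lambda>k i. \<tau> k * s k i"
    have "R = (\<lambda>e. \<Sum>k\<in>L. outer (?b k) (t k) e)" by (simp add: R_def outer_def fun_eq_iff mult.assoc)
    moreover have "ip (sq n) (\<lambda>e. \<Sum>k\<in>L. outer (?b k) (t k) e) (\<lambda>e. \<Sum>k\<in>L. outer (?b k) (t k) e)
        = (\<Sum>k\<in>L. ip {..<n} (?b k) (?b k) * ip {..<n} (t k) (t k))"
      using t by (intro ip_sum_outer_orthogonal) (auto simp: L_def orthonormal_def)
    ultimately have "ip (sq n) R R = (\<Sum>k\<in>L. ip {..<n} (?b k) (?b k) * ip {..<n} (t k) (t k))" by simp
    also have "\<dots> = (\<Sum>k\<in>L. (\<tau> k)\<^sup>2)"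
      unfolding ip_scale_left ip_scale_right using s t
      by (intro sum.cong) (auto simp: L_def orthonormal_def power2_eq_square)
    finally show ?thesis .
  qed
  moreover have "32 * real r * (\<Sum>k\<in>L. (\<tau> k)\<^sup>2) \<le> real r * N"
  proof -
    have "real p * N \<le> real r * N" using p N by (intro mult_right_mono) auto
    then show ?thesis using tail T unfolding L_def by simp
  qed
  ultimately have R: "ip (sq n) R R \<le> N / 32" using rank(2) by (simp add: field_simps)
  have hw: "ip (sq n) w h = ip (sq n) w w" 
  proof -
    have "ip (sq n) w h = ip (sq n) w (\<lambda>e. w e + R e)" using hwR by (intro ip_cong) auto
    then show ?thesis unfolding ip_add_right wR by simp
  qed
  have "N = ip (sq n) (\<lambda>e. w e + R e) (\<lambda>e. w e + R e)" unfolding N_def using hwR by (intro ip_cong) auto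
  then have NwR: "N = ip (sq n) w w + ip (sq n) R R"
    unfolding ip_add_right ip_add_left using wR wR[unfolded ip_commute[of "sq n" w R]] by simp
  define \<omega> where "\<omega> = sqrt (ip (sq n) w w)"
  have w: "ip (sq n) w w = \<omega>\<^sup>2" "\<omega> > 0" using NwR R N by (auto simp: \<omega>_def ip_self_nonneg)
  define W where "W = Matrix.mat n n w"
  have Wc: "W \<in> carrier_mat n n" and We: "\<And>e. e \<in> sq n \<Longrightarrow> W $$ e = w e" by (auto simp: W_def)
  have "vec_space.rank n W \<le> card ({..<p} <+> ({..<p} <+> K))"
    by (rule rank_of_finite_sum_le[OF Wc, where x = "case_sum u (case_sum c (\<lambda>k i. \<tau> k * s k i))" and y = "case_sum a (case_sum v t)"])
       (use finK in \<open>auto simp: W_def w_def outer_def sum.Plus mult.assoc add.assoc\<close>)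
  also have "\<dots> \<le> 10 * r" using K p finK by (simp add: card_Plus)
  finally have rW: "vec_space.rank n W \<le> 10 * r" .
  obtain k \<rho> x y where svdW: "svd n W k \<rho> x y" using svd_exists[OF Wc] .
  have k: "k \<le> 10 * r" using svd_length_le_rank[OF Wc svdW] rW by simp
  have x: "orthonormal n k x" and y: "orthonormal n k y" using svdW by (auto simp: svd_def)
  have "ip (sq n) (\<lambda>e. W $$ e) (\<lambda>e. W $$ e) = ip (sq n) w w" using We by (intro ip_cong) auto
  then have \<rho>: "(\<Sum>l<k. (\<rho> l)\<^sup>2) = \<omega>\<^sup>2" using svd_norm[OF svdW] w by simp
  \<comment> \<open>Zero vectors fill up to 10 r terms, as the rank of \<open>W\<close> may be
    smaller.\<close>
  define b' where "b' = (\<lambda>l. if l < k then (\<lambda>i. (\<rho> l / \<omega>) * x l i) else (\<lambda>_. 0))"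
  define c' where "c' = (\<lambda>l. if l < k then y l else (\<lambda>_. 0))"
  have ip0: "ip I (\<lambda>_. 0) f = 0" "ip I f (\<lambda>_. 0) = 0" for I :: "nat set" and f by (simp_all add: ip_def)
  have bb: "ip {..<n} (b' l) (b' m) = (if l = m \<and> l < k then (\<rho> l / \<omega>)\<^sup>2 else 0)" for l m
  proof (cases "l < k \<and> m < k")
    case True
    then have "ip {..<n} (b' l) (b' m) = (\<rho> l / \<omega>) * ((\<rho> m / \<omega>) * ip {..<n} (x l) (x m))"
      unfolding b'_def by (simp only: if_True ip_scale_left ip_scale_right)
    then show ?thesis using x True by (auto simp: orthonormal_def power2_eq_square)
  qed (auto simp: b'_def ip0)
  have cc: "ip {..<n} (c' l) (c' m) = (if l = m \<and> l < k then 1 else 0)" for l m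
    using y by (auto simp: c'_def ip0 orthonormal_def)
  have "(\<Sum>l<10 * r. ip {..<n} (b' l) (b' l)) = (\<Sum>l<k. (\<rho> l / \<omega>)\<^sup>2)"
    using k by (intro sum.mono_neutral_cong_right) (auto simp: bb)
  also have "\<dots> = 1" using \<rho> w by (simp add: power_divide flip: sum_divide_distrib)
  finally have frame: "unit_frame n (10 * r) b' c'"
    using bb cc by (simp add: unit_frame_def)
  have fm: "frame_mat (10 * r) b' c' e = (1 / \<omega>) * w e" if "e \<in> sq n" for e
  proof -
    have "frame_mat (10 * r) b' c' e = (\<Sum>l<k. outer (b' l) (c' l) e)"
      unfolding frame_mat_def using k
      by (intro sum.mono_neutral_right) (auto simp: b'_def outer_def split: prod.splits)
    also have "\<dots> = (\<Sum>l<k. (1 / \<omega>) * (\<rho> l * outer (x l) (y l) e))"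
      by (intro sum.cong) (auto simp: b'_def c'_def outer_def split: prod.splits)
    also have "\<dots> = (1 / \<omega>) * w e"
      using svd_expand[OF svdW that] We[OF that] unfolding sum_distrib_left[symmetric] by simp
    finally show ?thesis .
  qed
  \<comment> \<open>With this \<alpha> the multiple of H is the orthogonal projection of the unit
    matrix to the line spanned by H; the squared distance is 1 - \<omega>^2 / N, the squared sine of
    the angle.\<close>
  define \<alpha> where "\<alpha> = \<omega> / N"
  have "ip (sq n) (\<lambda>e. frame_mat (10 * r) b' c' e - \<alpha> * h e) (\<lambda>e. frame_mat (10 * r) b' c' e - \<alpha> * h e)
      = ip (sq n) (\<lambda>e. (1 / \<omega>) * w e - \<alpha> * h e) (\<lambda>e. (1 / \<omega>) * w e - \<alpha> * h e)"
    using fm by (intro ip_cong) auto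
  also have "\<dots> = (1 / \<omega>) * (1 / \<omega>) * \<omega>\<^sup>2 - 2 * (1 / \<omega>) * \<alpha> * \<omega>\<^sup>2 + \<alpha> * \<alpha> * N"
    unfolding ip_diff_left ip_diff_right ip_scale_left ip_scale_right
    unfolding ip_commute[of "sq n" h w] hw w(1) N_def[symmetric] by (simp add: algebra_simps)
  also have "\<dots> = 1 - \<omega>\<^sup>2 / N"
    using w(2) N by (simp add: \<alpha>_def field_simps power2_eq_square)
  also have "\<dots> \<le> 1 / 32" using NwR R N w(1) by (simp add: field_simps)
  finally show ?thesis using that[OF frame, of \<alpha>] unfolding h_def by blast
qed

section \<open>Rotation invariance of Gaussian vectors\<close>

abbreviation "\<gamma> \<equiv> std_normal_distribution"

text \<open>The rotation is a composition of two affine substitutions in one variable, with scale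
  factors that cancel. One of them divides by \<open>c\<close>, so c = 0, a swap of coordinates up
  to sign, is treated apart.\<close>

lemma nn_integral_lborel_rotation:
  fixes g :: "real \<times> real \<Rightarrow> ennreal"
  assumes g[measurable]: "g \<in> borel_measurable borel" and cs: "c\<^sup>2 + s\<^sup>2 = 1"
  shows "(\<integral>\<^sup>+ y. \<integral>\<^sup>+ x. g (c * x + s * y, - s * x + c * y) \<partial>lborel \<partial>lborel)
    = (\<integral>\<^sup>+ y. \<integral>\<^sup>+ x. g (x, y) \<partial>lborel \<partial>lborel)"
proof -
  have gm[measurable]: "g \<in> borel_measurable (borel \<Otimes>\<^sub>M borel)" using g by (simp add: borel_prod)
  have swap: "(\<integral>\<^sup>+ y. \<integral>\<^sup>+ x. h (x, y) \<partial>lborel \<partial>lborel) = (\<integral>\<^sup>+ x. \<integral>\<^sup>+ y. h (x, y) \<partial>lborel \<partial>lborel)"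
    if [measurable]: "h \<in> borel_measurable (borel \<Otimes>\<^sub>M borel)" for h :: "real \<times> real \<Rightarrow> ennreal"
    by (rule lborel_pair.Fubini') measurable
  show ?thesis
  proof (cases "c = 0")
    case False
    have "(\<integral>\<^sup>+ x. g (x, (y - s * x) / c) \<partial>lborel)
        = ennreal \<bar>c\<bar> * (\<integral>\<^sup>+ x. g (c * x + s * y, - s * x + c * y) \<partial>lborel)" for y
    proof -
      have "(y - s * (s * y + c * x)) / c = - s * x + c * y" for x
      proof -
        have "(y - s * (s * y + c * x)) = y * (c\<^sup>2 + s\<^sup>2) - s * (s * y + c * x)" using cs by simp
        also have "\<dots> = c * (- s * x + c * y)" by (simp add: power2_eq_square algebra_simps)
        finally show ?thesis using False by simp
      qed
      then show ?thesis
        using nn_integral_real_affine[of "\<lambda>x. g (x, (y - s * x) / c)" c "s * y"] False by (simp add: add.commute)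
    qed
    then have "(\<integral>\<^sup>+ y. \<integral>\<^sup>+ x. g (x, (y - s * x) / c) \<partial>lborel \<partial>lborel)
        = ennreal \<bar>c\<bar> * (\<integral>\<^sup>+ y. \<integral>\<^sup>+ x. g (c * x + s * y, - s * x + c * y) \<partial>lborel \<partial>lborel)"
      by (simp add: nn_integral_cmult)
    moreover have "(\<integral>\<^sup>+ y. \<integral>\<^sup>+ x. g (x, (y - s * x) / c) \<partial>lborel \<partial>lborel)
        = ennreal \<bar>c\<bar> * (\<integral>\<^sup>+ y. \<integral>\<^sup>+ x. g (x, y) \<partial>lborel \<partial>lborel)"
    proof -
      have "(\<integral>\<^sup>+ y. g (x, (y - s * x) / c) \<partial>lborel) = ennreal \<bar>c\<bar> * (\<integral>\<^sup>+ y. g (x, y) \<partial>lborel)" for x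
      proof -
        have "(\<integral>\<^sup>+ y. g (x, y) \<partial>lborel) = ennreal \<bar>1 / c\<bar> * (\<integral>\<^sup>+ y. g (x, - s * x / c + 1 / c * y) \<partial>lborel)"
          by (rule nn_integral_real_affine) (use False in auto)
        also have "(\<integral>\<^sup>+ y. g (x, - s * x / c + 1 / c * y) \<partial>lborel) = (\<integral>\<^sup>+ y. g (x, (y - s * x) / c) \<partial>lborel)"
          by (simp add: field_simps diff_divide_distrib)
        finally show ?thesis
          using False by (simp add: mult.assoc[symmetric] ennreal_mult''[symmetric])
      qed
      then have "(\<integral>\<^sup>+ x. \<integral>\<^sup>+ y. g (x, (y - s * x) / c) \<partial>lborel \<partial>lborel)
          = ennreal \<bar>c\<bar> * (\<integral>\<^sup>+ x. \<integral>\<^sup>+ y. g (x, y) \<partial>lborel \<partial>lborel)"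
        by (simp add: nn_integral_cmult)
      then show ?thesis
        using swap[of "\<lambda>(x, y). g (x, (y - s * x) / c)"] swap[of g] by simp
    qed
    ultimately show ?thesis using False by (simp add: ennreal_mult_cancel_left)
  next
    case True
    then have s: "\<bar>s\<bar> = 1" using cs by (simp add: abs_square_eq_1)
    then have "s \<noteq> 0" by auto
    have "(\<integral>\<^sup>+ x. g (s * y, - s * x) \<partial>lborel) = (\<integral>\<^sup>+ x. g (s * y, x) \<partial>lborel)" for y
      using nn_integral_real_affine[of "\<lambda>x. g (s * y, x)" "- s" 0] s \<open>s \<noteq> 0\<close> by simp
    moreover have "(\<integral>\<^sup>+ y. \<integral>\<^sup>+ x. g (s * y, x) \<partial>lborel \<partial>lborel) = (\<integral>\<^sup>+ y. \<integral>\<^sup>+ x. g (y, x) \<partial>lborel \<partial>lborel)"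
      using nn_integral_real_affine[of "\<lambda>y. \<integral>\<^sup>+ x. g (y, x) \<partial>lborel" s 0] s \<open>s \<noteq> 0\<close> by simp
    ultimately show ?thesis using True swap[of g] by simp
  qed
qed

text \<open>The joint density depends on x^2 + y^2 only.\<close>

lemma nn_integral_normal_rotation:
  fixes f :: "real \<times> real \<Rightarrow> ennreal"
  assumes f[measurable]: "f \<in> borel_measurable borel" and cs: "c\<^sup>2 + s\<^sup>2 = 1"
  shows "(\<integral>\<^sup>+ y. \<integral>\<^sup>+ x. f (c * x + s * y, - s * x + c * y) \<partial>\<gamma> \<partial>\<gamma>)
    = (\<integral>\<^sup>+ y. \<integral>\<^sup>+ x. f (x, y) \<partial>\<gamma> \<partial>\<gamma>)"
proof -
  have [measurable]: "f \<in> borel_measurable (borel \<Otimes>\<^sub>M borel)" using f by (simp add: borel_prod)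
  define g where "g = (\<lambda>(x, y). ennreal (std_normal_density x) * (ennreal (std_normal_density y) * f (x, y)))"
  have [measurable]: "g \<in> borel_measurable borel"
    unfolding borel_prod[symmetric] g_def by measurable
  have expand: "(\<integral>\<^sup>+ y. \<integral>\<^sup>+ x. h x y \<partial>\<gamma> \<partial>\<gamma>)
     = (\<integral>\<^sup>+ y. \<integral>\<^sup>+ x. ennreal (std_normal_density x) * (ennreal (std_normal_density y) * h x y) \<partial>lborel \<partial>lborel)"
    if [measurable]: "case_prod h \<in> borel_measurable (borel \<Otimes>\<^sub>M borel)" for h :: "real \<Rightarrow> real \<Rightarrow> ennreal"
    by (simp add: nn_integral_density nn_integral_cmult[symmetric] mult_ac)
  have "ennreal (std_normal_density x) * (ennreal (std_normal_density y) * z)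
      = ennreal (std_normal_density (c * x + s * y)) * (ennreal (std_normal_density (- s * x + c * y)) * z)" for x y z
  proof -
    have e: "std_normal_density a * std_normal_density b = exp (- (a\<^sup>2 + b\<^sup>2) / 2) / (2 * pi)" for a b
      by (simp add: std_normal_density_def mult_exp_exp add_divide_distrib[symmetric] field_simps)
    have "(c * x + s * y)\<^sup>2 + (- s * x + c * y)\<^sup>2 = (c\<^sup>2 + s\<^sup>2) * (x\<^sup>2 + y\<^sup>2)"
      by (simp add: power2_eq_square algebra_simps)
    then have "std_normal_density x * std_normal_density y
        = std_normal_density (c * x + s * y) * std_normal_density (- s * x + c * y)"
      using cs unfolding e by simp
    then show ?thesis by (simp add: mult.assoc[symmetric] ennreal_mult'[symmetric])
  qed
  then show ?thesis
    using nn_integral_lborel_rotation[OF \<open>g \<in> borel_measurable borel\<close> cs]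
    by (subst (1 2) expand) (auto simp: g_def)
qed

abbreviation gauss :: "'i set \<Rightarrow> ('i \<Rightarrow> real) measure" where
  "gauss I \<equiv> Pi\<^sub>M I (\<lambda>_. \<gamma>)"

lemma prob_space_std_normal: "prob_space \<gamma>"
  by (rule prob_space_normal_density) simp

interpretation std_normal: prob_space \<gamma>
  by (rule prob_space_std_normal)

interpretation normal: product_sigma_finite "\<lambda>_. \<gamma>"
  by standard

lemma prob_space_gauss: "prob_space (gauss I)"
  by (rule prob_space_PiM) (rule prob_space_std_normal)

lemma measurable_givens:
  assumes "i \<in> I" "j \<in> I"
  shows "givens i j c s \<in> gauss I \<rightarrow>\<^sub>M gauss I"
proof (rule measurable_PiM_single')
  show "givens i j c s \<in> space (gauss I) \<rightarrow> (\<Pi>\<^sub>E k\<in>I. space \<gamma>)"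
    using assms by (auto simp: givens_def space_PiM PiE_def extensional_def)
  fix k assume [measurable]: "k \<in> I"
  have [measurable]: "i \<in> I" "j \<in> I" by fact+
  show "(\<lambda>x. givens i j c s x k) \<in> gauss I \<rightarrow>\<^sub>M \<gamma>"
    unfolding givens_def fun_upd_def by (cases "k = j"; cases "k = i"; simp; measurable)
qed

text \<open>Fubini isolates the two coordinates that the rotation mixes; the others are frozen in
  \<open>x\<close>.\<close>

lemma nn_integral_givens:
  fixes f :: "('i \<Rightarrow> real) \<Rightarrow> ennreal"
  assumes "finite I" and ij: "i \<in> I" "j \<in> I" "i \<noteq> j" and cs: "c\<^sup>2 + s\<^sup>2 = 1"
    and f: "f \<in> borel_measurable (gauss I)"
  shows "(\<integral>\<^sup>+ x. f (givens i j c s x) \<partial>gauss I) = (\<integral>\<^sup>+ x. f x \<partial>gauss I)"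
proof -
  define J where "J = I - {i, j}"
  have I: "I = insert i (insert j J)" and J: "finite J" "i \<notin> insert j J" "j \<notin> J" "finite (insert j J)"
    using assms by (auto simp: J_def)
  have split: "(\<integral>\<^sup>+ x. h x \<partial>gauss I) = (\<integral>\<^sup>+ x. \<integral>\<^sup>+ y. \<integral>\<^sup>+ z. h (x(j := y, i := z)) \<partial>\<gamma>
      \<partial>\<gamma> \<partial>gauss J)" if h: "h \<in> borel_measurable (gauss I)" for h :: "('i \<Rightarrow> real) \<Rightarrow> ennreal"
  proof -
    have [measurable]: "h \<in> borel_measurable (gauss (insert i (insert j J)))" using h unfolding I .
    have "(\<lambda>x. \<integral>\<^sup>+ z. h (x(i := z)) \<partial>\<gamma>) \<in> borel_measurable (gauss (insert j J))"
      by measurable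
    then show ?thesis
      unfolding I using J by (simp add: normal.product_nn_integral_insert)
  qed
  have "(\<lambda>x. f (givens i j c s x)) \<in> borel_measurable (gauss I)"
    using measurable_comp[OF measurable_givens[OF ij(1,2)] f] by (simp add: comp_def)
  then have "(\<integral>\<^sup>+ x. f (givens i j c s x) \<partial>gauss I) =
      (\<integral>\<^sup>+ x. \<integral>\<^sup>+ y. \<integral>\<^sup>+ z. f (givens i j c s (x(j := y, i := z))) \<partial>\<gamma>
      \<partial>\<gamma> \<partial>gauss J)"
    by (rule split)
  also have "\<dots> = (\<integral>\<^sup>+ x. \<integral>\<^sup>+ y. \<integral>\<^sup>+ z. f (x(j := y, i := z)) \<partial>\<gamma>
      \<partial>\<gamma> \<partial>gauss J)"
  proof (rule nn_integral_cong)
    fix x assume x: "x \<in> space (gauss J)"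
    define F where "F = (\<lambda>(z, y). f (x(j := y, i := z)))"
    have upd: "(\<lambda>(z, y). x(j := y, i := z)) \<in> (borel \<Otimes>\<^sub>M borel) \<rightarrow>\<^sub>M gauss I"
    proof (rule measurable_PiM_single')
      show "(\<lambda>(z, y). x(j := y, i := z)) \<in> space (borel \<Otimes>\<^sub>M borel) \<rightarrow> (\<Pi>\<^sub>E k\<in>I. space \<gamma>)"
        using x unfolding I by (auto simp: space_PiM PiE_def extensional_def)
      fix k assume "k \<in> I"
      show "(\<lambda>e. (case e of (z, y) \<Rightarrow> x(j := y, i := z)) k) \<in> borel \<Otimes>\<^sub>M borel \<rightarrow>\<^sub>M \<gamma>"
        unfolding fun_upd_def split_beta by (cases "k = i"; cases "k = j"; simp)
    qed
    have "F \<in> borel_measurable borel"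
      using measurable_comp[OF upd f] unfolding F_def borel_prod by (simp add: comp_def split_beta)
    moreover have "givens i j c s (x(j := y, i := z)) = x(j := - s * z + c * y, i := c * z + s * y)" for y z
      using ij by (auto simp: givens_def fun_upd_def fun_eq_iff)
    ultimately show "(\<integral>\<^sup>+ y. \<integral>\<^sup>+ z. f (givens i j c s (x(j := y, i := z))) \<partial>\<gamma> \<partial>\<gamma>)
      = (\<integral>\<^sup>+ y. \<integral>\<^sup>+ z. f (x(j := y, i := z)) \<partial>\<gamma> \<partial>\<gamma>)"
      using nn_integral_normal_rotation[of F, OF _ cs] by (simp add: F_def)
  qed
  also have "\<dots> = (\<integral>\<^sup>+ x. f x \<partial>gauss I)" by (rule split[OF f, symmetric])
  finally show ?thesis .
qed

lemma measurable_rotations: "T \<in> rotations I \<Longrightarrow> T \<in> gauss I \<rightarrow>\<^sub>M gauss I"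
proof (induction rule: rotations.induct)
  case (step T i j c s)
  then show ?case using measurable_comp[OF step.IH measurable_givens] by blast
qed (simp add: id_def)

lemma nn_integral_rotations:
  assumes "T \<in> rotations I" "finite I" "f \<in> borel_measurable (gauss I)"
  shows "(\<integral>\<^sup>+ x. f (T x) \<partial>gauss I) = (\<integral>\<^sup>+ x. f x \<partial>gauss I)"
  using assms(1,3)
proof (induction arbitrary: f rule: rotations.induct)
  case (step T i j c s)
  have "(\<lambda>x. f (givens i j c s x)) \<in> borel_measurable (gauss I)"
    using measurable_comp[OF measurable_givens step.prems] step.hyps by (simp add: comp_def)
  then have "(\<integral>\<^sup>+ x. f (givens i j c s (T x)) \<partial>gauss I) = (\<integral>\<^sup>+ x. f (givens i j c s x) \<partial>gauss I)"
    by (rule step.IH)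
  then show ?case using nn_integral_givens[OF assms(2) _ _ _ _ step.prems] step.hyps by simp
qed simp

lemma emeasure_rotations:
  assumes T: "T \<in> rotations I" "finite I" and P: "Measurable.pred (gauss I) P"
  shows "emeasure (gauss I) {x \<in> space (gauss I). P (T x)} = emeasure (gauss I) {x \<in> space (gauss I). P x}"
proof -
  have [measurable]: "T \<in> gauss I \<rightarrow>\<^sub>M gauss I" "Measurable.pred (gauss I) P"
    using measurable_rotations[OF T(1)] P by auto
  let ?A = "{x \<in> space (gauss I). P x}"
  have "{x \<in> space (gauss I). P (T x)} \<in> sets (gauss I)" by measurable
  then have "emeasure (gauss I) {x \<in> space (gauss I). P (T x)}
      = (\<integral>\<^sup>+ x. indicator {x \<in> space (gauss I). P (T x)} x \<partial>gauss I)" by simp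
  also have "\<dots> = (\<integral>\<^sup>+ x. indicator ?A (T x) \<partial>gauss I)"
    using measurable_space[OF measurable_rotations[OF T(1)]] by (intro nn_integral_cong) (auto split: split_indicator)
  also have "\<dots> = (\<integral>\<^sup>+ x. indicator ?A x \<partial>gauss I)"
    by (rule nn_integral_rotations[OF T]) measurable
  also have "\<dots> = emeasure (gauss I) ?A" by (intro nn_integral_indicator) measurable
  finally show ?thesis .
qed

text \<open>Rotating every row of a matrix by the same map is itself a product of plane rotations of
  the whole array, row after row, so the law of the Gaussian matrix is invariant under it.\<close>

lemma rotations_rowwise:
  assumes "T \<in> rotations {..<D :: nat}"
  shows "\<exists>S\<in>rotations ({..<m :: nat} \<times> {..<D}). \<forall>w. \<forall>r<m. (\<lambda>k. S w (r, k)) = T (\<lambda>k. w (r, k))"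
  using assms
proof (induction rule: rotations.induct)
  case id
  show ?case by (intro bexI[of _ id] rotations.id) auto
next
  case (step T i j c s)
  then obtain S where S: "S \<in> rotations ({..<m} \<times> {..<D})" "\<forall>w. \<forall>r<m. (\<lambda>k. S w (r, k)) = T (\<lambda>k. w (r, k))"
    by blast
  have "p \<le> m \<Longrightarrow> \<exists>R\<in>rotations ({..<m} \<times> {..<D}). \<forall>w. \<forall>r k. R w (r, k) =
      (if r < p then givens i j c s (\<lambda>k. w (r, k)) k else w (r, k))" for p
  proof (induction p)
    case 0
    show ?case by (intro bexI[of _ id] rotations.id) auto
  next
    case (Suc p)
    then obtain R where R: "R \<in> rotations ({..<m} \<times> {..<D})" "\<And>w r k. R w (r, k) =
      (if r < p then givens i j c s (\<lambda>k. w (r, k)) k else w (r, k))" by auto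
    have "givens (p, i) (p, j) c s \<circ> R \<in> rotations ({..<m} \<times> {..<D})"
      using R(1) Suc step.hyps by (intro rotations.step) auto
    then show ?case
      by (rule bexI[rotated]) (auto simp: givens_def R(2) less_Suc_eq)
  qed
  from this[of m] obtain R where R: "R \<in> rotations ({..<m} \<times> {..<D})" "\<And>w r k. R w (r, k) =
      (if r < m then givens i j c s (\<lambda>k. w (r, k)) k else w (r, k))" by auto
  show ?case
    using rotations_comp[OF R(1) S(1)] S(2) by (intro bexI[of _ "R \<circ> S"]) (auto simp: R(2) fun_eq_iff)
qed

section \<open>Chernoff bound for sums of squares\<close>

lemma nn_integral_normal_exp_square:
  assumes "\<theta> < 1 / 2"
  shows "(\<integral>\<^sup>+ x. ennreal (exp (\<theta> * x\<^sup>2)) \<partial>\<gamma>) = ennreal ((1 - 2 * \<theta>) powr (- 1 / 2))"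
proof -
  define \<sigma> where "\<sigma> = (1 - 2 * \<theta>) powr (- 1 / 2)"
  have pos: "1 - 2 * \<theta> > 0" using assms by simp
  have \<sigma>: "\<sigma> > 0" "\<sigma>\<^sup>2 = 1 / (1 - 2 * \<theta>)"
    using pos by (auto simp: \<sigma>_def powr_minus_divide powr_half_sqrt power_divide)
  have "std_normal_density x * exp (\<theta> * x\<^sup>2) = \<sigma> * normal_density 0 \<sigma> x" for x
  proof -
    have "exp (- x\<^sup>2 / 2) * exp (\<theta> * x\<^sup>2) = exp (- x\<^sup>2 / (2 * \<sigma>\<^sup>2))"
      unfolding \<sigma>(2) mult_exp_exp using pos by (simp add: field_simps)
    moreover have "sqrt (2 * pi * \<sigma>\<^sup>2) = sqrt (2 * pi) * \<sigma>"
      using \<sigma>(1) by (simp add: real_sqrt_mult)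
    ultimately show ?thesis using \<sigma>(1) by (simp add: normal_density_def)
  qed
  then have "(\<integral>\<^sup>+ x. ennreal (exp (\<theta> * x\<^sup>2)) \<partial>\<gamma>)
      = (\<integral>\<^sup>+ x. ennreal \<sigma> * ennreal (normal_density 0 \<sigma> x) \<partial>lborel)"
    using \<sigma>(1) by (simp add: nn_integral_density flip: ennreal_mult')
  also have "\<dots> = ennreal \<sigma> * (\<integral>\<^sup>+ x. ennreal (normal_density 0 \<sigma> x) \<partial>lborel)"
    by (rule nn_integral_cmult) simp
  also have "(\<integral>\<^sup>+ x. ennreal (normal_density 0 \<sigma> x) \<partial>lborel) = 1"
    using \<sigma>(1) by (subst nn_integral_eq_integral) auto
  finally show ?thesis by (simp add: \<sigma>_def)
qed

text \<open>Exponential Markov bound, with multiplier 2, for 1/12 of the full sum of squares minus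
  the sum over the first \<open>m\<close>. The exponents are 1/6 - 2 = -11/6 on the first
  \<open>m\<close> coordinates and 1/6 on the others, so that 1 - 2 \<theta> is 14/3 and
  2/3.\<close>

definition chernoff_bound :: "nat \<Rightarrow> nat \<Rightarrow> real" where
  "chernoff_bound m D = (14 / 3) powr (- real m / 2) * (2 / 3) powr (- real (D - m) / 2)"

lemma chernoff_bound_nonneg [simp]: "0 \<le> chernoff_bound m D"
  by (simp add: chernoff_bound_def)

lemma normal_coordinate_proportion:
  assumes "m \<le> D"
  shows "emeasure (gauss {..<D}) {x \<in> space (gauss {..<D}). (\<Sum>i<m. (x i)\<^sup>2) \<le> 1 / 12 * (\<Sum>i<D. (x i)\<^sup>2)}
    \<le> ennreal (chernoff_bound m D)"
proof -
  define \<theta> where "\<theta> = (\<lambda>i. if i < m then - 11 / 6 else (1 / 6 :: real))"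
  let ?G = "gauss {..<D}"
  let ?A = "{x \<in> space ?G. (\<Sum>i<m. (x i)\<^sup>2) \<le> 1 / 12 * (\<Sum>i<D. (x i)\<^sup>2)}"
  have D: "{..<D} = {..<m} \<union> {m..<D}" "{..<m} \<inter> {m..<D} = {}" using assms by auto
  have sum\<theta>: "(\<Sum>i<D. \<theta> i * (x i)\<^sup>2) = 2 * (1 / 12 * (\<Sum>i<D. (x i)\<^sup>2) - (\<Sum>i<m. (x i)\<^sup>2))" for x :: "nat \<Rightarrow> real"
  proof -
    have "(\<Sum>i<D. h i) = (\<Sum>i<m. h i) + (\<Sum>i\<in>{m..<D}. h i)" for h :: "nat \<Rightarrow> real"
      unfolding D(1) by (rule sum.union_disjoint) auto
    then have *: "(\<Sum>i<D. \<theta> i * (x i)\<^sup>2) = (- 11 / 6) * (\<Sum>i<m. (x i)\<^sup>2) + (1 / 6) * (\<Sum>i\<in>{m..<D}. (x i)\<^sup>2)"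
      and **: "(\<Sum>i<D. (x i)\<^sup>2) = (\<Sum>i<m. (x i)\<^sup>2) + (\<Sum>i\<in>{m..<D}. (x i)\<^sup>2)"
      by (simp_all add: \<theta>_def sum_distrib_left)
    have "(- 11 / 6) * A + (1 / 6) * B = 2 * (1 / 12 * (A + B) - A)" for A B :: real
      by (simp add: field_simps)
    then show ?thesis unfolding * ** .
  qed
  have [measurable]: "(\<lambda>x. x i) \<in> borel_measurable ?G" if "i < D" for i
    using measurable_component_singleton[of i "{..<D}" "\<lambda>_. \<gamma>"] that by simp
  have [measurable]: "(\<lambda>x. \<Sum>i<m. (x i)\<^sup>2) \<in> borel_measurable ?G" "(\<lambda>x. \<Sum>i<D. (x i)\<^sup>2) \<in> borel_measurable ?G"
    using assms by (auto intro!: borel_measurable_sum borel_measurable_power)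
  have "emeasure ?G ?A = (\<integral>\<^sup>+ x. indicator ?A x \<partial>?G)"
    by (intro nn_integral_indicator[symmetric]) measurable
  also have "\<dots> \<le> (\<integral>\<^sup>+ x. (\<Prod>i<D. ennreal (exp (\<theta> i * (x i)\<^sup>2))) \<partial>?G)"
  proof (intro nn_integral_mono)
    fix x
    have "(\<Prod>i<D. ennreal (exp (\<theta> i * (x i)\<^sup>2))) = ennreal (exp (\<Sum>i<D. \<theta> i * (x i)\<^sup>2))"
      by (simp add: prod_ennreal exp_sum)
    then show "indicator ?A x \<le> (\<Prod>i<D. ennreal (exp (\<theta> i * (x i)\<^sup>2)))"
      unfolding sum\<theta> by (auto split: split_indicator)
  qed
  also have "\<dots> = (\<Prod>i<D. \<integral>\<^sup>+ y. ennreal (exp (\<theta> i * y\<^sup>2)) \<partial>\<gamma>)"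
    by (rule normal.product_nn_integral_prod) auto
  also have "\<dots> = (\<Prod>i<D. ennreal ((1 - 2 * \<theta> i) powr (- 1 / 2)))"
    by (intro prod.cong refl nn_integral_normal_exp_square) (auto simp: \<theta>_def)
  also have "\<dots> = ennreal (\<Prod>i<D. (1 - 2 * \<theta> i) powr (- 1 / 2))"
    by (rule prod_ennreal) simp
  also have "(\<Prod>i<D. (1 - 2 * \<theta> i) powr (- 1 / 2)) = (\<Prod>i<m. (14 / 3) powr (- 1 / 2)) * (\<Prod>i\<in>{m..<D}. (2 / 3) powr (- 1 / 2))"
    unfolding D(1) by (subst prod.union_disjoint) (auto simp: \<theta>_def)
  also have "\<dots> = chernoff_bound m D"
    by (simp add: chernoff_bound_def powr_realpow[symmetric] powr_powr)
  finally show ?thesis .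
qed

section \<open>Distance from a fixed vector to the kernel of a Gaussian matrix\<close>

text \<open>Tube lemma: for a point outside the projection, finitely many of the open boxes that
  avoid \<open>C\<close> cover the fibre, and the intersection of their bases is a neighbourhood
  that avoids the projection.\<close>

lemma closed_projection_along_compact:
  fixes C :: "('a::topological_space \<times> 'b::topological_space) set"
  assumes "compact K" "closed C"
  shows "closed {x. \<exists>y\<in>K. (x, y) \<in> C}"
  unfolding closed_def
proof (subst open_subopen, intro ballI)
  fix x assume "x \<in> - {x. \<exists>y\<in>K. (x, y) \<in> C}"
  then have "\<forall>y\<in>K. (x, y) \<in> - C" by auto
  moreover have "open (- C)" using assms by (simp add: open_Compl)
  ultimately have "\<forall>y\<in>K. \<exists>A B. open A \<and> open B \<and> x \<in> A \<and> y \<in> B \<and> A \<times> B \<subseteq> - C"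
    by (metis open_prod_elim mem_Sigma_iff)
  then obtain A B where AB: "\<And>y. y \<in> K \<Longrightarrow> open (A y) \<and> open (B y) \<and> x \<in> A y \<and> y \<in> B y \<and> A y \<times> B y \<subseteq> - C"
    by metis
  obtain K' where K': "K' \<subseteq> K" "finite K'" "K \<subseteq> (\<Union>y\<in>K'. B y)"
    by (rule compactE_image[OF assms(1), of K B]) (use AB in blast)+
  have "u \<notin> {x. \<exists>y\<in>K. (x, y) \<in> C}" if u: "u \<in> (\<Inter>y\<in>K'. A y)" for u
  proof
    assume "u \<in> {x. \<exists>y\<in>K. (x, y) \<in> C}"
    then obtain y y' where "y \<in> K" "(u, y) \<in> C" "y' \<in> K'" "y \<in> B y'" using K'(3) by blast
    moreover from this have "(u, y) \<in> A y' \<times> B y'" using u by blast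
    ultimately show False using AB[of y'] K'(1) by blast
  qed
  moreover have "open (\<Inter>y\<in>K'. A y)" using AB K' by (intro open_INT) auto
  moreover have "x \<in> (\<Inter>y\<in>K'. A y)" using AB K' by auto
  ultimately show "\<exists>T. open T \<and> x \<in> T \<and> T \<subseteq> - {x. \<exists>y\<in>K. (x, y) \<in> C}" by blast
qed

text \<open>The set projected is a countable union of sets with compact fibres, hence the projection is
  an F-sigma set although projections of Borel sets need not be Borel.\<close>

lemma borel_projection:
  fixes C :: "('a::topological_space \<times> ('i \<Rightarrow> real)) set"
  assumes "closed C" "finite J"
  shows "{x. \<exists>y. (\<forall>i. i \<notin> J \<longrightarrow> y i = 0) \<and> (x, y) \<in> C} \<in> sets borel"
proof -
  define S where "S = (\<lambda>n::nat. {y :: 'i \<Rightarrow> real. \<forall>i. \<bar>y i\<bar> \<le> real n} \<inter> {y. \<forall>i. i \<notin> J \<longrightarrow> y i = 0})"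
  have "closed {y :: 'i \<Rightarrow> real. \<forall>i. i \<notin> J \<longrightarrow> y i = 0}"
    by (intro closed_Collect_all closed_Collect_imp closed_Collect_eq) auto
  then have "compact (S n)" for n unfolding S_def by (intro compact_Int_closed compact_box)
  then have "closed {x. \<exists>y\<in>S n. (x, y) \<in> C}" for n
    by (rule closed_projection_along_compact) fact
  then have "(\<Union>n. {x. \<exists>y\<in>S n. (x, y) \<in> C}) \<in> sets borel" by (intro sets.countable_UN) auto
  also have "(\<Union>n. {x. \<exists>y\<in>S n. (x, y) \<in> C}) = {x. \<exists>y. (\<forall>i. i \<notin> J \<longrightarrow> y i = 0) \<and> (x, y) \<in> C}"
  proof safe
    fix x y assume y: "\<forall>i. i \<notin> J \<longrightarrow> y i = 0" "(x, y) \<in> C"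
    obtain n where n: "(\<Sum>i\<in>J. \<bar>y i\<bar>) \<le> real n" using real_arch_simple by blast
    have "\<bar>y i\<bar> \<le> real n" for i
    proof (cases "i \<in> J")
      case True
      then have "\<bar>y i\<bar> \<le> (\<Sum>i\<in>J. \<bar>y i\<bar>)" using assms(2) by (intro member_le_sum) auto
      then show ?thesis using n by simp
    qed (use y in auto)
    then have "y \<in> S n" using y by (simp add: S_def)
    then show "x \<in> (\<Union>n. {x. \<exists>y\<in>S n. (x, y) \<in> C})" using y by auto
  qed (auto simp: S_def)
  finally show ?thesis .
qed

text \<open>The product measure lives on functions that are \<open>undefined\<close> outside
  \<open>I\<close>. They are placed in the full function space, whose Borel sets are the product
  sets because the index type is countable.\<close>

lemma measurable_gauss_borel: "(\<lambda>w. w) \<in> gauss I \<rightarrow>\<^sub>M (borel :: ('i::countable \<Rightarrow> real) measure)"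
proof -
  have "(\<lambda>w. w) \<in> gauss I \<rightarrow>\<^sub>M Pi\<^sub>M UNIV (\<lambda>_::'i. borel :: real measure)"
  proof (rule measurable_PiM_single')
    fix i :: 'i
    show "(\<lambda>w. w i) \<in> gauss I \<rightarrow>\<^sub>M (borel :: real measure)"
    proof (cases "i \<in> I")
      case True
      then show ?thesis using measurable_component_singleton[of i I "\<lambda>_. \<gamma>"] by simp
    next
      case False
      then have "(\<lambda>w. w i) \<in> gauss I \<rightarrow>\<^sub>M (borel :: real measure) \<longleftrightarrow> (\<lambda>w. undefined :: real) \<in> gauss I \<rightarrow>\<^sub>M (borel :: real measure)"
        by (intro measurable_cong) (auto simp: space_PiM PiE_def extensional_def)
      then show ?thesis by simp
    qed
  qed auto
  then show ?thesis by (simp cong: measurable_cong_sets add: sets_PiM_equal_borel)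
qed

lemma pred_gauss_borel:
  assumes "{w :: 'i::countable \<Rightarrow> real. P w} \<in> sets borel"
  shows "Measurable.pred (gauss I) P"
  using measurable_compose[OF measurable_gauss_borel, of P "count_space UNIV" I] assms
  by (simp add: pred_def)

lemma pred_gauss_pair_borel:
  assumes "{e :: ('i::countable \<Rightarrow> real) \<times> ('j::countable \<Rightarrow> real). P e} \<in> sets borel"
  shows "Measurable.pred (gauss I \<Otimes>\<^sub>M gauss J) P"
proof -
  have "(\<lambda>e. (fst e, snd e)) \<in> gauss I \<Otimes>\<^sub>M gauss J \<rightarrow>\<^sub>M
      ((borel :: ('i \<Rightarrow> real) measure) \<Otimes>\<^sub>M (borel :: ('j \<Rightarrow> real) measure))"
    by (intro measurable_Pair measurable_compose[OF measurable_fst measurable_gauss_borel]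
        measurable_compose[OF measurable_snd measurable_gauss_borel])
  then have "(\<lambda>e. e) \<in> gauss I \<Otimes>\<^sub>M gauss J \<rightarrow>\<^sub>M (borel :: (('i \<Rightarrow> real) \<times> ('j \<Rightarrow> real)) measure)"
    by (simp add: borel_prod)
  from measurable_compose[OF this, of P "count_space UNIV"] show ?thesis
    using assms by (simp add: pred_def)
qed

lemma continuous_on_coordinate:
  "continuous_on S (\<lambda>p. fst p i :: real)" "continuous_on S' (\<lambda>p. snd p j :: real)"
  using continuous_on_product_then_coordinatewise[OF continuous_on_fst[OF continuous_on_id], of S i]
    continuous_on_product_then_coordinatewise[OF continuous_on_snd[OF continuous_on_id], of S' j]
  by simp_all

lemma continuous_on_fst_coordinate:
  "continuous_on S (\<lambda>p. fst (fst p) i :: real)" "continuous_on S' (\<lambda>p. snd (fst p) j :: real)"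
  using continuous_on_product_then_coordinatewise[OF continuous_on_fst[OF continuous_on_fst[OF continuous_on_id]], of S i]
    continuous_on_product_then_coordinatewise[OF continuous_on_snd[OF continuous_on_fst[OF continuous_on_id]], of S' j]
  by simp_all

section \<open>Proximity to the kernel: measurability, invariance, probability\<close>

text \<open>The squared distance from \<open>x\<close> to the kernel of the first \<open>m\<close>
  rows, relative to the squared norm of \<open>x\<close>, is at most 1/12. The witness
  \<open>z\<close> is supported on {..<D}, the form that \<open>borel_projection\<close>
  handles.\<close>

definition near_ker :: "nat \<Rightarrow> nat \<Rightarrow> (nat \<times> nat \<Rightarrow> real) \<Rightarrow> (nat \<Rightarrow> real) \<Rightarrow> bool" where
  "near_ker m D w x \<longleftrightarrow> (\<exists>z. (\<forall>k. k \<notin> {..<D} \<longrightarrow> z k = 0) \<and> (\<forall>i<m. (\<Sum>k<D. w (i, k) * z k) = 0) \<and>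
     ip {..<D} (\<lambda>k. x k - z k) (\<lambda>k. x k - z k) \<le> 1 / 12 * ip {..<D} x x)"

text \<open>Linear dependence, normalized: a unit coefficient vector gives a closed condition, a
  merely nonzero one would not.\<close>

definition dependent_rows :: "nat \<Rightarrow> nat \<Rightarrow> (nat \<times> nat \<Rightarrow> real) \<Rightarrow> bool" where
  "dependent_rows p D w \<longleftrightarrow> (\<exists>t. (\<forall>j. j \<notin> {..<p} \<longrightarrow> t j = 0) \<and> (\<Sum>j<p. (t j)\<^sup>2) = 1 \<and>
     (\<forall>k<D. (\<Sum>j<p. t j * w (j, k)) = 0))"

text \<open>Measurability jointly in matrix and vector, for the exchange of integrals in
  \<open>near_ker_prob\<close>; both sections are obtained from it.\<close>

lemma borel_near_ker: "{e. near_ker m D (fst e) (snd e)} \<in> sets borel"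
proof -
  define C where "C = {p :: ((nat \<times> nat \<Rightarrow> real) \<times> (nat \<Rightarrow> real)) \<times> (nat \<Rightarrow> real).
     (\<forall>i<m. (\<Sum>k<D. fst (fst p) (i, k) * snd p k) = 0) \<and>
     ip {..<D} (\<lambda>k. snd (fst p) k - snd p k) (\<lambda>k. snd (fst p) k - snd p k)
       \<le> 1 / 12 * ip {..<D} (snd (fst p)) (snd (fst p))}"
  have "closed C"
    unfolding C_def ip_def
    by (intro closed_Collect_conj closed_Collect_all closed_Collect_imp closed_Collect_eq
        closed_Collect_le continuous_on_sum continuous_on_mult continuous_on_diff continuous_on_const
        continuous_on_coordinate continuous_on_fst_coordinate) auto
  from borel_projection[OF this, of "{..<D}"] show ?thesis
    by (simp add: near_ker_def C_def)
qed

lemma pred_near_ker_pair: "Measurable.pred (gauss I \<Otimes>\<^sub>M gauss J) (\<lambda>e. near_ker m D (fst e) (snd e))"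
  by (rule pred_gauss_pair_borel) (rule borel_near_ker)

lemma pred_near_ker: "Measurable.pred (gauss I) (\<lambda>w. near_ker m D w x)"
proof (rule pred_gauss_borel)
  have "(\<lambda>w. (w, x)) \<in> borel \<rightarrow>\<^sub>M borel"
    by (intro borel_measurable_continuous_onI continuous_intros)
  from measurable_sets[OF this borel_near_ker]
  show "{w. near_ker m D w x} \<in> sets borel" by (simp add: vimage_def)
qed

lemma pred_near_ker_snd: "Measurable.pred (gauss J) (near_ker m D w)"
proof (rule pred_gauss_borel)
  have "(\<lambda>x. (w, x)) \<in> borel \<rightarrow>\<^sub>M borel"
    by (intro borel_measurable_continuous_onI continuous_intros)
  from measurable_sets[OF this borel_near_ker]
  show "{x. near_ker m D w x} \<in> sets borel" by (simp add: vimage_def)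
qed

lemma pred_dependent_rows: "Measurable.pred (gauss I) (dependent_rows p D)"
proof (rule pred_gauss_borel)
  define C where "C = {e :: (nat \<times> nat \<Rightarrow> real) \<times> (nat \<Rightarrow> real).
     (\<Sum>j<p. snd e j * snd e j) = 1 \<and> (\<forall>k<D. (\<Sum>j<p. snd e j * fst e (j, k)) = 0)}"
  have "closed C"
    unfolding C_def
    by (intro closed_Collect_conj closed_Collect_all closed_Collect_imp closed_Collect_eq
        continuous_on_sum continuous_on_mult continuous_on_const continuous_on_coordinate) auto
  from borel_projection[OF this, of "{..<p}"] show "{w. dependent_rows p D w} \<in> sets borel"
    by (simp add: dependent_rows_def C_def power2_eq_square)
qed

lemma rotations_outside: "T \<in> rotations I \<Longrightarrow> k \<notin> I \<Longrightarrow> T x k = x k"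
  by (induction rule: rotations.induct) (auto simp: givens_def)

lemma near_ker_rotation:
  assumes T: "T \<in> rotations {..<D}" and rows: "\<And>r. r < m \<Longrightarrow> (\<lambda>k. w' (r, k)) = T (\<lambda>k. w (r, k))"
    and near: "near_ker m D w x"
  shows "near_ker m D w' (T x)"
proof -
  obtain z where z: "\<And>k. k \<notin> {..<D} \<Longrightarrow> z k = 0" "\<And>i. i < m \<Longrightarrow> (\<Sum>k<D. w (i, k) * z k) = 0"
    "ip {..<D} (\<lambda>k. x k - z k) (\<lambda>k. x k - z k) \<le> 1 / 12 * ip {..<D} x x"
    using near unfolding near_ker_def by blast
  have "(\<Sum>k<D. w' (i, k) * T z k) = 0" if "i < m" for i
  proof -
    have "(\<Sum>k<D. w' (i, k) * T z k) = ip {..<D} (T (\<lambda>k. w (i, k))) (T z)"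
      using fun_cong[OF rows[OF that]] by (simp add: ip_def)
    also have "\<dots> = 0" using rotations_ip[OF T] z(2)[OF that] by (simp add: ip_def)
    finally show ?thesis .
  qed
  moreover have "ip {..<D} (\<lambda>k. T x k - T z k) (\<lambda>k. T x k - T z k) \<le> 1 / 12 * ip {..<D} (T x) (T x)"
    using z(3) rotations_ip[OF T] unfolding rotations_diff[OF T, symmetric] by simp
  ultimately show ?thesis
    unfolding near_ker_def using z(1) rotations_outside[OF T] by (intro exI[of _ "T z"]) auto
qed

lemma near_ker_scale:
  assumes "near_ker m D w x" "\<And>k. k < D \<Longrightarrow> y k = c * x k"
  shows "near_ker m D w y"
proof -
  obtain z where z: "\<And>k. k \<notin> {..<D} \<Longrightarrow> z k = 0" "\<And>i. i < m \<Longrightarrow> (\<Sum>k<D. w (i, k) * z k) = 0"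
    "ip {..<D} (\<lambda>k. x k - z k) (\<lambda>k. x k - z k) \<le> 1 / 12 * ip {..<D} x x"
    using assms(1) unfolding near_ker_def by blast
  have "(\<Sum>k<D. w (i, k) * (c * z k)) = 0" if "i < m" for i
  proof -
    have "(\<Sum>k<D. w (i, k) * (c * z k)) = c * (\<Sum>k<D. w (i, k) * z k)"
      by (simp add: sum_distrib_left mult_ac)
    then show ?thesis using z(2)[OF that] by simp
  qed
  moreover have "ip {..<D} (\<lambda>k. y k - c * z k) (\<lambda>k. y k - c * z k)
      = ip {..<D} (\<lambda>k. c * (x k - z k)) (\<lambda>k. c * (x k - z k))"
    by (intro ip_cong) (auto simp: assms(2) right_diff_distrib)
  moreover have "ip {..<D} y y = ip {..<D} (\<lambda>k. c * x k) (\<lambda>k. c * x k)"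
    by (intro ip_cong) (auto simp: assms(2))
  moreover have "c * (c * ip {..<D} (\<lambda>k. x k - z k) (\<lambda>k. x k - z k)) \<le> 1 / 12 * (c * (c * ip {..<D} x x))"
    using mult_left_mono[OF z(3), of "c * c"] by (simp add: mult_ac)
  ultimately show ?thesis
    unfolding near_ker_def ip_scale_left ip_scale_right using z(1) by (intro exI[of _ "\<lambda>k. c * z k"]) auto
qed

text \<open>Rotating \<open>x\<close> into the first axis and every row along with it preserves
  nearness and the law of the matrix. Only the first \<open>m\<close> of the \<open>M\<close> rows
  enter the event, so that \<open>m\<close> can be capped at the dimension later.\<close>

lemma near_ker_prob_direction:
  assumes "m \<le> M" and x: "ip {..<D} x x > 0"
  defines "G \<equiv> gauss ({..<M} \<times> {..<D})"
  shows "emeasure G {w \<in> space G. near_ker m D w x}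
    = emeasure G {w \<in> space G. near_ker m D w (\<lambda>k. if k = 0 then 1 else 0)}"
proof -
  let ?e = "\<lambda>k. if k = 0 then 1 else (0::real)"
  have "D > 0" using x by (cases "D = 0") (auto simp: ip_def)
  then obtain T where T: "T \<in> rotations {..<D}" "\<forall>k\<in>{..<D} - {0}. T x k = 0"
    using rotations_annihilate[of "{..<D}" 0 x] by auto
  define c where "c = T x 0"
  have Tx: "T x k = c * ?e k" if "k < D" for k using T(2) that by (auto simp: c_def)
  have "ip {..<D} x x = ip {..<D} (T x) (T x)" using rotations_ip[OF T(1)] by simp
  also have "\<dots> = ip {..<D} (\<lambda>k. c * ?e k) (\<lambda>k. c * ?e k)" using Tx by (intro ip_cong) simp_all
  also have "\<dots> = c * (c * ip {..<D} ?e ?e)" by (simp only: ip_scale_left ip_scale_right)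
  finally have "c \<noteq> 0" using x by auto
  obtain T' where T': "T' \<in> rotations {..<D}" "T' \<circ> T = id" using rotations_inverse[OF T(1)] by blast
  obtain S where S: "S \<in> rotations ({..<M} \<times> {..<D})" "\<And>w r. r < M \<Longrightarrow> (\<lambda>k. S w (r, k)) = T (\<lambda>k. w (r, k))"
    using rotations_rowwise[OF T(1), of M] by blast
  have "near_ker m D w x \<longleftrightarrow> near_ker m D (S w) ?e" for w
  proof
    assume "near_ker m D w x"
    then have "near_ker m D (S w) (T x)" using S(2) \<open>m \<le> M\<close> by (intro near_ker_rotation[OF T(1)]) auto
    then show "near_ker m D (S w) ?e"
      by (rule near_ker_scale[where c = "1 / c"]) (simp add: Tx \<open>c \<noteq> 0\<close>)
  next
    assume "near_ker m D (S w) ?e"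
    then have "near_ker m D (S w) (T x)" by (rule near_ker_scale) (rule Tx)
    moreover have TT: "T' (T y) = y" for y using T'(2) by (metis comp_apply id_apply)
    ultimately show "near_ker m D w x"
      using near_ker_rotation[OF T'(1), of m w "S w" "T x"] S(2) \<open>m \<le> M\<close> by simp
  qed
  then show ?thesis
    using emeasure_rotations[OF S(1), of "\<lambda>w. near_ker m D w ?e"] pred_near_ker by (simp add: G_def)
qed

lemma emeasure_std_normal_singleton: "emeasure \<gamma> {a} = 0"
  by (subst emeasure_density) (auto simp: nn_integral_cmult_indicator)

text \<open>Fubini in the coordinate \<open>e\<close>: with the others frozen, at most one value
  solves the equation.\<close>

lemma gauss_hyperplane_null:
  assumes "finite R" "e \<in> R" "q e \<noteq> 0"
  shows "emeasure (gauss R) {y \<in> space (gauss R). (\<Sum>k\<in>R. q k * y k) = 0} = 0"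
proof -
  define J where "J = R - {e}"
  have R: "R = insert e J" and J: "finite J" "e \<notin> J" using assms by (auto simp: J_def)
  define A where "A = {y \<in> space (gauss R). (\<Sum>k\<in>R. q k * y k) = 0}"
  have A[measurable]: "A \<in> sets (gauss R)"
    unfolding A_def by measurable
  have "emeasure (gauss R) A = (\<integral>\<^sup>+ y. indicator A y \<partial>gauss R)" by simp
  also have "\<dots> = (\<integral>\<^sup>+ x. \<integral>\<^sup>+ z. indicator A (x(e := z)) \<partial>\<gamma> \<partial>gauss J)"
    using J A unfolding R by (intro normal.product_nn_integral_insert) auto
  also have "\<dots> = (\<integral>\<^sup>+ x. 0 \<partial>gauss J)"
  proof (rule nn_integral_cong)
    fix x
    define a where "a = - (\<Sum>k\<in>J. q k * x k) / q e"
    have "indicator A (x(e := z)) \<le> (indicator {a} z :: ennreal)" for z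
    proof -
      have *: "(\<Sum>k\<in>R. q k * (x(e := z)) k) = q e * z + (\<Sum>k\<in>J. q k * x k)"
        unfolding R using J by (auto intro!: sum.cong)
      have "z = a" if "x(e := z) \<in> A"
      proof -
        have "(\<Sum>k\<in>R. q k * (x(e := z)) k) = 0" using that by (simp add: A_def)
        then have "q e * z = - (\<Sum>k\<in>J. q k * x k)" unfolding * by linarith
        then show ?thesis using assms(3) unfolding a_def by (metis nonzero_mult_div_cancel_left)
      qed
      then show ?thesis by (auto simp del: fun_upd_apply split: split_indicator)
    qed
    then have "(\<integral>\<^sup>+ z. indicator A (x(e := z)) \<partial>\<gamma>) \<le> (\<integral>\<^sup>+ z. indicator {a} z \<partial>\<gamma>)"
      by (intro nn_integral_mono) auto
    also have "\<dots> = 0" using emeasure_std_normal_singleton[of a] by simp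
    finally show "(\<integral>\<^sup>+ z. indicator A (x(e := z)) \<partial>\<gamma>) = 0" by simp
  qed
  finally show ?thesis by (simp add: A_def)
qed

text \<open>Induction on the rows. With the other rows frozen, some unit vector \<open>q\<close> is
  orthogonal to the first \<open>p\<close> rows. If row \<open>p\<close> is the first to create a
  dependence, its coefficient is nonzero, so the row is orthogonal to \<open>q\<close> and lies in a
  null hyperplane.\<close>

lemma AE_independent_rows:
  assumes "m \<le> M" "m \<le> D"
  shows "AE w in gauss ({..<M} \<times> {..<D}). \<not> dependent_rows m D w"
  using assms
proof (induction m)
  case 0
  show ?case by (simp add: dependent_rows_def)
next
  case (Suc p)
  define I where "I = {..<M} \<times> {..<D}"
  define R where "R = {p} \<times> {..<D}"
  define J where "J = I - R"
  have JR: "J \<inter> R = {}" "finite J" "finite R" "J \<union> R = I" using Suc by (auto simp: I_def J_def R_def)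
  let ?B = "{w \<in> space (gauss I). dependent_rows (Suc p) D w \<and> \<not> dependent_rows p D w}"
  have [measurable]: "Measurable.pred (gauss I) (dependent_rows k D)" for k by (rule pred_dependent_rows)
  have B[measurable]: "?B \<in> sets (gauss I)" by measurable
  have "emeasure (gauss I) ?B = (\<integral>\<^sup>+ w. indicator ?B w \<partial>gauss I)" by simp
  also have "\<dots> = (\<integral>\<^sup>+ x. \<integral>\<^sup>+ y. indicator ?B (merge J R (x, y)) \<partial>gauss R \<partial>gauss J)"
    using normal.product_nn_integral_fold[OF JR(1-3), unfolded JR(4), of "indicator ?B"] by simp
  also have "\<dots> = (\<integral>\<^sup>+ x. 0 \<partial>gauss J)"
  proof (rule nn_integral_cong)
    fix x :: "nat \<times> nat \<Rightarrow> real"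
    obtain q where q: "(\<Sum>k<D. (q k)\<^sup>2) = 1" "\<And>j. j < p \<Longrightarrow> (\<Sum>k<D. x (j, k) * q k) = 0"
      using homogeneous_solution[of p D "\<lambda>j k. x (j, k)"] Suc by auto
    have "\<exists>k<D. q k \<noteq> 0"
    proof (rule ccontr)
      assume "\<not> (\<exists>k<D. q k \<noteq> 0)"
      then have "(\<Sum>k<D. (q k)\<^sup>2) = 0" by (intro sum.neutral) auto
      then show False using q(1) by simp
    qed
    then obtain k0 where k0: "k0 < D" "q k0 \<noteq> 0" by blast
    let ?H = "{y \<in> space (gauss R). (\<Sum>e\<in>R. q (snd e) * y e) = 0}"
    have sumR: "(\<Sum>e\<in>R. h (snd e) e) = (\<Sum>k<D. h k (p, k))" for h :: "nat \<Rightarrow> nat \<times> nat \<Rightarrow> real"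
      unfolding R_def by (simp add: sum.cartesian_product')
    have "(indicator ?B (merge J R (x, y)) :: ennreal) \<le> indicator ?H y" if y: "y \<in> space (gauss R)" for y
    proof -
      let ?w = "merge J R (x, y)"
      have "y \<in> ?H" if "?w \<in> ?B"
      proof -
        obtain t where t: "(\<Sum>j<Suc p. (t j)\<^sup>2) = 1" "\<And>k. k < D \<Longrightarrow> (\<Sum>j<Suc p. t j * ?w (j, k)) = 0"
          using \<open>?w \<in> ?B\<close> by (auto simp: dependent_rows_def)
        have "t p \<noteq> 0"
        proof
          assume "t p = 0"
          then have "dependent_rows p D ?w" unfolding dependent_rows_def
            using t by (intro exI[of _ "\<lambda>j. if j < p then t j else 0"]) simp_all
          then show False using \<open>?w \<in> ?B\<close> by simp
        qed
        have wx: "?w (j, k) = x (j, k)" if "j < p" "k < D" for j k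
          using that Suc by (auto simp: merge_def J_def I_def R_def)
        have wy: "?w (p, k) = y (p, k)" if "k < D" for k
          using that by (auto simp: merge_def J_def I_def R_def)
        have "0 = (\<Sum>k<D. q k * (\<Sum>j<Suc p. t j * ?w (j, k)))" using t(2) by simp
        also have "\<dots> = (\<Sum>k<D. \<Sum>j<Suc p. t j * (?w (j, k) * q k))"
          by (simp add: sum_distrib_left mult_ac del: sum.lessThan_Suc)
        also have "\<dots> = (\<Sum>j<Suc p. t j * (\<Sum>k<D. ?w (j, k) * q k))"
          unfolding sum_distrib_left by (rule sum.swap)
        also have "\<dots> = (\<Sum>j<p. t j * (\<Sum>k<D. x (j, k) * q k)) + t p * (\<Sum>k<D. y (p, k) * q k)"
          using wx wy by simp
        also have "\<dots> = t p * (\<Sum>k<D. q k * y (p, k))" using q(2) by (simp add: mult.commute)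
        finally show ?thesis using \<open>t p \<noteq> 0\<close> y sumR[of "\<lambda>k e. q k * y e"] by simp
      qed
      then show ?thesis by (auto split: split_indicator)
    qed
    then have "(\<integral>\<^sup>+ y. indicator ?B (merge J R (x, y)) \<partial>gauss R) \<le> (\<integral>\<^sup>+ y. indicator ?H y \<partial>gauss R)"
      by (intro nn_integral_mono) auto
    also have "\<dots> = emeasure (gauss R) ?H" by (intro nn_integral_indicator) measurable
    also have "\<dots> = 0"
      using k0 JR(3) by (intro gauss_hyperplane_null[where e = "(p, k0)"]) (auto simp: R_def)
    finally show "(\<integral>\<^sup>+ y. indicator ?B (merge J R (x, y)) \<partial>gauss R) = 0" by simp
  qed
  finally have "emeasure (gauss I) ?B = 0" by simp
  then have "AE w in gauss I. \<not> (dependent_rows (Suc p) D w \<and> \<not> dependent_rows p D w)"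
    by (subst AE_iff_null) (auto simp: null_sets_def)
  moreover have "AE w in gauss I. \<not> dependent_rows p D w" unfolding I_def using Suc by simp
  ultimately show ?case unfolding I_def by eventually_elim auto
qed

text \<open>Once the rows are triangular, the rotated kernel lies among the vectors whose first
  \<open>m\<close> coordinates vanish; the distance from \<open>x\<close> is therefore at least the
  norm of the first \<open>m\<close> rotated coordinates, and the Chernoff bound applies.\<close>

lemma near_ker_fixed_matrix:
  assumes "m \<le> D" and indep: "\<not> dependent_rows m D w"
  shows "emeasure (gauss {..<D}) {x \<in> space (gauss {..<D}). near_ker m D w x}
    \<le> ennreal (chernoff_bound m D)"
proof -
  define W where "W = (\<lambda>i k. w (i, k))"
  obtain T where T: "T \<in> rotations {..<D}" and tri: "\<And>j k. j < m \<Longrightarrow> k < D \<Longrightarrow> j < k \<Longrightarrow> T (W j) k = 0"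
    using rotations_triangularize[OF assms(1), of W] by blast
  \<comment> \<open>If this entry vanished, the rows 0 to i would be rotated into the first
    \<open>i\<close> coordinates: i + 1 vectors in dimension \<open>i\<close>, hence
    dependent.\<close>
  have diag: "T (W i) i \<noteq> 0" if "i < m" for i
  proof
    assume 0: "T (W i) i = 0"
    obtain t where t: "(\<Sum>j<Suc i. (t j)\<^sup>2) = 1" "\<And>k. k < i \<Longrightarrow> (\<Sum>j<Suc i. T (W j) k * t j) = 0"
      using homogeneous_solution[of i "Suc i" "\<lambda>k j. T (W j) k"] by auto
    have Tz: "(\<Sum>j<Suc i. t j * T (W j) k) = 0" if "k < D" for k
    proof (cases "k < i")
      case True
      then show ?thesis using t(2)[OF True] by (simp add: mult.commute)
    next
      case False
      then show ?thesis using tri that 0 \<open>i < m\<close> by (intro sum.neutral ballI) (auto simp: less_Suc_eq, metis linorder_neqE_nat)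
    qed
    have "ip {..<D} (\<lambda>k. \<Sum>j<Suc i. t j * W j k) (\<lambda>k. \<Sum>j<Suc i. t j * W j k)
        = ip {..<D} (\<lambda>k. \<Sum>j<Suc i. t j * T (W j) k) (\<lambda>k. \<Sum>j<Suc i. t j * T (W j) k)"
      unfolding rotations_sum[OF T finite_lessThan, symmetric] using rotations_ip[OF T] by simp
    also have "\<dots> = 0" using Tz by (simp add: ip_def)
    finally have z: "(\<Sum>j<Suc i. t j * w (j, k)) = 0" if "k < D" for k
      using that by (simp add: ip_self_eq_0 W_def)
    define t' where "t' = (\<lambda>j. if j < Suc i then t j else 0)"
    have ext: "(\<Sum>j<m. f j * t' j) = (\<Sum>j<Suc i. f j * t j)" for f
      using \<open>i < m\<close> by (intro sum.mono_neutral_cong_right) (auto simp: t'_def)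
    have "dependent_rows m D w"
      unfolding dependent_rows_def
    proof (intro exI[of _ t'] conjI allI impI)
      show "(\<Sum>j<m. (t' j)\<^sup>2) = 1"
        using t(1) \<open>i < m\<close>
        by (subst sum.mono_neutral_cong_right[of "{..<m}" "{..<Suc i}" _ "\<lambda>j. (t j)\<^sup>2"]) (auto simp: t'_def)
      show "(\<Sum>j<m. t' j * w (j, k)) = 0" if "k < D" for k
        using ext[of "\<lambda>j. w (j, k)"] z[OF that] by (simp add: mult.commute)
    qed (use \<open>i < m\<close> in \<open>auto simp: t'_def\<close>)
    then show False using indep by simp
  qed
  have near: "(\<Sum>i<m. (T x i)\<^sup>2) \<le> 1 / 12 * (\<Sum>i<D. (T x i)\<^sup>2)" if nk: "near_ker m D w x" for x
  proof -
    obtain z where z: "\<And>i. i < m \<Longrightarrow> (\<Sum>k<D. w (i, k) * z k) = 0"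
      "ip {..<D} (\<lambda>k. x k - z k) (\<lambda>k. x k - z k) \<le> 1 / 12 * ip {..<D} x x"
      using nk unfolding near_ker_def by blast
    \<comment> \<open>Forward substitution in a lower triangular system.\<close>
    have Tz: "i < m \<Longrightarrow> T z i = 0" for i
    proof (induction i rule: less_induct)
      case (less i)
      have "0 = ip {..<D} (W i) z" using z(1)[OF less.prems] by (simp add: ip_def W_def)
      also have "\<dots> = ip {..<D} (T (W i)) (T z)" by (rule rotations_ip[OF T, symmetric]) simp
      also have "\<dots> = (\<Sum>k\<in>{i}. T (W i) k * T z k)"
        unfolding ip_def using less tri assms(1)
        by (intro sum.mono_neutral_right) (auto, metis linorder_neqE_nat order.strict_trans)
      finally show ?case using diag[OF less.prems] by simp
    qed
    have "(\<Sum>i<m. (T x i)\<^sup>2) = (\<Sum>i<m. (T x i - T z i)\<^sup>2)" using Tz by simp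
    also have "\<dots> \<le> (\<Sum>i<D. (T x i - T z i)\<^sup>2)" using assms(1) by (intro sum_mono2) auto
    also have "\<dots> = ip {..<D} (T (\<lambda>k. x k - z k)) (T (\<lambda>k. x k - z k))"
      unfolding rotations_diff[OF T] by (simp add: ip_def power2_eq_square)
    also have "\<dots> \<le> 1 / 12 * ip {..<D} (T x) (T x)" using z(2) rotations_ip[OF T] by simp
    finally show ?thesis by (simp add: ip_def power2_eq_square)
  qed
  let ?G = "gauss {..<D}"
  let ?P = "\<lambda>x. (\<Sum>i<m. (x i)\<^sup>2) \<le> 1 / 12 * (\<Sum>i<D. (x i)\<^sup>2)"
  have [measurable]: "(\<lambda>x. x i) \<in> borel_measurable ?G" if "i < D" for i
    using measurable_component_singleton[of i "{..<D}" "\<lambda>_. \<gamma>"] that by simp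
  have [measurable]: "(\<lambda>x. \<Sum>i<m. (x i)\<^sup>2) \<in> borel_measurable ?G" "(\<lambda>x. \<Sum>i<D. (x i)\<^sup>2) \<in> borel_measurable ?G"
    using assms by (auto intro!: borel_measurable_sum borel_measurable_power)
  have [measurable]: "T \<in> ?G \<rightarrow>\<^sub>M ?G" by (rule measurable_rotations[OF T])
  have P[measurable]: "Measurable.pred ?G ?P"
    unfolding pred_def by (intro borel_measurable_le borel_measurable_times borel_measurable_const) measurable
  have "emeasure ?G {x \<in> space ?G. near_ker m D w x} \<le> emeasure ?G {x \<in> space ?G. ?P (T x)}"
    using near by (intro emeasure_mono) auto
  also have "\<dots> = emeasure ?G {x \<in> space ?G. ?P x}" by (rule emeasure_rotations[OF T _ P]) simp
  also have "\<dots> \<le> ennreal (chernoff_bound m D)"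
    by (rule normal_coordinate_proportion[OF assms(1)])
  finally show ?thesis .
qed

text \<open>By rotation invariance the probability does not depend on the direction of x, so that x may be
  averaged over a Gaussian vector, and then the matrix may be frozen.\<close>

lemma near_ker_prob:
  assumes mM: "m \<le> M" and mD: "m \<le> D" and x: "ip {..<D} x x > 0"
  defines "G \<equiv> gauss ({..<M} \<times> {..<D})"
  shows "emeasure G {w \<in> space G. near_ker m D w x}
    \<le> ennreal (chernoff_bound m D)"
proof -
  let ?b = "ennreal (chernoff_bound m D)"
  let ?H = "gauss {..<D}"
  have "D > 0" using x by (cases "D = 0") (auto simp: ip_def)
  interpret G: prob_space G unfolding G_def by (rule prob_space_gauss)
  interpret H: prob_space ?H by (rule prob_space_gauss)
  interpret GH: pair_sigma_finite G ?H ..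
  define \<pi> where "\<pi> = emeasure G {w \<in> space G. near_ker m D w x}"
  have [measurable]: "Measurable.pred (G \<Otimes>\<^sub>M ?H) (\<lambda>e. near_ker m D (fst e) (snd e))"
    unfolding G_def by (rule pred_near_ker_pair)
  define f where "f = (\<lambda>e. indicator {e \<in> space (G \<Otimes>\<^sub>M ?H). near_ker m D (fst e) (snd e)} e :: ennreal)"
  have f[measurable]: "f \<in> borel_measurable (G \<Otimes>\<^sub>M ?H)" unfolding f_def by measurable
  have fw: "(\<integral>\<^sup>+ w. f (w, y) \<partial>G) = emeasure G {w \<in> space G. near_ker m D w y}" if "y \<in> space ?H" for y
  proof -
    have "{w \<in> space G. near_ker m D w y} \<in> sets G"
      unfolding G_def using pred_near_ker[where x = y] by (simp add: pred_def)
    then have "emeasure G {w \<in> space G. near_ker m D w y} = (\<integral>\<^sup>+ w. indicator {w \<in> space G. near_ker m D w y} w \<partial>G)"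
      by (rule nn_integral_indicator[symmetric])
    also have "\<dots> = (\<integral>\<^sup>+ w. f (w, y) \<partial>G)"
      using that by (intro nn_integral_cong) (auto simp: f_def space_pair_measure split: split_indicator)
    finally show ?thesis by simp
  qed
  have fx: "(\<integral>\<^sup>+ y. f (w, y) \<partial>?H) = emeasure ?H {y \<in> space ?H. near_ker m D w y}" if "w \<in> space G" for w
  proof -
    have "{y \<in> space ?H. near_ker m D w y} \<in> sets ?H"
      using pred_near_ker_snd[where w = w] by (simp add: pred_def)
    then have "emeasure ?H {y \<in> space ?H. near_ker m D w y} = (\<integral>\<^sup>+ y. indicator {y \<in> space ?H. near_ker m D w y} y \<partial>?H)"
      by (rule nn_integral_indicator[symmetric])
    also have "\<dots> = (\<integral>\<^sup>+ y. f (w, y) \<partial>?H)"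
      using that by (intro nn_integral_cong) (auto simp: f_def space_pair_measure split: split_indicator)
    finally show ?thesis by simp
  qed
  \<comment> \<open>Makes the norm of almost every \<open>y\<close> positive, as
    \<open>near_ker_prob_direction\<close> requires.\<close>
  have "AE y in ?H. y 0 \<noteq> 0"
  proof -
    have "{y \<in> space ?H. (\<Sum>k<D. (if k = 0 then 1 else 0) * y k) = 0} = {y \<in> space ?H. y 0 = 0}"
      using \<open>D > 0\<close> by (auto simp: if_distrib[of "\<lambda>c. c * _"] cong: if_cong)
    then have "emeasure ?H {y \<in> space ?H. y 0 = 0} = 0"
      using gauss_hyperplane_null[of "{..<D}" 0 "\<lambda>k. if k = 0 then 1 else 0"] \<open>D > 0\<close> by simp
    moreover have "(\<lambda>y. y 0) \<in> borel_measurable ?H"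
      using measurable_component_singleton[of 0 "{..<D}" "\<lambda>_. \<gamma>"] \<open>D > 0\<close> by simp
    then have "{y \<in> space ?H. y 0 = 0} \<in> sets ?H" by measurable
    ultimately show ?thesis by (subst AE_iff_null) (auto simp: null_sets_def)
  qed
  then have "AE y in ?H. (\<integral>\<^sup>+ w. f (w, y) \<partial>G) = \<pi>"
    using AE_space
  proof eventually_elim
    case (elim y)
    have "0 < (y 0)\<^sup>2" using elim by simp
    also have "\<dots> \<le> ip {..<D} y y"
      unfolding ip_def power2_eq_square using \<open>D > 0\<close> by (intro member_le_sum) auto
    finally have "emeasure G {w \<in> space G. near_ker m D w y} = \<pi>"
      unfolding \<pi>_def G_def near_ker_prob_direction[OF mM x] by (rule near_ker_prob_direction[OF mM])
    then show ?case using fw elim by simp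
  qed
  then have "(\<integral>\<^sup>+ y. \<integral>\<^sup>+ w. f (w, y) \<partial>G \<partial>?H) = (\<integral>\<^sup>+ y. \<pi> \<partial>?H)" by (rule nn_integral_cong_AE)
  also have "\<dots> = \<pi>" using H.emeasure_space_1 by simp
  finally have "\<pi> = (\<integral>\<^sup>+ y. \<integral>\<^sup>+ w. f (w, y) \<partial>G \<partial>?H)" ..
  also have "\<dots> = (\<integral>\<^sup>+ w. \<integral>\<^sup>+ y. f (w, y) \<partial>?H \<partial>G)" using f by (intro GH.Fubini') simp
  also have "\<dots> \<le> (\<integral>\<^sup>+ w. ?b \<partial>G)"
  proof (rule nn_integral_mono_AE)
    show "AE w in G. (\<integral>\<^sup>+ y. f (w, y) \<partial>?H) \<le> ?b"
      using AE_independent_rows[OF mM mD, folded G_def] AE_space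
    proof eventually_elim
      case (elim w)
      then show ?case using near_ker_fixed_matrix[OF mD] fx by simp
    qed
  qed
  also have "\<dots> = ?b" using G.emeasure_space_1 by simp
  finally show ?thesis by (simp add: \<pi>_def)
qed

section \<open>Measurability of the recovery event\<close>

text \<open>The stacking order of \<open>vec_of_cols\<close>, on plain functions. Positions from n^2
  on carry arbitrary values, so agreement is claimed only below n^2.\<close>

definition flat :: "nat \<Rightarrow> (nat \<times> nat \<Rightarrow> real) \<Rightarrow> nat \<Rightarrow> real" where
  "flat n F k = F (k mod n, k div n)"

lemma flat_cong:
  assumes "\<And>e. e \<in> sq n \<Longrightarrow> F e = G e" "k < n\<^sup>2"
  shows "flat n F k = flat n G k"
proof -
  have "n > 0" using assms(2) by (cases "n = 0") auto
  then have "(k mod n, k div n) \<in> sq n" using assms(2) by (simp add: less_mult_imp_div_less power2_eq_square)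
  then show ?thesis unfolding flat_def by (rule assms(1))
qed

lemma sum_flat: "(\<Sum>k<n\<^sup>2. h (k mod n, k div n)) = (\<Sum>e\<in>sq n. h e)"
proof (rule sum.reindex_bij_witness[where i = "\<lambda>(i, j). j * n + i" and j = "\<lambda>k. (k mod n, k div n)"])
  fix e assume "e \<in> sq n"
  then obtain i j where e: "e = (i, j)" "i < n" "j < n" by auto
  then have "j * n + i < Suc j * n" by simp
  also have "\<dots> \<le> n * n" using e by (intro mult_right_mono) auto
  finally show "(case e of (i, j) \<Rightarrow> j * n + i) \<in> {..<n\<^sup>2}" using e by (simp add: power2_eq_square)
next
  fix k assume "k \<in> {..<n\<^sup>2}"
  then have k: "k < n * n" by (simp add: power2_eq_square)
  then have "n > 0" by (cases "n = 0") auto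
  then show "(k mod n, k div n) \<in> sq n" using k by (simp add: less_mult_imp_div_less)
qed auto

lemma ip_flat: "ip {..<n\<^sup>2} (flat n F) (flat n G) = ip (sq n) F G"
  unfolding ip_def flat_def by (rule sum_flat[of "\<lambda>e. F e * G e"])

lemma lin_map_eq_iff:
  assumes "Z \<in> carrier_mat n n" "X \<in> carrier_mat n n"
  shows "lin_map (Matrix.mat m (n\<^sup>2) w) Z = lin_map (Matrix.mat m (n\<^sup>2) w) X \<longleftrightarrow>
    (\<forall>i<m. (\<Sum>k<n\<^sup>2. w (i, k) * flat n (\<lambda>e. Z $$ e - X $$ e) k) = 0)"
proof -
  let ?A = "Matrix.mat m (n\<^sup>2) w"
  have row: "lin_map ?A Y $ i = (\<Sum>k<n\<^sup>2. w (i, k) * flat n (\<lambda>e. Y $$ e) k)"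
    if "i < m" "Y \<in> carrier_mat n n" for Y i
    using that by (simp add: lin_map_def vec_of_cols_def flat_def scalar_prod_def power2_eq_square lessThan_atLeast0)
  have dim: "dim_vec (lin_map ?A Y) = m" for Y by (simp add: lin_map_def)
  have "lin_map ?A Z = lin_map ?A X \<longleftrightarrow> (\<forall>i<m. lin_map ?A Z $ i = lin_map ?A X $ i)"
    by (auto simp: vec_eq_iff dim)
  also have "\<dots> \<longleftrightarrow> (\<forall>i<m. (\<Sum>k<n\<^sup>2. w (i, k) * flat n (\<lambda>e. Z $$ e - X $$ e) k) = 0)"
    using row assms by (simp add: flat_def right_diff_distrib sum_subtractf)
  finally show ?thesis .
qed

text \<open>A competitor that merely ties with X already destroys uniqueness, so failure is a weak
  inequality, which is what makes it accessible to closed sets. In the absence of competitors the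
  feasible point X is the only minimizer.\<close>

lemma not_recovers_iff:
  assumes X: "X \<in> carrier_mat n n"
  shows "\<not> recovers n (Matrix.mat m (n\<^sup>2) w) X \<longleftrightarrow>
    (\<exists>H\<in>carrier_mat n n. ip (sq n) (\<lambda>e. H $$ e) (\<lambda>e. H $$ e) > 0 \<and>
      (\<forall>i<m. (\<Sum>k<n\<^sup>2. w (i, k) * flat n (\<lambda>e. H $$ e) k) = 0) \<and> nuclear_norm (X + H) \<le> nuclear_norm X)"
    (is "?L \<longleftrightarrow> ?R")
proof -
  let ?A = "Matrix.mat m (n\<^sup>2) w"
  let ?F = "\<lambda>Z. Z \<in> carrier_mat n n \<and> lin_map ?A Z = lin_map ?A X"
  have 1: "?L \<longleftrightarrow> (\<exists>Z. ?F Z \<and> Z \<noteq> X \<and> nuclear_norm Z \<le> nuclear_norm X)"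
  proof
    assume ?L
    show "\<exists>Z. ?F Z \<and> Z \<noteq> X \<and> nuclear_norm Z \<le> nuclear_norm X"
    proof (rule ccontr)
      assume no: "\<not> ?thesis"
      then have "is_arg_min nuclear_norm ?F Z \<longleftrightarrow> Z = X" for Z
        using X unfolding is_arg_min_def by (metis (no_types, lifting) not_le order.strict_implies_order)
      then show False using \<open>?L\<close> by (auto simp: recovers_def nuclear_argmin_def)
    qed
  next
    assume "\<exists>Z. ?F Z \<and> Z \<noteq> X \<and> nuclear_norm Z \<le> nuclear_norm X"
    then obtain Z where Z: "?F Z" "Z \<noteq> X" "nuclear_norm Z \<le> nuclear_norm X" by blast
    show ?L
    proof
      assume "recovers n ?A X"
      then have "is_arg_min nuclear_norm ?F X" "\<not> is_arg_min nuclear_norm ?F Z"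
        using Z(2) by (auto simp: recovers_def nuclear_argmin_def)
      then show False using Z unfolding is_arg_min_def by (meson less_le_trans)
    qed
  qed
  also have "\<dots> \<longleftrightarrow> ?R"
  proof
    assume "\<exists>Z. ?F Z \<and> Z \<noteq> X \<and> nuclear_norm Z \<le> nuclear_norm X"
    then obtain Z where Z: "?F Z" "Z \<noteq> X" "nuclear_norm Z \<le> nuclear_norm X" by blast
    define H where "H = Z - X"
    have H: "H \<in> carrier_mat n n" "X + H = Z" "\<And>e. e \<in> sq n \<Longrightarrow> H $$ e = Z $$ e - X $$ e"
      using Z X by (auto simp: H_def intro!: eq_matI)
    have "ip (sq n) (\<lambda>e. H $$ e) (\<lambda>e. H $$ e) \<noteq> 0"
    proof
      assume "ip (sq n) (\<lambda>e. H $$ e) (\<lambda>e. H $$ e) = 0"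
      then have "\<forall>e\<in>sq n. Z $$ e = X $$ e" using H(3) by (auto simp: ip_self_eq_0)
      then have "Z = X" using Z X by (intro eq_matI) auto
      then show False using Z by simp
    qed
    then have "ip (sq n) (\<lambda>e. H $$ e) (\<lambda>e. H $$ e) > 0"
      using ip_self_nonneg[of "sq n" "\<lambda>e. H $$ e"] by linarith
    moreover have "(\<Sum>k<n\<^sup>2. w (i, k) * flat n (\<lambda>e. H $$ e) k) = 0" if "i < m" for i
    proof -
      have "flat n (\<lambda>e. H $$ e) k = flat n (\<lambda>e. Z $$ e - X $$ e) k" if "k < n\<^sup>2" for k
        using H(3) that by (rule flat_cong)
      then show ?thesis using Z(1) X \<open>i < m\<close> lin_map_eq_iff[of Z n X m w] by simp
    qed
    ultimately show ?R using H Z by (intro bexI[of _ H]) auto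
  next
    assume ?R
    then obtain H where H: "H \<in> carrier_mat n n" "ip (sq n) (\<lambda>e. H $$ e) (\<lambda>e. H $$ e) > 0"
      "\<forall>i<m. (\<Sum>k<n\<^sup>2. w (i, k) * flat n (\<lambda>e. H $$ e) k) = 0" "nuclear_norm (X + H) \<le> nuclear_norm X" by blast
    have e: "(X + H) $$ e - X $$ e = H $$ e" if "e \<in> sq n" for e using that H(1) X by auto
    have "flat n (\<lambda>e. (X + H) $$ e - X $$ e) k = flat n (\<lambda>e. H $$ e) k" if "k < n\<^sup>2" for k
      using e that by (rule flat_cong)
    then have "?F (X + H)" using H X lin_map_eq_iff[of "X + H" n X m w] by simp
    moreover have "X + H \<noteq> X"
    proof
      assume "X + H = X"
      then have "ip (sq n) (\<lambda>e. H $$ e) (\<lambda>e. H $$ e) = 0" using e by (auto simp: ip_self_eq_0)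
      then show False using H(2) by simp
    qed
    ultimately show "\<exists>Z. ?F Z \<and> Z \<noteq> X \<and> nuclear_norm Z \<le> nuclear_norm X" using H(4) by blast
  qed
  finally show ?thesis .
qed

definition low_rank_failure :: "nat \<Rightarrow> nat \<Rightarrow> nat \<Rightarrow> (nat \<times> nat \<Rightarrow> real) \<Rightarrow> bool" where
  "low_rank_failure n m r w \<longleftrightarrow> (\<exists>X\<in>carrier_mat n n. \<exists>H\<in>carrier_mat n n. vec_space.rank n X \<le> r \<and>
     ip (sq n) (\<lambda>e. H $$ e) (\<lambda>e. H $$ e) > 0 \<and>
     (\<forall>i<m. (\<Sum>k<n\<^sup>2. w (i, k) * flat n (\<lambda>e. H $$ e) k) = 0) \<and> nuclear_norm (X + H) \<le> nuclear_norm X)"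

lemma recovers_low_rank_iff:
  assumes "0 \<le> \<beta>"
  shows "recovers_low_rank n \<beta> (Matrix.mat m (n\<^sup>2) w) \<longleftrightarrow> \<not> low_rank_failure n m (nat \<lfloor>\<beta> * real n\<rfloor>) w"
proof -
  have "real k \<le> \<beta> * real n \<longleftrightarrow> k \<le> nat \<lfloor>\<beta> * real n\<rfloor>" for k
    using assms by (simp add: le_nat_iff le_floor_iff)
  then have "\<not> recovers_low_rank n \<beta> (Matrix.mat m (n\<^sup>2) w) \<longleftrightarrow>
    (\<exists>X\<in>carrier_mat n n. vec_space.rank n X \<le> nat \<lfloor>\<beta> * real n\<rfloor> \<and> \<not> recovers n (Matrix.mat m (n\<^sup>2) w) X)"
    by (simp add: recovers_low_rank_def)
  also have "\<dots> \<longleftrightarrow> low_rank_failure n m (nat \<lfloor>\<beta> * real n\<rfloor>) w"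
    unfolding low_rank_failure_def by (intro bex_cong refl) (simp add: not_recovers_iff)
  finally show ?thesis by blast
qed

lemma nuclear_norm_rank_0:
  assumes "X \<in> carrier_mat n n" "vec_space.rank n X = 0"
  shows "nuclear_norm X = 0"
proof -
  obtain p \<sigma> u v where s: "svd n X p \<sigma> u v" using svd_exists[OF assms(1)] .
  then have "p = 0" using svd_length_le_rank[OF assms(1) s] assms(2) by simp
  then show ?thesis using s by (simp add: svd_def)
qed

text \<open>The approximation by rank 10 r is stated for r > 0. At rank 0 the matrix X is zero, and
  a nonzero H has positive nuclear norm.\<close>

lemma no_rank_0_failure: "\<not> low_rank_failure n m 0 w"
proof
  assume "low_rank_failure n m 0 w"
  then obtain X H where XH: "X \<in> carrier_mat n n" "H \<in> carrier_mat n n" "vec_space.rank n X = 0"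
    "ip (sq n) (\<lambda>e. H $$ e) (\<lambda>e. H $$ e) > 0" "nuclear_norm (X + H) \<le> nuclear_norm X"
    by (auto simp: low_rank_failure_def)
  obtain x y where "\<And>i j. i < n \<Longrightarrow> j < n \<Longrightarrow> X $$ (i, j) = (\<Sum>l<(0::nat). x l i * y l j :: real)"
    using rank_factorization[OF XH(1)] XH(3) by metis
  then have "X + H = H" using XH by (intro eq_matI) auto
  then have le: "nuclear_norm H \<le> 0" using XH nuclear_norm_rank_0 by simp
  obtain p \<sigma> u v where s: "svd n H p \<sigma> u v" using svd_exists[OF XH(2)] .
  have "p = 0"
  proof (rule ccontr)
    assume "p \<noteq> 0"
    then have "(\<Sum>l<p. \<sigma> l) > 0" using s by (intro sum_pos) (auto simp: svd_def)
    then show False using le s by (simp add: svd_def)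
  qed
  then show False using svd_norm[OF s] XH(4) by simp
qed

text \<open>Stated for matrices that depend on a parameter of any topological space, so that the
  failure conditions on the encoding array are closed.\<close>

lemma continuous_on_nuclear_norm:
  fixes F :: "'a::topological_space \<Rightarrow> nat \<times> nat \<Rightarrow> real"
  assumes "\<And>e. e \<in> sq n \<Longrightarrow> continuous_on S (\<lambda>p. F p e)"
  shows "continuous_on S (\<lambda>p. nuclear_norm (Matrix.mat n n (F p)))"
  unfolding continuous_on_def
proof
  fix p assume "p \<in> S"
  let ?N = "\<lambda>p. nuclear_norm (Matrix.mat n n (F p))"
  have bound: "\<bar>?N q - ?N p\<bar> \<le> (\<Sum>i<n. \<Sum>j<n. \<bar>F q (i, j) - F p (i, j)\<bar>)" for q
    using nuclear_norm_lipschitz[of "Matrix.mat n n (F p)" n "Matrix.mat n n (F q)"]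
      nuclear_norm_lipschitz[of "Matrix.mat n n (F q)" n "Matrix.mat n n (F p)"]
    by (simp add: abs_le_iff abs_minus_commute[of "F p _" "F q _"])
  have "((\<lambda>q. \<bar>F q (i, j) - F p (i, j)\<bar>) \<longlongrightarrow> 0) (at p within S)" if "i < n" "j < n" for i j
  proof -
    have "((\<lambda>q. F q (i, j)) \<longlongrightarrow> F p (i, j)) (at p within S)"
      using assms[of "(i, j)"] that \<open>p \<in> S\<close> by (simp add: continuous_on_def)
    then show ?thesis by (simp add: LIM_zero tendsto_rabs_zero)
  qed
  then have "((\<lambda>q. \<Sum>i<n. \<Sum>j<n. \<bar>F q (i, j) - F p (i, j)\<bar>) \<longlongrightarrow> (\<Sum>i<n. \<Sum>j<n. 0)) (at p within S)"
    by (intro tendsto_sum) auto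
  then have "((\<lambda>q. \<Sum>i<n. \<Sum>j<n. \<bar>F q (i, j) - F p (i, j)\<bar>) \<longlongrightarrow> 0) (at p within S)" by simp
  then have "((\<lambda>q. \<bar>?N q - ?N p\<bar>) \<longlongrightarrow> 0) (at p within S)"
    by (rule tendsto_sandwich[OF _ _ tendsto_const, rotated 2]) (auto intro!: always_eventually bound)
  then show "(?N \<longlongrightarrow> ?N p) (at p within S)"
    by (intro LIM_zero_cancel[of ?N] tendsto_rabs_zero_cancel[of "\<lambda>q. ?N q - ?N p"])
qed

text \<open>A failure is encoded by one array y: the slices y (0, _, _) and y (1, _, _) hold the left and right
  factors of X, the slice y (2, _, _) holds H.\<close>

lemma pred_low_rank_failure: "Measurable.pred (gauss I) (low_rank_failure n m r)"
proof (rule pred_gauss_borel)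
  define Xf :: "(nat \<times> nat \<times> nat \<Rightarrow> real) \<Rightarrow> nat \<times> nat \<Rightarrow> real" where
    "Xf = (\<lambda>y e. \<Sum>l<r. y (0, l, fst e) * y (1, l, snd e))"
  define Hf :: "(nat \<times> nat \<times> nat \<Rightarrow> real) \<Rightarrow> nat \<times> nat \<Rightarrow> real" where "Hf = (\<lambda>y e. y (2, e))"
  \<comment> \<open>The open condition that H is nonzero is exhausted by the closed conditions with
    threshold 1/(q + 1); each \<open>C q\<close> is closed, and its projection is Borel.\<close>
  define C where "C = (\<lambda>q. {p :: (nat \<times> nat \<Rightarrow> real) \<times> (nat \<times> nat \<times> nat \<Rightarrow> real).
     1 / real (Suc q) \<le> ip (sq n) (Hf (snd p)) (Hf (snd p)) \<and>
     (\<forall>i<m. (\<Sum>k<n\<^sup>2. fst p (i, k) * flat n (Hf (snd p)) k) = 0) \<and>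
     nuclear_norm (Matrix.mat n n (\<lambda>e. Xf (snd p) e + Hf (snd p) e)) \<le> nuclear_norm (Matrix.mat n n (\<lambda>e. Xf (snd p) e))})"
  have "closed (C q)" for q
    unfolding C_def ip_def flat_def Xf_def Hf_def
    by (intro closed_Collect_conj closed_Collect_all closed_Collect_imp closed_Collect_eq
        closed_Collect_le continuous_on_nuclear_norm continuous_on_sum continuous_on_mult continuous_on_add continuous_on_const
        continuous_on_coordinate) auto
  \<comment> \<open>The middle index has to accommodate the factors of X, up to \<open>r\<close> of
    them, as well as the \<open>n\<close> rows of H.\<close>
  define J where "J = {..<3::nat} \<times> {..<r + n} \<times> {..<n}"
  have "finite J" by (simp add: J_def)
  have "(\<Union>q. {w. \<exists>y. (\<forall>i. i \<notin> J \<longrightarrow> y i = 0) \<and> (w, y) \<in> C q}) \<in> sets borel"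
    using borel_projection[OF \<open>closed (C _)\<close> \<open>finite J\<close>] by (intro sets.countable_UN) auto
  also have "(\<Union>q. {w. \<exists>y. (\<forall>i. i \<notin> J \<longrightarrow> y i = 0) \<and> (w, y) \<in> C q}) = {w. low_rank_failure n m r w}"
  proof safe
    fix q w y assume "\<forall>i. i \<notin> J \<longrightarrow> y i = 0" "(w, y) \<in> C q"
    then have y: "1 / real (Suc q) \<le> ip (sq n) (Hf y) (Hf y)" "\<And>i. i < m \<Longrightarrow> (\<Sum>k<n\<^sup>2. w (i, k) * flat n (Hf y) k) = 0"
      "nuclear_norm (Matrix.mat n n (\<lambda>e. Xf y e + Hf y e)) \<le> nuclear_norm (Matrix.mat n n (Xf y))"
      by (auto simp: C_def)
    define X H where "X = Matrix.mat n n (Xf y)" and "H = Matrix.mat n n (Hf y)"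
    have carr: "X \<in> carrier_mat n n" "H \<in> carrier_mat n n" by (auto simp: X_def H_def)
    have He: "H $$ e = Hf y e" if "e \<in> sq n" for e using that by (auto simp: H_def)
    have XH: "X + H = Matrix.mat n n (\<lambda>e. Xf y e + Hf y e)" by (intro eq_matI) (auto simp: X_def H_def)
    have "vec_space.rank n X \<le> r"
      by (rule rank_of_sum_le[OF carr(1), where x = "\<lambda>l i. y (0, l, i)" and y = "\<lambda>l j. y (1, l, j)"])
         (auto simp: X_def Xf_def)
    moreover have "ip (sq n) (\<lambda>e. H $$ e) (\<lambda>e. H $$ e) = ip (sq n) (Hf y) (Hf y)" using He by (intro ip_cong) auto
    moreover have "0 < ip (sq n) (Hf y) (Hf y)" by (rule less_le_trans[OF _ y(1)]) simp
    moreover have "(\<Sum>k<n\<^sup>2. w (i, k) * flat n (\<lambda>e. H $$ e) k) = 0" if "i < m" for i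
    proof -
      have "flat n (\<lambda>e. H $$ e) k = flat n (Hf y) k" if "k < n\<^sup>2" for k
        using He that by (rule flat_cong)
      then show ?thesis using y(2)[OF that] by simp
    qed
    ultimately show "low_rank_failure n m r w"
      using carr y(1,3) unfolding low_rank_failure_def XH[symmetric] X_def[symmetric]
      by (rule_tac bexI[where x = X], rule_tac bexI[where x = H]) auto
  next
    fix w assume "low_rank_failure n m r w"
    then obtain X H where XH: "X \<in> carrier_mat n n" "H \<in> carrier_mat n n" "vec_space.rank n X \<le> r"
      "ip (sq n) (\<lambda>e. H $$ e) (\<lambda>e. H $$ e) > 0"
      "\<And>i. i < m \<Longrightarrow> (\<Sum>k<n\<^sup>2. w (i, k) * flat n (\<lambda>e. H $$ e) k) = 0"
      "nuclear_norm (X + H) \<le> nuclear_norm X" unfolding low_rank_failure_def by blast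
    obtain b c where bc: "\<And>i j. i < n \<Longrightarrow> j < n \<Longrightarrow> X $$ (i, j) = (\<Sum>l<vec_space.rank n X. b l i * c l j)"
      using rank_factorization[OF XH(1)] by metis
    define y :: "nat \<times> nat \<times> nat \<Rightarrow> real" where "y = (\<lambda>(t, l, i).
        if t = 0 \<and> l < vec_space.rank n X \<and> i < n then b l i
        else if t = 1 \<and> l < vec_space.rank n X \<and> i < n then c l i
        else if t = 2 \<and> l < n \<and> i < n then H $$ (l, i) else 0)"
    have supp: "\<forall>i. i \<notin> J \<longrightarrow> y i = 0" using XH(3) by (auto simp: y_def J_def)
    have Hy: "Hf y e = H $$ e" if "e \<in> sq n" for e using that by (auto simp: Hf_def y_def)
    have Xy: "Xf y e = X $$ e" if "e \<in> sq n" for e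
    proof -
      obtain i j where e: "e = (i, j)" "i < n" "j < n" using \<open>e \<in> sq n\<close> by auto
      have "Xf y e = (\<Sum>l<vec_space.rank n X. b l i * c l j)"
        unfolding Xf_def using e XH(3) by (intro sum.mono_neutral_cong_right) (auto simp: y_def)
      then show ?thesis using bc e by simp
    qed
    obtain q where q: "1 / real (Suc q) < ip (sq n) (\<lambda>e. H $$ e) (\<lambda>e. H $$ e)"
      using reals_Archimedean[OF XH(4)] by (auto simp: inverse_eq_divide)
    have mats: "Matrix.mat n n (\<lambda>e. Xf y e + Hf y e) = X + H" "Matrix.mat n n (Xf y) = X"
      using XH(1,2) Xy Hy by (auto intro!: eq_matI)
    have "ip (sq n) (Hf y) (Hf y) = ip (sq n) (\<lambda>e. H $$ e) (\<lambda>e. H $$ e)" using Hy by (intro ip_cong) auto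
    moreover have "flat n (Hf y) k = flat n (\<lambda>e. H $$ e) k" if "k < n\<^sup>2" for k
      using Hy that by (rule flat_cong)
    ultimately have "(w, y) \<in> C q" using XH(5,6) q mats by (simp add: C_def)
    then show "w \<in> (\<Union>q. {w. \<exists>y. (\<forall>i. i \<notin> J \<longrightarrow> y i = 0) \<and> (w, y) \<in> C q})" using supp by blast
  qed
  finally show "{w. low_rank_failure n m r w} \<in> sets borel" .
qed

section \<open>A net of low-rank matrices\<close>

lemma sum_power_abs_le:
  fixes x :: real
  assumes "0 < x" "x < 1"
  shows "(\<Sum>j\<in>{- int N..int N}. x ^ nat \<bar>j\<bar>) \<le> (1 + x) / (1 - x)"
proof -
  have "(1 - x) * (\<Sum>j\<in>{- int N..int N}. x ^ nat \<bar>j\<bar>) = 1 + x - 2 * x ^ Suc N"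
  proof (induction N)
    case (Suc N)
    have "{- int (Suc N)..int (Suc N)} = insert (- int (Suc N)) (insert (int (Suc N)) {- int N..int N})"
      by auto
    then have "(\<Sum>j\<in>{- int (Suc N)..int (Suc N)}. x ^ nat \<bar>j\<bar>) = 2 * x ^ Suc N + (\<Sum>j\<in>{- int N..int N}. x ^ nat \<bar>j\<bar>)"
      by (simp add: nat_add_distrib)
    then have "(1 - x) * (\<Sum>j\<in>{- int (Suc N)..int (Suc N)}. x ^ nat \<bar>j\<bar>)
        = (1 - x) * (2 * x ^ Suc N) + (1 - x) * (\<Sum>j\<in>{- int N..int N}. x ^ nat \<bar>j\<bar>)"
      by (simp only: distrib_left)
    then show ?case unfolding Suc by (simp add: algebra_simps)
  qed (simp add: algebra_simps)
  also have "\<dots> \<le> 1 + x" using assms by simp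
  finally show ?thesis using assms by (simp add: field_simps)
qed

text \<open>Weighting f by the product of x to the power abs (f i) makes the count a product of
  geometric sums.\<close>

lemma card_l1_ball_int:
  fixes x :: real and N :: nat and I :: "'i set"
  assumes "finite I" "0 < x" "x < 1"
  defines "A \<equiv> {f \<in> I \<rightarrow>\<^sub>E {- int N..int N}. (\<Sum>i\<in>I. \<bar>f i\<bar>) \<le> int N}"
  shows "finite A" "real (card A) * x ^ N \<le> ((1 + x) / (1 - x)) ^ card I"
proof -
  have fin: "finite (I \<rightarrow>\<^sub>E {- int N..int N})" using assms(1) by (intro finite_PiE) auto
  then show "finite A" unfolding A_def by simp
  have "real (card A) * x ^ N = (\<Sum>f\<in>A. x ^ N)" by simp
  also have "\<dots> \<le> (\<Sum>f\<in>A. \<Prod>i\<in>I. x ^ nat \<bar>f i\<bar>)"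
  proof (rule sum_mono)
    fix f assume "f \<in> A"
    moreover have "int (\<Sum>i\<in>I. nat \<bar>f i\<bar>) = (\<Sum>i\<in>I. \<bar>f i\<bar>)" by simp
    ultimately have "int (\<Sum>i\<in>I. nat \<bar>f i\<bar>) \<le> int N" unfolding A_def by (metis (mono_tags, lifting) mem_Collect_eq)
    then have "(\<Sum>i\<in>I. nat \<bar>f i\<bar>) \<le> N" by (simp only: of_nat_le_iff)
    then have "x ^ N \<le> x ^ (\<Sum>i\<in>I. nat \<bar>f i\<bar>)" using assms by (intro power_decreasing) auto
    then show "x ^ N \<le> (\<Prod>i\<in>I. x ^ nat \<bar>f i\<bar>)" by (simp add: power_sum)
  qed
  also have "\<dots> \<le> (\<Sum>f\<in>I \<rightarrow>\<^sub>E {- int N..int N}. \<Prod>i\<in>I. x ^ nat \<bar>f i\<bar>)"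
    using fin assms(2) by (intro sum_mono2 prod_nonneg) (auto simp: A_def)
  also have "\<dots> = (\<Prod>i\<in>I. \<Sum>j\<in>{- int N..int N}. x ^ nat \<bar>j\<bar>)"
    using assms(1) by (intro prod_sum_PiE[symmetric]) auto
  also have "\<dots> \<le> (\<Prod>i\<in>I. (1 + x) / (1 - x))"
    using assms(2,3) by (intro prod_mono conjI sum_nonneg sum_power_abs_le) auto
  finally show "real (card A) * x ^ N \<le> ((1 + x) / (1 - x)) ^ card I" by simp
qed

definition cell_index :: "nat \<Rightarrow> nat \<Rightarrow> (bool \<times> nat \<times> nat) set" where
  "cell_index n k = UNIV \<times> {..<k} \<times> {..<n}"

text \<open>The Boolean selects the factor; rounding down the scaled coordinates gives cells of diameter 1/20
  for the whole left factor and for each column of the right factor.\<close>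

definition scaled_coord :: "nat \<Rightarrow> nat \<Rightarrow> (nat \<Rightarrow> nat \<Rightarrow> real) \<Rightarrow> (nat \<Rightarrow> nat \<Rightarrow> real) \<Rightarrow> bool \<times> nat \<times> nat \<Rightarrow> real" where
  "scaled_coord n k b c = (\<lambda>(s, l, i). if s then b l i * (20 * sqrt (real (k * n))) else c l i * (20 * sqrt (real n)))"

definition cell :: "nat \<Rightarrow> nat \<Rightarrow> (nat \<Rightarrow> nat \<Rightarrow> real) \<Rightarrow> (nat \<Rightarrow> nat \<Rightarrow> real) \<Rightarrow> bool \<times> nat \<times> nat \<Rightarrow> int" where
  "cell n k b c = restrict (\<lambda>e. \<lfloor>scaled_coord n k b c e\<rfloor>) (cell_index n k)"

text \<open>An l1 ball rather than a box: one coordinate can reach 20 sqrt(k n), so a box would cost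
  a logarithm of n per coordinate, whereas the l1 ball costs a constant. Its radius is explained by
  \<open>cell_in_cells\<close>.\<close>

definition cells :: "nat \<Rightarrow> nat \<Rightarrow> (bool \<times> nat \<times> nat \<Rightarrow> int) set" where
  "cells n k = {f \<in> cell_index n k \<rightarrow>\<^sub>E {- int (42 * (k * n))..int (42 * (k * n))}.
     (\<Sum>e\<in>cell_index n k. \<bar>f e\<bar>) \<le> int (42 * (k * n))}"

lemma finite_cell_index: "finite (cell_index n k)" and card_cell_index: "card (cell_index n k) = 2 * (k * n)"
  by (simp_all add: cell_index_def card_cartesian_product card_UNIV_bool)

lemma finite_cells: "finite (cells n k)"
  unfolding cells_def by (rule card_l1_ball_int(1)[OF finite_cell_index, of "1 / 2"]) auto

text \<open>The radius is 21 times the number 2 k n of coordinates. The weight x = 21/22 is close to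
  the minimizer of (1 + x)/(1 - x) divided by x^21 and gives about 114.2.\<close>

lemma card_cells: "real (card (cells n k)) \<le> 115 ^ (2 * (k * n))"
proof -
  let ?N = "2 * (k * n)"
  have "real (card (cells n k)) * (21 / 22) ^ (42 * (k * n)) \<le> ((1 + 21 / 22) / (1 - 21 / 22)) ^ ?N"
    using card_l1_ball_int(2)[OF finite_cell_index, of "21 / 22" n k "42 * (k * n)"]
    by (simp only: cells_def card_cell_index)
  also have "((1 + 21 / 22) / (1 - 21 / 22) :: real) = 43" by simp
  also have "(42 * (k * n)) = 21 * ?N" by simp
  finally have "real (card (cells n k)) * ((21 / 22) ^ 21) ^ ?N \<le> 43 ^ ?N" by (simp only: power_mult)
  also have "(43 :: real) ^ ?N \<le> (115 * (21 / 22) ^ 21) ^ ?N" by (intro power_mono) (simp_all add: power_divide)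
  also have "\<dots> = 115 ^ ?N * ((21 / 22) ^ 21) ^ ?N" by (rule power_mult_distrib)
  finally show ?thesis by (rule mult_right_le_imp_le) simp
qed

lemma sum_abs_le_sqrt:
  fixes x :: "'a \<Rightarrow> real"
  assumes "(\<Sum>i\<in>I. x i * x i) \<le> 1"
  shows "(\<Sum>i\<in>I. \<bar>x i\<bar>) \<le> sqrt (real (card I))"
proof -
  have "(\<Sum>i\<in>I. 1 * \<bar>x i\<bar>)\<^sup>2 \<le> (\<Sum>i\<in>I. 1\<^sup>2) * (\<Sum>i\<in>I. \<bar>x i\<bar>\<^sup>2)" by (rule Cauchy_Schwarz_ineq_sum)
  also have "\<dots> \<le> real (card I) * 1" using assms by (intro mult_mono) (auto simp: power2_eq_square sum_nonneg)
  finally show ?thesis by (intro real_le_rsqrt) simp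
qed

lemma sum_cell_index:
  "(\<Sum>e\<in>cell_index n k. h e) = (\<Sum>l<k. \<Sum>i<n. h (True, l, i)) + (\<Sum>l<k. \<Sum>i<n. h (False, l, i) :: 'a :: comm_monoid_add)"
  unfolding cell_index_def UNIV_bool by (simp add: sum.cartesian_product' add.commute)

text \<open>By Cauchy-Schwarz either scaled factor has l1 norm at most 20 k n: the left one has norm
  1 over k n coordinates, each right column norm at most 1 over n coordinates. Rounding adds at most
  1 for each of the 2 k n coordinates, in all 42 k n.\<close>

lemma cell_in_cells:
  assumes "unit_frame n k b c"
  shows "cell n k b c \<in> cells n k"
proof -
  let ?y = "scaled_coord n k b c"
  have c: "(\<Sum>i<n. \<bar>?y (False, l, i)\<bar>) \<le> 20 * real n" if "l < k" for l
  proof -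
    have "(\<Sum>i<n. \<bar>c l i\<bar>) \<le> sqrt (real n)"
      using sum_abs_le_sqrt[of "c l" "{..<n}"] assms that by (simp add: unit_frame_def ip_def)
    then have "(\<Sum>i<n. \<bar>c l i\<bar>) * (20 * sqrt (real n)) \<le> sqrt (real n) * (20 * sqrt (real n))"
      by (intro mult_right_mono) auto
    then show ?thesis by (simp add: scaled_coord_def abs_mult sum_distrib_right[symmetric])
  qed
  have b: "(\<Sum>l<k. \<Sum>i<n. \<bar>?y (True, l, i)\<bar>) \<le> 20 * real (k * n)"
  proof -
    have "(\<Sum>e\<in>{..<k} \<times> {..<n}. \<bar>b (fst e) (snd e)\<bar>) \<le> sqrt (real (card ({..<k} \<times> {..<n})))"
      using assms by (intro sum_abs_le_sqrt) (simp add: unit_frame_def ip_def sum.cartesian_product')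
    then have "(\<Sum>l<k. \<Sum>i<n. \<bar>b l i\<bar>) \<le> sqrt (real (k * n))"
      by (simp add: sum.cartesian_product')
    then have "(\<Sum>l<k. \<Sum>i<n. \<bar>b l i\<bar>) * (20 * sqrt (real (k * n))) \<le> sqrt (real (k * n)) * (20 * sqrt (real (k * n)))"
      by (intro mult_right_mono) auto
    also have "\<dots> = 20 * (sqrt (real (k * n)) * sqrt (real (k * n)))" by simp
    also have "\<dots> = 20 * real (k * n)" by (simp only: real_sqrt_mult_self abs_of_nat)
    finally show ?thesis
      by (simp add: scaled_coord_def abs_mult sum_distrib_right[symmetric] del: real_sqrt_mult of_nat_mult)
  qed
  have "(\<Sum>e\<in>cell_index n k. \<bar>?y e\<bar>) \<le> 20 * real (k * n) + (\<Sum>l<k. 20 * real n)"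
    unfolding sum_cell_index using b c by (intro add_mono sum_mono) auto
  then have y: "(\<Sum>e\<in>cell_index n k. \<bar>?y e\<bar>) \<le> 40 * real (k * n)" by simp
  have "real_of_int (\<Sum>e\<in>cell_index n k. \<bar>cell n k b c e\<bar>) \<le> (\<Sum>e\<in>cell_index n k. \<bar>?y e\<bar> + 1)"
    unfolding of_int_sum
  proof (rule sum_mono)
    fix e assume "e \<in> cell_index n k"
    then show "real_of_int \<bar>cell n k b c e\<bar> \<le> \<bar>?y e\<bar> + 1"
      unfolding cell_def restrict_apply by simp linarith
  qed
  also have "\<dots> \<le> 42 * real (k * n)"
    using y by (simp add: sum.distrib card_cell_index)
  finally have "real_of_int (\<Sum>e\<in>cell_index n k. \<bar>cell n k b c e\<bar>) \<le> real_of_int (int (42 * (k * n)))" by simp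
  then have S: "(\<Sum>e\<in>cell_index n k. \<bar>cell n k b c e\<bar>) \<le> int (42 * (k * n))" by (simp only: of_int_le_iff)
  have "\<bar>cell n k b c e\<bar> \<le> int (42 * (k * n))" if "e \<in> cell_index n k" for e
  proof -
    have "\<bar>cell n k b c e\<bar> \<le> (\<Sum>e\<in>cell_index n k. \<bar>cell n k b c e\<bar>)"
      using that finite_cell_index by (intro member_le_sum) auto
    then show ?thesis using S by simp
  qed
  then have "cell n k b c \<in> cell_index n k \<rightarrow>\<^sub>E {- int (42 * (k * n))..int (42 * (k * n))}"
    by (intro PiE_I) (auto simp: abs_le_iff cell_def minus_le_iff)
  then show ?thesis using S by (simp add: cells_def)
qed

text \<open>Equal floors mean scaled coordinates at distance at most 1, hence an error of 1/20 in
  each factor; \<open>frame_mat_close\<close> adds the two.\<close>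

lemma same_cell_close:
  assumes bc: "unit_frame n k b c" and bc': "unit_frame n k b' c'" and eq: "cell n k b c = cell n k b' c'"
    and pos: "n > 0" "k > 0"
  shows "ip (sq n) (\<lambda>e. frame_mat k b c e - frame_mat k b' c' e) (\<lambda>e. frame_mat k b c e - frame_mat k b' c' e)
    \<le> (1 / 10)\<^sup>2"
proof -
  have near: "\<bar>scaled_coord n k b c e - scaled_coord n k b' c' e\<bar> \<le> 1" if "e \<in> cell_index n k" for e
  proof -
    have "\<lfloor>scaled_coord n k b c e\<rfloor> = \<lfloor>scaled_coord n k b' c' e\<rfloor>"
      using fun_cong[OF eq, of e] that by (simp add: cell_def)
    then show ?thesis by linarith
  qed
  have sq: "d * d \<le> (1 / 20)\<^sup>2 / K" if "\<bar>u * (20 * sqrt K) - v * (20 * sqrt K)\<bar> \<le> 1" "d = u - v" "K > 0" for u v d K :: real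
  proof -
    have "\<bar>d * (20 * sqrt K)\<bar> \<le> 1" using that by (simp add: left_diff_distrib)
    then have "(d * (20 * sqrt K))\<^sup>2 \<le> 1" by (simp only: abs_square_le_1)
    moreover have "(d * (20 * sqrt K))\<^sup>2 = d * d * (400 * K)"
      using \<open>K > 0\<close> by (simp add: power_mult_distrib) (simp add: power2_eq_square)
    ultimately have "d * d * (400 * K) \<le> 1" by simp
    then show ?thesis using \<open>K > 0\<close> by (simp add: field_simps power2_eq_square)
  qed
  have c: "ip {..<n} (\<lambda>i. c l i - c' l i) (\<lambda>i. c l i - c' l i) \<le> (1 / 20)\<^sup>2" if "l < k" for l
  proof -
    have "(c l i - c' l i) * (c l i - c' l i) \<le> (1 / 20)\<^sup>2 / real n" if "i < n" for i
      using near[of "(False, l, i)"] \<open>l < k\<close> that pos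
      by (intro sq[of "c l i" "real n" "c' l i"]) (auto simp: cell_index_def scaled_coord_def)
    then have "ip {..<n} (\<lambda>i. c l i - c' l i) (\<lambda>i. c l i - c' l i) \<le> (\<Sum>i<n. (1 / 20)\<^sup>2 / real n)"
      unfolding ip_def by (intro sum_mono) auto
    then show ?thesis using pos by simp
  qed
  have b: "(\<Sum>l<k. ip {..<n} (\<lambda>i. b l i - b' l i) (\<lambda>i. b l i - b' l i)) \<le> (1 / 20)\<^sup>2"
  proof -
    have "(b l i - b' l i) * (b l i - b' l i) \<le> (1 / 20)\<^sup>2 / real (k * n)" if "i < n" "l < k" for i l
      using near[of "(True, l, i)"] that pos
      by (intro sq[of "b l i" "real (k * n)" "b' l i"]) (auto simp: cell_index_def scaled_coord_def)
    then have "(\<Sum>l<k. ip {..<n} (\<lambda>i. b l i - b' l i) (\<lambda>i. b l i - b' l i)) \<le> (\<Sum>l<k. \<Sum>i<n. (1 / 20)\<^sup>2 / real (k * n))"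
      unfolding ip_def by (intro sum_mono) auto
    then show ?thesis using pos by simp
  qed
  show ?thesis using frame_mat_close[OF bc bc' _ c b] by simp
qed

text \<open>The conclusion covers every pair in the cell, so that a representative can be fixed
  before the random matrix is drawn.\<close>

lemma near_ker_of_cell:
  assumes X: "X \<in> carrier_mat n n" and H: "H \<in> carrier_mat n n"
    and le: "nuclear_norm (X + H) \<le> nuclear_norm X" and rank: "vec_space.rank n X \<le> r" "r > 0"
    and H0: "ip (sq n) (\<lambda>e. H $$ e) (\<lambda>e. H $$ e) > 0"
    and ker: "\<And>i. i < m \<Longrightarrow> (\<Sum>k<n\<^sup>2. w (i, k) * flat n (\<lambda>e. H $$ e) k) = 0"
  shows "\<exists>f\<in>cells n (10 * r). \<exists>b c. unit_frame n (10 * r) b c \<and> cell n (10 * r) b c = f \<and>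
    (\<forall>b' c'. unit_frame n (10 * r) b' c' \<longrightarrow> cell n (10 * r) b' c' = f \<longrightarrow>
      near_ker m (n\<^sup>2) w (flat n (frame_mat (10 * r) b' c')))"
proof -
  define K where "K = 10 * r"
  have "K > 0" using rank by (simp add: K_def)
  have "n > 0" using H0 by (cases "n = 0") (auto simp: ip_def)
  obtain b c \<alpha> where bc: "unit_frame n K b c"
    and close: "ip (sq n) (\<lambda>e. frame_mat K b c e - \<alpha> * H $$ e) (\<lambda>e. frame_mat K b c e - \<alpha> * H $$ e) \<le> 1 / 32"
    unfolding K_def by (rule low_rank_approximation[OF X H le rank H0])
  have "near_ker m (n\<^sup>2) w (flat n (frame_mat K b' c'))"
    if bc': "unit_frame n K b' c'" and eq: "cell n K b' c' = cell n K b c" for b' c'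
  proof -
    let ?z = "\<lambda>k. if k < n\<^sup>2 then \<alpha> * flat n (\<lambda>e. H $$ e) k else 0"
    let ?W = "frame_mat K b' c'"
    \<comment> \<open>0.178 is a rational upper bound of sqrt(1/32), and 0.278^2 is below
      1/12.\<close>
    have "ip (sq n) (\<lambda>e. (?W e - frame_mat K b c e) + (frame_mat K b c e - \<alpha> * H $$ e))
        (\<lambda>e. (?W e - frame_mat K b c e) + (frame_mat K b c e - \<alpha> * H $$ e)) \<le> (1 / 10 + 0.178)\<^sup>2"
      by (intro ip_triangle same_cell_close bc bc' eq \<open>K > 0\<close> \<open>n > 0\<close> order_trans[OF close]) (simp_all add: power2_eq_square)
    also have "\<dots> \<le> 1 / 12" by (simp add: power2_eq_square)
    finally have "ip (sq n) (\<lambda>e. ?W e - \<alpha> * H $$ e) (\<lambda>e. ?W e - \<alpha> * H $$ e) \<le> 1 / 12" by simp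
    moreover have "ip {..<n\<^sup>2} (\<lambda>k. flat n ?W k - ?z k) (\<lambda>k. flat n ?W k - ?z k)
        = ip (sq n) (\<lambda>e. ?W e - \<alpha> * H $$ e) (\<lambda>e. ?W e - \<alpha> * H $$ e)"
      unfolding ip_flat[symmetric] by (intro ip_cong) (auto simp: flat_def)
    moreover have "ip {..<n\<^sup>2} (flat n ?W) (flat n ?W) = 1" unfolding ip_flat by (rule unit_frame_norm[OF bc'])
    moreover have "(\<Sum>k<n\<^sup>2. w (i, k) * ?z k) = 0" if "i < m" for i
    proof -
      have "(\<Sum>k<n\<^sup>2. w (i, k) * ?z k) = \<alpha> * (\<Sum>k<n\<^sup>2. w (i, k) * flat n (\<lambda>e. H $$ e) k)"
        by (simp add: sum_distrib_left mult_ac)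
      then show ?thesis using ker[OF that] by simp
    qed
    ultimately show ?thesis unfolding near_ker_def by (intro exI[of _ ?z]) auto
  qed
  then show ?thesis
    using bc cell_in_cells[OF bc] unfolding K_def[symmetric] by (intro bexI[of _ "cell n K b c"] exI[of _ b] exI[of _ c]) auto
qed

text \<open>Union bound over the occupied cells. \<open>m'\<close> discards rows beyond n^2, because
  the bound for a fixed vector is for at most as many rows as columns; fewer constraints only
  enlarge the covering events.\<close>

lemma low_rank_failure_prob:
  fixes n m r :: nat
  assumes "r > 0"
  defines "m' \<equiv> min m (n\<^sup>2)"
  defines "G \<equiv> gauss ({..<m} \<times> {..<n\<^sup>2})"
  shows "emeasure G {w \<in> space G. low_rank_failure n m r w} \<le>
    ennreal (115 ^ (20 * (r * n)) * chernoff_bound m' (n\<^sup>2))"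
proof -
  let ?k = "10 * r"
  let ?p = "chernoff_bound m' (n\<^sup>2)"
  define Q where "Q = (\<lambda>f bc. unit_frame n ?k (fst bc) (snd bc) \<and> cell n ?k (fst bc) (snd bc) = f)"
  define F where "F = {f \<in> cells n ?k. \<exists>bc. Q f bc}"
  \<comment> \<open>One pair per occupied cell, chosen without reference to the random
    matrix.\<close>
  define rep where "rep = (\<lambda>f. SOME bc. Q f bc)"
  have rep: "Q f (rep f)" if "f \<in> F" for f using that unfolding F_def rep_def by (auto intro: someI)
  define W where "W = (\<lambda>f. flat n (frame_mat ?k (fst (rep f)) (snd (rep f))))"
  define E where "E = (\<lambda>f. {w \<in> space G. near_ker m' (n\<^sup>2) w (W f)})"
  have E: "E f \<in> sets G" for f
    unfolding E_def G_def using pred_near_ker[where x = "W f"] by (simp add: pred_def)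
  have finF: "finite F" using finite_cells unfolding F_def by simp
  have "{w \<in> space G. low_rank_failure n m r w} \<subseteq> (\<Union>f\<in>F. E f)"
  proof safe
    fix w assume w: "w \<in> space G" "low_rank_failure n m r w"
    then obtain X H where XH: "X \<in> carrier_mat n n" "H \<in> carrier_mat n n" "vec_space.rank n X \<le> r"
      "ip (sq n) (\<lambda>e. H $$ e) (\<lambda>e. H $$ e) > 0"
      "\<And>i. i < m \<Longrightarrow> (\<Sum>k<n\<^sup>2. w (i, k) * flat n (\<lambda>e. H $$ e) k) = 0"
      "nuclear_norm (X + H) \<le> nuclear_norm X" unfolding low_rank_failure_def by blast
    have "\<And>i. i < m' \<Longrightarrow> (\<Sum>k<n\<^sup>2. w (i, k) * flat n (\<lambda>e. H $$ e) k) = 0" using XH(5) by (simp add: m'_def)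
    from near_ker_of_cell[OF XH(1,2,6,3) assms(1) XH(4) this]
    obtain f b c where f: "f \<in> cells n ?k" "unit_frame n ?k b c" "cell n ?k b c = f"
      and near: "\<And>b' c'. unit_frame n ?k b' c' \<Longrightarrow> cell n ?k b' c' = f \<Longrightarrow>
        near_ker m' (n\<^sup>2) w (flat n (frame_mat ?k b' c'))" by blast
    have "f \<in> F" using f by (auto simp: F_def Q_def intro!: exI[of _ "(b, c)"])
    moreover have "near_ker m' (n\<^sup>2) w (W f)" unfolding W_def using rep[OF calculation] by (intro near) (auto simp: Q_def)
    ultimately show "w \<in> (\<Union>f\<in>F. E f)" using w(1) by (auto simp: E_def)
  qed
  then have "emeasure G {w \<in> space G. low_rank_failure n m r w} \<le> emeasure G (\<Union>f\<in>F. E f)"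
    using E finF by (intro emeasure_mono) auto
  also have "\<dots> \<le> (\<Sum>f\<in>F. emeasure G (E f))" using E finF by (intro emeasure_subadditive_finite) auto
  also have "\<dots> \<le> (\<Sum>f\<in>F. ennreal ?p)"
  proof (rule sum_mono)
    fix f assume "f \<in> F"
    then have "ip {..<n\<^sup>2} (W f) (W f) = 1"
      unfolding W_def ip_flat using rep[of f] by (intro unit_frame_norm) (auto simp: Q_def)
    then show "emeasure G (E f) \<le> ennreal ?p"
      unfolding E_def G_def by (intro near_ker_prob) (auto simp: m'_def)
  qed
  also have "\<dots> = ennreal (real (card F) * ?p)" by (simp add: ennreal_mult ennreal_of_nat_eq_real_of_nat)
  also have "\<dots> \<le> ennreal (115 ^ (20 * (r * n)) * ?p)"
  proof (intro ennreal_leI mult_right_mono)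
    have "card F \<le> card (cells n ?k)" unfolding F_def by (intro card_mono finite_cells) auto
    then have "real (card F) \<le> real (card (cells n ?k))" by simp
    also have "\<dots> \<le> 115 ^ (2 * (?k * n))" by (rule card_cells)
    also have "2 * (?k * n) = 20 * (r * n)" by simp
    finally show "real (card F) \<le> 115 ^ (20 * (r * n))" .
  qed simp
  finally show ?thesis .
qed

section \<open>The numerical threshold and the main theorem\<close>

text \<open>Twice the decay rate per n^2 that is left when the whole budget 64/81 is spent.\<close>

definition rate :: real where "rate = ln (14 / 3) - 64 / 81 * ln 7"

text \<open>Cleared of denominators this is 7^64 < (14/3)^81, an exact rational computation.\<close>

lemma rate_pos: "rate > 0"
proof -
  have "64 * ln 7 = ln ((7::real) ^ 64)" by (subst ln_realpow) simp_all
  also have "\<dots> < ln ((14 / 3) ^ 81)" by (subst ln_less_cancel_iff) (simp_all add: power_divide)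
  also have "\<dots> = 81 * ln (14 / 3 :: real)" by (subst ln_realpow) simp_all
  finally show ?thesis by (simp add: rate_def)
qed

text \<open>The factor is 40 (50/199) / 25: \<beta> will be at most c^2 (50/199), and 40 \<beta> ln
  115 has to fit into 25 c^2 ln 7.\<close>

lemma entropy_const_le: "8 / 199 * 10 * ln 115 \<le> ln (7::real)"
proof -
  have "80 * ln 115 = ln ((115::real) ^ 80)" by (subst ln_realpow) simp_all
  also have "\<dots> \<le> ln (7 ^ 199)" by (subst ln_le_cancel_iff) simp_all
  also have "\<dots> = 199 * ln (7 :: real)" by (subst ln_realpow) simp_all
  finally show ?thesis by simp
qed

lemma admissible_gap_le:
  assumes \<beta>: "0 \<le> \<beta>" "\<beta> \<le> 1" and adm: "\<epsilon> \<in> admissible_eps \<beta>"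
  shows "5 * sqrt (2 * \<beta> * (2 - \<beta>)) < 8 / (3 * pi)"
    "f_strong \<beta> \<epsilon> - g_strong \<beta> \<epsilon> \<le> 8 / (3 * pi) - 5 * sqrt (2 * \<beta> * (2 - \<beta>))"
proof -
  define b c where "b = 8 / (3 * pi)" and "c = sqrt (2 * \<beta> * (2 - \<beta>))"
  have b: "b > 0" and c: "c \<ge> 0" using \<beta> by (auto simp: b_def c_def)
  have e: "\<epsilon> > 0" and f: "f_strong \<beta> \<epsilon> > 0" and fg: "f_strong \<beta> \<epsilon> - g_strong \<beta> \<epsilon> > 0"
    using adm admissible_eps_iff_f_pos[OF \<beta>] by auto
  define y where "y = 4 * \<epsilon>"
  define a where "a = (1 - \<beta>) powr (3/2) - \<beta> powr (3/2) - y"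
  have y: "y > 0" using e by (simp add: y_def)
  have fa: "f_strong \<beta> \<epsilon> = b * (a / (1 + y))" by (simp add: f_strong_def b_def a_def y_def)
  have "a > 0" using f b y unfolding fa by (simp add: zero_less_mult_iff zero_less_divide_iff)
  have "(1 - \<beta>) powr (3/2) \<le> 1" using \<beta> by (intro powr_le1) auto
  then have a: "a \<le> 1 - y" unfolding a_def using powr_ge_zero[of \<beta> "3/2"] by linarith
  then have y1: "y < 1" using \<open>a > 0\<close> by linarith
  have "a / (1 + y) \<le> a / 1" using \<open>a > 0\<close> y by (intro divide_left_mono) auto
  then have "f_strong \<beta> \<epsilon> \<le> b * (1 - y)" unfolding fa using a b by (intro mult_left_mono) auto
  moreover have "c * (5 * (1 - y)) \<le> g_strong \<beta> \<epsilon>"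
  proof -
    \<comment> \<open>The logarithm is split as ln(30 pi) - ln(5 y) and ln(5 y) is replaced by its
      tangent 5 y - 1; the constant works because exp 4 <= 81 < 30 pi.\<close>
    have "(4::real) = ln (exp 1 ^ 4)" by (simp add: ln_realpow)
    also have "\<dots> \<le> ln (3 ^ 4)" using power_mono[OF exp_le, of 4] by (subst ln_le_cancel_iff) simp_all
    also have "\<dots> \<le> ln (30 * pi)" using pi_gt3 by (subst ln_le_cancel_iff) auto
    finally have "4 \<le> ln (30 * pi)" .
    moreover have "ln (5 * y) \<le> 5 * y - 1" using y by (intro ln_le_minus_one) auto
    ultimately have *: "5 * (1 - y) \<le> ln (30 * pi) - ln (5 * y)" unfolding right_diff_distrib by linarith
    have "3 * pi / (2 * \<epsilon>) = (30 * pi) / (5 * y)" using e by (simp add: y_def field_simps)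
    then have "ln (3 * pi / (2 * \<epsilon>)) = ln ((30 * pi) / (5 * y))" by (simp only:)
    then have "ln (3 * pi / (2 * \<epsilon>)) = ln (30 * pi) - ln (5 * y)" using y ln_div[of "30 * pi" "5 * y"] by simp
    with * have "5 * (1 - y) \<le> ln (3 * pi / (2 * \<epsilon>))" by (simp only:)
    then show ?thesis unfolding g_strong_def c_def[symmetric] using c by (intro mult_left_mono)
  qed
  ultimately have le: "f_strong \<beta> \<epsilon> - g_strong \<beta> \<epsilon> \<le> (1 - y) * (b - 5 * c)"
    by (simp add: algebra_simps)
  then have "(1 - y) * (b - 5 * c) > 0" using fg by linarith
  then have pos: "b - 5 * c > 0" using y1 by (simp add: zero_less_mult_iff)
  then show "5 * sqrt (2 * \<beta> * (2 - \<beta>)) < 8 / (3 * pi)" by (simp add: b_def c_def)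
  have "(1 - y) * (b - 5 * c) \<le> 1 * (b - 5 * c)" using y pos by (intro mult_right_mono) auto
  then show "f_strong \<beta> \<epsilon> - g_strong \<beta> \<epsilon> \<le> 8 / (3 * pi) - 5 * sqrt (2 * \<beta> * (2 - \<beta>))"
    using le by (simp add: b_def c_def)
qed

text \<open>\<open>K\<close> is (b - 5 c)^2, an upper bound for the relative dimension of the
  kernel. The separate bound 64/81 later shows \<mu> > 0.\<close>

lemma strong_bound_consequence:
  assumes \<beta>: "0 \<le> \<beta>" "\<beta> \<le> 1" and sb: "strong_bound \<mu> \<beta>"
  obtains K where "0 \<le> K" "1 - \<mu> \<le> K" "K \<le> 64 / 81" "40 * \<beta> * ln 115 + K * ln 7 \<le> 64 / 81 * ln 7"
proof -
  define b c where "b = 8 / (3 * pi)" and "c = sqrt (2 * \<beta> * (2 - \<beta>))"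
  obtain \<epsilon> where adm: "\<epsilon> \<in> admissible_eps \<beta>" using sb by (auto simp: strong_bound_def)
  have c: "0 \<le> c" "5 * c < b" using admissible_gap_le(1)[OF \<beta> adm] \<beta> by (auto simp: b_def c_def)
  have b: "b > 0" "b \<le> 8 / 9" using pi_gt3 by (auto simp: b_def field_simps)
  have b2: "b\<^sup>2 \<le> (8 / 9)\<^sup>2" using b by (intro power_mono) auto
  define K where "K = (b - 5 * c)\<^sup>2"
  have "(SUP \<epsilon>\<in>admissible_eps \<beta>. (f_strong \<beta> \<epsilon> - g_strong \<beta> \<epsilon>)\<^sup>2) \<le> K"
  proof (rule cSUP_least)
    show "admissible_eps \<beta> \<noteq> {}" using adm by auto
    fix \<epsilon> assume e: "\<epsilon> \<in> admissible_eps \<beta>"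
    then show "(f_strong \<beta> \<epsilon> - g_strong \<beta> \<epsilon>)\<^sup>2 \<le> K"
      unfolding K_def b_def c_def using admissible_gap_le(2)[OF \<beta> e]
      by (intro power_mono) (auto simp: admissible_eps_def)
  qed
  then have K1: "1 - \<mu> \<le> K" using sb by (simp add: strong_bound_def)
  have K2: "K \<le> b\<^sup>2" unfolding K_def using c by (intro power_mono) auto
  have c2: "c\<^sup>2 = 2 * \<beta> * (2 - \<beta>)" using \<beta> by (simp add: c_def)
  \<comment> \<open>Bootstrapping: each bound on \<beta> improves the lower bound on 2 - \<beta>,
    from \<beta> <= c^2 over \<beta> <= 1/25 and \<beta> <= 1/100 to \<beta> <= c^2
    (50/199).\<close>
  have "\<beta> \<le> 2 * \<beta> * (2 - \<beta>)" using mult_left_mono[of "1/2" "2 - \<beta>" "2 * \<beta>"] \<beta> by simp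
  then have "\<beta> \<le> c\<^sup>2" by (simp add: c2)
  have "25 * c\<^sup>2 \<le> b\<^sup>2" using power_mono[of "5 * c" b 2] c by (simp add: power_mult_distrib)
  then have "c\<^sup>2 \<le> 64 / 81 / 25" using b2 by (simp add: power2_eq_square)
  then have "\<beta> \<le> 1 / 25" using \<open>\<beta> \<le> c\<^sup>2\<close> by linarith
  then have "2 * \<beta> * (49 / 25) \<le> c\<^sup>2" unfolding c2 using \<beta> by (intro mult_left_mono) auto
  then have "\<beta> \<le> 1 / 100" using \<open>c\<^sup>2 \<le> 64 / 81 / 25\<close> by linarith
  then have "2 * \<beta> * (199 / 100) \<le> c\<^sup>2" unfolding c2 using \<beta> by (intro mult_left_mono) auto
  then have \<beta>c: "\<beta> \<le> c\<^sup>2 * (50 / 199)" by linarith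
  have l115: "ln (115::real) \<ge> 0" and l7: "ln (7::real) \<ge> 0" by simp_all
  have "40 * \<beta> * ln 115 \<le> 40 * (c\<^sup>2 * (50 / 199)) * ln 115"
    using \<beta>c l115 by (intro mult_right_mono) auto
  also have "\<dots> = 25 * c\<^sup>2 * (8 / 199 * 10 * ln 115)" by simp
  also have "\<dots> \<le> 25 * c\<^sup>2 * ln 7" using entropy_const_le by (intro mult_left_mono) auto
  finally have "40 * \<beta> * ln 115 + K * ln 7 \<le> (25 * c\<^sup>2 + K) * ln 7" by (simp add: algebra_simps)
  also have "\<dots> \<le> 64 / 81 * ln 7"
  proof (intro mult_right_mono l7)
    have "25 * c\<^sup>2 + K = b\<^sup>2 - 2 * (5 * c) * (b - 5 * c)" by (simp add: K_def power2_eq_square algebra_simps)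
    moreover have "2 * (5 * c) * (b - 5 * c) \<ge> 0" using c by (intro mult_nonneg_nonneg) auto
    ultimately show "25 * c\<^sup>2 + K \<le> 64 / 81" using b2 by (simp add: power2_eq_square)
  qed
  finally show ?thesis using that[of K] K1 K2 b2 by (simp add: K_def power2_eq_square)
qed

text \<open>Per n^2/2 the exponent gains ln(14/3). A dimension that passes to the kernel changes its
  factor from (14/3)^(-1/2) to (2/3)^(-1/2), a loss of ln 7 in the same unit, and the net costs 40
  \<beta> ln 115.\<close>

lemma failure_bound_le:
  assumes r: "real r \<le> \<beta> * real n" and m': "m' \<le> n\<^sup>2" "real (n\<^sup>2 - m') \<le> K * (real n)\<^sup>2"
    and K: "40 * \<beta> * ln 115 + K * ln 7 \<le> 64 / 81 * ln 7"
  shows "115 ^ (20 * (r * n)) * chernoff_bound m' (n\<^sup>2)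
    \<le> exp (- (rate / 2) * (real n)\<^sup>2)"
proof -
  define d where "d = real (n\<^sup>2 - m')"
  have m: "real m' = (real n)\<^sup>2 - d" using m'(1) by (simp add: d_def of_nat_diff)
  have "115 ^ (20 * (r * n)) = exp (20 * (real r * real n) * ln 115)"
    by (simp add: powr_realpow[symmetric] powr_def)
  then have "115 ^ (20 * (r * n)) * chernoff_bound m' (n\<^sup>2)
      = exp (20 * (real r * real n) * ln 115 + (- real m' / 2 * ln (14 / 3) + - d / 2 * ln (2 / 3)))"
  proof -
    have "(14 / 3) powr (- real m' / 2) = exp (- real m' / 2 * ln (14 / 3))"
      "(2 / 3) powr (- real (n\<^sup>2 - m') / 2) = exp (- d / 2 * ln (2 / 3))" by (simp_all add: powr_def d_def)
    then show ?thesis using \<open>115 ^ (20 * (r * n)) = _\<close> by (simp only: chernoff_bound_def exp_add)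
  qed
  also have "\<dots> \<le> exp (- (rate / 2) * (real n)\<^sup>2)"
  proof (subst exp_le_cancel_iff)
    have "ln (14 / 3 :: real) = ln (7 * (2 / 3))" by simp
    also have "\<dots> = ln 7 + ln (2 / 3)" by (rule ln_mult_pos) auto
    finally have l: "ln (2 / 3 :: real) = ln (14 / 3) - ln 7" by simp
    have "real r * real n \<le> \<beta> * (real n)\<^sup>2"
      using mult_right_mono[OF r, of "real n"] by (simp add: power2_eq_square mult.assoc)
    then have i1: "20 * (real r * real n) * ln 115 \<le> 20 * (\<beta> * (real n)\<^sup>2) * ln 115"
      by (intro mult_right_mono mult_left_mono) auto
    have i2: "d * ln 7 \<le> K * (real n)\<^sup>2 * ln 7" using m'(2) unfolding d_def by (intro mult_right_mono) auto
    have i3: "(40 * \<beta> * ln 115 + K * ln 7) * (real n)\<^sup>2 \<le> (64 / 81 * ln 7) * (real n)\<^sup>2"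
      using K by (intro mult_right_mono) auto
    show "20 * (real r * real n) * ln 115 + (- real m' / 2 * ln (14 / 3) + - d / 2 * ln (2 / 3))
        \<le> - (rate / 2) * (real n)\<^sup>2"
    proof -
      have "20 * p * a + (- (N - e) / 2 * x + - e / 2 * (x - y)) \<le> - ((x - 64 / 81 * y) / 2) * N"
        if "20 * p * a \<le> 20 * (\<beta> * N) * a" "e * y \<le> K * N * y" "(40 * \<beta> * a + K * y) * N \<le> (64 / 81 * y) * N"
        for p a N e x y :: real
      proof -
        have "20 * p * a + (- (N - e) / 2 * x + - e / 2 * (x - y)) = 20 * p * a + e * y / 2 - N * x / 2"
          by (simp add: field_simps)
        also have "\<dots> \<le> (40 * \<beta> * a + K * y) * N / 2 - N * x / 2" using that(1,2) by (simp add: field_simps)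
        also have "\<dots> \<le> (64 / 81 * y) * N / 2 - N * x / 2" using that(3) by linarith
        also have "\<dots> = - ((x - 64 / 81 * y) / 2) * N" by (simp add: field_simps)
        finally show ?thesis .
      qed
      from this[OF i1 i2 i3] show ?thesis unfolding l m rate_def .
    qed
  qed
  finally show ?thesis .
qed

lemma gaussian_recovery:
  assumes \<beta>: "0 \<le> \<beta>" "\<beta> \<le> 1" and sb: "strong_bound \<mu> \<beta>" and m: "real m = \<mu> * (real n)\<^sup>2"
  defines "G \<equiv> gaussian_ensemble m (n\<^sup>2)"
  shows "{w \<in> space G. recovers_low_rank n \<beta> (Matrix.mat m (n\<^sup>2) w)} \<in> sets G"
    and "measure G {w \<in> space G. \<not> recovers_low_rank n \<beta> (Matrix.mat m (n\<^sup>2) w)} \<le> exp (- (rate / 2) * (real n)\<^sup>2)"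
proof -
  define r where "r = nat \<lfloor>\<beta> * real n\<rfloor>"
  have G: "G = gauss ({..<m} \<times> {..<n\<^sup>2})" by (simp add: G_def gaussian_ensemble_def)
  interpret G: prob_space G unfolding G by (rule prob_space_gauss)
  have eq: "recovers_low_rank n \<beta> (Matrix.mat m (n\<^sup>2) w) \<longleftrightarrow> \<not> low_rank_failure n m r w" for w
    unfolding r_def by (rule recovers_low_rank_iff[OF \<beta>(1)])
  have meas[measurable]: "Measurable.pred G (low_rank_failure n m r)" unfolding G by (rule pred_low_rank_failure)
  show "{w \<in> space G. recovers_low_rank n \<beta> (Matrix.mat m (n\<^sup>2) w)} \<in> sets G" unfolding eq by measurable
  show "measure G {w \<in> space G. \<not> recovers_low_rank n \<beta> (Matrix.mat m (n\<^sup>2) w)} \<le> exp (- (rate / 2) * (real n)\<^sup>2)"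
  proof (cases "r = 0")
    case True
    then show ?thesis using no_rank_0_failure by (simp add: eq)
  next
    case False
    obtain K where K: "0 \<le> K" "1 - \<mu> \<le> K" "40 * \<beta> * ln 115 + K * ln 7 \<le> 64 / 81 * ln 7"
      using strong_bound_consequence[OF \<beta> sb] by metis
    define m' where "m' = min m (n\<^sup>2)"
    \<comment> \<open>For \<mu> > 1 there can be more rows than columns; then \<open>m'\<close> is
      n^2 and no dimension is left for the kernel.\<close>
    have "real (n\<^sup>2 - m') \<le> K * (real n)\<^sup>2"
    proof (cases "m \<le> n\<^sup>2")
      case True
      then have "real (n\<^sup>2 - m') = (1 - \<mu>) * (real n)\<^sup>2" using m by (simp add: m'_def of_nat_diff algebra_simps)
      then show ?thesis using K by (simp add: mult_right_mono)
    next
      case False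
      then show ?thesis using K by (simp add: m'_def)
    qed
    moreover have "real r \<le> \<beta> * real n" unfolding r_def using \<beta> by simp
    ultimately have "115 ^ (20 * (r * n)) * chernoff_bound m' (n\<^sup>2)
        \<le> exp (- (rate / 2) * (real n)\<^sup>2)"
      by (intro failure_bound_le[OF _ _ _ K(3)]) (auto simp: m'_def)
    then have "emeasure G {w \<in> space G. low_rank_failure n m r w} \<le> ennreal (exp (- (rate / 2) * (real n)\<^sup>2))"
      using low_rank_failure_prob[of r m n] False unfolding G m'_def[symmetric]
      by (meson ennreal_leI gr0I order_trans)
    then show ?thesis unfolding eq by (simp add: G.emeasure_eq_measure)
  qed
qed

section \<open>Transfer to Gaussian matrices on an arbitrary probability space\<close>

text \<open>The entries, restricted to the index set, have the product law. Both dimensions are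
  positive since the characterization of independence by product laws is applied with a nonempty
  index set.\<close>

lemma gaussian_random_matrix_distr:
  assumes "prob_space M" and A: "gaussian_random_matrix M m k A" and "m > 0" "k > 0"
  defines "I \<equiv> {..<m} \<times> {..<k}"
  shows "(\<lambda>\<omega>. \<lambda>ij\<in>I. A \<omega> $$ ij) \<in> M \<rightarrow>\<^sub>M gaussian_ensemble m k"
    and "distr M (gaussian_ensemble m k) (\<lambda>\<omega>. \<lambda>ij\<in>I. A \<omega> $$ ij) = gaussian_ensemble m k"
proof -
  interpret prob_space M by fact
  let ?X = "\<lambda>ij \<omega>. A \<omega> $$ ij"
  have ind: "indep_vars (\<lambda>_. borel) ?X I" and dens: "\<And>ij. ij \<in> I \<Longrightarrow> distributed M lborel (?X ij) std_normal_density"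
    using A by (auto simp: gaussian_random_matrix_def I_def)
  have rv: "random_variable borel (?X ij)" if "ij \<in> I" for ij
    using distributed_measurable[OF dens[OF that]] by simp
  have D: "distr M borel (?X ij) = \<gamma>" if "ij \<in> I" for ij
    using distributed_distr_eq_density[OF dens[OF that]] by (simp cong: distr_cong)
  have sets: "sets (gaussian_ensemble m k) = sets (Pi\<^sub>M I (\<lambda>_. borel :: real measure))"
    unfolding gaussian_ensemble_def I_def by (intro sets_PiM_cong) auto
  have "(\<lambda>\<omega>. \<lambda>ij\<in>I. ?X ij \<omega>) \<in> M \<rightarrow>\<^sub>M Pi\<^sub>M I (\<lambda>_. borel :: real measure)"
    by (intro measurable_restrict rv)
  then show meas: "(\<lambda>\<omega>. \<lambda>ij\<in>I. A \<omega> $$ ij) \<in> M \<rightarrow>\<^sub>M gaussian_ensemble m k"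
    using sets by (simp cong: measurable_cong_sets)
  have "I \<noteq> {}" using \<open>m > 0\<close> \<open>k > 0\<close> by (auto simp: I_def)
  have "distr M (gaussian_ensemble m k) (\<lambda>\<omega>. \<lambda>ij\<in>I. ?X ij \<omega>) = distr M (Pi\<^sub>M I (\<lambda>_. borel)) (\<lambda>\<omega>. \<lambda>ij\<in>I. ?X ij \<omega>)"
    using sets by (intro distr_cong) auto
  also have "\<dots> = Pi\<^sub>M I (\<lambda>ij. distr M borel (?X ij))"
    using indep_vars_iff_distr_eq_PiM'[OF \<open>I \<noteq> {}\<close> rv] ind by simp
  also have "\<dots> = gaussian_ensemble m k"
    unfolding gaussian_ensemble_def I_def[symmetric] by (intro PiM_cong D refl)
  finally show "distr M (gaussian_ensemble m k) (\<lambda>\<omega>. \<lambda>ij\<in>I. A \<omega> $$ ij) = gaussian_ensemble m k" .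
qed

lemma gaussian_random_matrix_recovery:
  assumes \<beta>: "0 \<le> \<beta>" "\<beta> \<le> 1" and sb: "strong_bound \<mu> \<beta>" and m: "real m = \<mu> * (real n)\<^sup>2" and "n > 0"
    and "prob_space M" and A: "gaussian_random_matrix M m (n\<^sup>2) A"
  shows "{\<omega> \<in> space M. \<not> recovers_low_rank n \<beta> (A \<omega>)} \<in> sets M"
    and "measure M {\<omega> \<in> space M. \<not> recovers_low_rank n \<beta> (A \<omega>)} \<le> exp (- (rate / 2) * (real n)\<^sup>2)"
proof -
  interpret prob_space M by fact
  let ?I = "{..<m} \<times> {..<n\<^sup>2}" and ?G = "gaussian_ensemble m (n\<^sup>2)"
  let ?R = "\<lambda>\<omega>. \<lambda>ij\<in>?I. A \<omega> $$ ij"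
  let ?B = "{w \<in> space ?G. \<not> recovers_low_rank n \<beta> (Matrix.mat m (n\<^sup>2) w)}"
  obtain K where "1 - \<mu> \<le> K" "K \<le> 64 / 81" using strong_bound_consequence[OF \<beta> sb] by metis
  \<comment> \<open>In fact \<mu> >= 17/81; so there is at least one row.\<close>
  then have "\<mu> > 0" by linarith
  then have "m > 0" using m \<open>n > 0\<close> by (metis gr0I less_numeral_extra(3) mult_pos_pos of_nat_0 of_nat_0_less_iff zero_less_power)
  note R = gaussian_random_matrix_distr[OF \<open>prob_space M\<close> A \<open>m > 0\<close>]
  have meas: "?R \<in> M \<rightarrow>\<^sub>M ?G" and distr: "distr M ?G ?R = ?G" using R \<open>n > 0\<close> by simp_all
  have B: "?B \<in> sets ?G"
  proof -
    have "?B = space ?G - {w \<in> space ?G. recovers_low_rank n \<beta> (Matrix.mat m (n\<^sup>2) w)}" by auto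
    then show ?thesis using gaussian_recovery(1)[OF \<beta> sb m] by simp
  qed
  have "Matrix.mat m (n\<^sup>2) (?R \<omega>) = A \<omega>" if "\<omega> \<in> space M" for \<omega>
    using A that by (intro eq_matI) (auto simp: gaussian_random_matrix_def)
  then have pre: "?R -` ?B \<inter> space M = {\<omega> \<in> space M. \<not> recovers_low_rank n \<beta> (A \<omega>)}"
    using measurable_space[OF meas] by auto
  show "{\<omega> \<in> space M. \<not> recovers_low_rank n \<beta> (A \<omega>)} \<in> sets M"
    unfolding pre[symmetric] by (rule measurable_sets[OF meas B])
  have "measure M {\<omega> \<in> space M. \<not> recovers_low_rank n \<beta> (A \<omega>)} = measure (distr M ?G ?R) ?B"
    unfolding pre[symmetric] by (rule measure_distr[OF meas B, symmetric])
  also have "\<dots> \<le> exp (- (rate / 2) * (real n)\<^sup>2)" unfolding distr by (rule gaussian_recovery(2)[OF \<beta> sb m])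
  finally show "measure M {\<omega> \<in> space M. \<not> recovers_low_rank n \<beta> (A \<omega>)} \<le> exp (- (rate / 2) * (real n)\<^sup>2)" .
qed

theorem theorem1p3:
  fixes \<mu> \<beta> :: real
    and M :: "'w measure"
    and A :: "nat \<Rightarrow> 'w \<Rightarrow> real mat"
  assumes "0 \<le> \<beta>" and "\<beta> \<le> 1"
    and "strong_bound \<mu> \<beta>"
  shows "(\<exists>c > 0. \<forall>n m. n > 0 \<longrightarrow> real m = \<mu> * (real n)\<^sup>2 \<longrightarrow>
            \<P>(w in gaussian_ensemble m (n\<^sup>2). recovers_low_rank n \<beta> (Matrix.mat m (n\<^sup>2) w))
              > 1 - exp (- c * (real n)\<^sup>2))
       \<and> (prob_space M \<longrightarrow>
            (\<forall>n m. n > 0 \<longrightarrow> real m = \<mu> * (real n)\<^sup>2 \<longrightarrow> gaussian_random_matrix M m (n\<^sup>2) (A n)) \<longrightarrow>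
            (AE \<omega> in M. \<forall>\<^sub>F n in sequentially.
               \<forall>m. real m = \<mu> * (real n)\<^sup>2 \<longrightarrow> recovers_low_rank n \<beta> (A n \<omega>)))"
proof (intro conjI impI)
  show "\<exists>c > 0. \<forall>n m. n > 0 \<longrightarrow> real m = \<mu> * (real n)\<^sup>2 \<longrightarrow>
            \<P>(w in gaussian_ensemble m (n\<^sup>2). recovers_low_rank n \<beta> (Matrix.mat m (n\<^sup>2) w))
              > 1 - exp (- c * (real n)\<^sup>2)"
  \<comment> \<open>Half of the proved rate: the slack turns the weak failure bound into a strict
    one for n > 0.\<close>
  proof (intro exI[of _ "rate / 4"] conjI allI impI)
    show "rate / 4 > 0" using rate_pos by simp
    fix n m :: nat
    assume "n > 0" and m: "real m = \<mu> * (real n)\<^sup>2"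
    let ?G = "gaussian_ensemble m (n\<^sup>2)"
    let ?B = "{w \<in> space ?G. \<not> recovers_low_rank n \<beta> (Matrix.mat m (n\<^sup>2) w)}"
    interpret G: prob_space ?G unfolding gaussian_ensemble_def by (rule prob_space_gauss)
    note rec = gaussian_recovery[OF assms m]
    have "\<P>(w in ?G. recovers_low_rank n \<beta> (Matrix.mat m (n\<^sup>2) w)) = 1 - measure ?G ?B"
      using G.prob_neg[OF rec(1)] by simp
    moreover have "measure ?G ?B < exp (- (rate / 4) * (real n)\<^sup>2)"
      using rec(2) rate_pos \<open>n > 0\<close> by (rule_tac le_less_trans) auto
    ultimately show "\<P>(w in ?G. recovers_low_rank n \<beta> (Matrix.mat m (n\<^sup>2) w)) > 1 - exp (- (rate / 4) * (real n)\<^sup>2)"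
      by linarith
  qed
next
  assume "prob_space M"
    and gauss: "\<forall>n m. n > 0 \<longrightarrow> real m = \<mu> * (real n)\<^sup>2 \<longrightarrow> gaussian_random_matrix M m (n\<^sup>2) (A n)"
  interpret prob_space M by fact
  \<comment> \<open>Empty for those n at which \<mu> n^2 is not a natural number; there the
    conclusion is vacuous.\<close>
  define B where "B = (\<lambda>n. if n > 0 \<and> (\<exists>m::nat. real m = \<mu> * (real n)\<^sup>2)
    then {\<omega> \<in> space M. \<not> recovers_low_rank n \<beta> (A n \<omega>)} else {})"
  have B: "B n \<in> sets M" "measure M (B n) \<le> exp (- (rate / 2)) ^ n" for n
  proof -
    show "B n \<in> sets M"
      using gaussian_random_matrix_recovery(1)[OF assms, of _ n M "A n"] gauss \<open>prob_space M\<close> by (auto simp: B_def)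
    \<comment> \<open>Since n <= n^2, a geometric series dominates. Its summability gives the almost
      sure statement under any coupling of the matrices \<open>A n\<close>.\<close>
    have "exp (- (rate / 2) * (real n)\<^sup>2) \<le> exp (- (rate / 2)) ^ n"
    proof -
      have "real n \<le> (real n)\<^sup>2" by (simp add: power2_eq_square flip: of_nat_mult)
      then have "rate / 2 * real n \<le> rate / 2 * (real n)\<^sup>2" using rate_pos by (intro mult_left_mono) auto
      then show ?thesis by (simp add: exp_of_nat_mult[symmetric] mult.commute)
    qed
    then show "measure M (B n) \<le> exp (- (rate / 2)) ^ n"
      using gaussian_random_matrix_recovery(2)[OF assms, of _ n M "A n"] gauss \<open>prob_space M\<close>
      by (auto simp: B_def intro: order_trans)
  qed
  have "summable (\<lambda>n. measure M (B n))"
    by (rule summable_comparison_test'[where g = "\<lambda>n. exp (- (rate / 2)) ^ n" and N = 0])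
       (use B rate_pos in \<open>auto intro!: summable_geometric\<close>)
  then have "AE \<omega> in M. \<forall>\<^sub>F n in sequentially. \<omega> \<in> space M - B n"
    using B by (intro borel_cantelli_AE1) (auto simp: emeasure_eq_measure)
  then show "AE \<omega> in M. \<forall>\<^sub>F n in sequentially. \<forall>m. real m = \<mu> * (real n)\<^sup>2 \<longrightarrow> recovers_low_rank n \<beta> (A n \<omega>)"
  proof eventually_elim
    case (elim \<omega>)
    show ?case using elim eventually_gt_at_top[of 0]
      by eventually_elim (auto simp: B_def split: if_splits)
  qed
qed

end
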